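(* Let $\{X_i\}$ be a sequence of 2-spheres endowed with metrics of curvature at least $-1$ in the sense of Alexandrov (CBB($-1$) metrics). Assume that $\{X_i\}$ converges in the Gromov-Hausdorff sense to a non-degenerate closed segment $I$. Let $\{d_i\}$ be a sequence of metrics on the disjoint unions $I\sqcup X_i$ extending the given metrics on $I$ and on $X_i$, and such that the Hausdorff distances satisfy $d_{i,H}(I,X_i)\to 0$ as $i\to\infty$. For $x\in I$ and $\varepsilon>0$ put $\mathcal{B}_{i,x}(\varepsilon)=\{y\in X_i : d_i(x,y)<\varepsilon\}$. Cohomology is taken with coefficients in a field. (1) Let $\kappa>0$ and $0<\varepsilon_1<\varepsilon_2<\frac{\kappa}{100}$. Then there exists $i_0$ such that for every $i>i_0$ and every $x\in I$ with $\mathrm{dist}(x,\partial I)>\kappa$ one has $$\dim \mathrm{Im}\left[H^a(\mathcal{B}_{i,x}(\varepsilon_2))\to H^a(\mathcal{B}_{i,x}(\varepsilon_1))\right]=\begin{cases}1 & \text{if } a=0,1,\\ 0&\text{otherwise.}\end{cases}$$ (2) Let $x\in\partial I$ and $0<\varepsilon_1<\varepsilon_2<\frac{1}{100}\mathrm{length}(I)$. Then for all large $i$ one has $$\dim \mathrm{Im}\left[H^a(\mathcal{B}_{i,x}(\varepsilon_2))\to H^a(\mathcal{B}_{i,x}(\varepsilon_1))\right]=\begin{cases}1 & \text{if } a=0,\\ 0&\text{otherwise.}\end{cases}$$ Here the maps are those induced by the inclusion $\mathcal{B}_{i,x}(\varepsilon_1)\subset\mathcal{B}_{i,x}(\vare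psilon_2)$.
   Context: CBB($-1$) metric (curvature at least $-1$ in the sense of Alexandrov) on a surface $S$: a complete intrinsic (length) metric $d$ inducing the topology of $S$ such that each point $x\in S$ has a neighborhood $U$ with the following property. For any two shortest paths $\psi,\chi$ issuing from $x$, let $y\in\psi$ and $z\in\chi$ be the points at distances $a$ and $b$ from $x$, and let $\lambda(a,b)$ be the angle opposite to the side of length $d(y,z)$ in the hyperbolic plane triangle (curvature $-1$) with side lengths $a,b,d(y,z)$; then $\lambda(a,b)$ is a nonincreasing function of $a$ and of $b$ in the range $a\in[0,a_0]$, $b\in[0,b_0]$ where $y,z\in U$. For a metric $d_i$ on a disjoint union, $d_{i,H}$ denotes the Hausdorff distance between subsets with respect to $d_i$. $\partial I$ is the set of the two endpoints of $I$. *)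

theory Defs
  imports
    "HOL-Analysis.Analysis"
    "HOL-Homology.Homology"
    "Jordan_Normal_Form.VS_Connect"
begin

section \<open>Singular cohomology with coefficients in a field\<close>

text \<open>
  A \<open>p\<close>-cochain is a function on singular \<open>p\<close>-simplices with values in the coefficient field,
  extended by \<open>0\<close> to all functions that are not singular simplices of the space.  With this
  convention a cochain of \<open>X\<close> is determined by its values on the simplices of \<open>X\<close>.
\<close>

type_synonym ('a, 'k) cochain = "((nat \<Rightarrow> real) \<Rightarrow> 'a) \<Rightarrow> 'k"

definition cochains :: "nat \<Rightarrow> 'a topology \<Rightarrow> ('a, 'k::field) cochain set" where
  "cochains p X = {\<phi>. \<forall>\<sigma>. \<not> singular_simplex p X \<sigma> \<longrightarrow> \<phi> \<sigma> = 0}"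

definition coboundary ::
  "nat \<Rightarrow> 'a topology \<Rightarrow> ('a, 'k::field) cochain \<Rightarrow> ('a, 'k) cochain" where
  "coboundary p X \<phi> = (\<lambda>\<sigma>. if singular_simplex (Suc p) X \<sigma>
     then (\<Sum>k\<le>Suc p. (-1) ^ k * \<phi> (singular_face (Suc p) k \<sigma>)) else 0)"

definition cocycles :: "nat \<Rightarrow> 'a topology \<Rightarrow> ('a, 'k::field) cochain set" where
  "cocycles p X = {\<phi> \<in> cochains p X. coboundary p X \<phi> = (\<lambda>_. 0)}"

definition coboundaries :: "nat \<Rightarrow> 'a topology \<Rightarrow> ('a, 'k::field) cochain set" where
  "coboundaries p X =
     (case p of 0 \<Rightarrow> {\<lambda>_. 0} | Suc q \<Rightarrow> coboundary q X ` cochains q X)"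

definition cohomology_class ::
  "nat \<Rightarrow> 'a topology \<Rightarrow> ('a, 'k::field) cochain \<Rightarrow> ('a, 'k) cochain set" where
  "cohomology_class p X \<phi> = {\<lambda>\<sigma>. \<phi> \<sigma> + \<beta> \<sigma> | \<beta>. \<beta> \<in> coboundaries p X}"

text \<open>
  The quotient space of cocycles modulo coboundaries.  The fields \<open>mult\<close> and \<open>one\<close> of the record
  play no role in the vector space structure.
\<close>

definition cohomology ::
  "nat \<Rightarrow> 'a topology \<Rightarrow> ('k::field, ('a, 'k) cochain set) module" where
  "cohomology p X =
    \<lparr> carrier = cohomology_class p X ` cocycles p X,
      mult = undefined, one = undefined,
      zero = coboundaries p X,
      add = (\<lambda>A B. {\<lambda>\<sigma>. \<alpha> \<sigma> + \<beta> \<sigma> | \<alpha> \<beta>. \<alpha> \<in> A \<and> \<beta> \<in> B}),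
      smult = (\<lambda>c A. {\<lambda>\<sigma>. c * \<alpha> \<sigma> + \<beta> \<sigma> | \<alpha> \<beta>. \<alpha> \<in> A \<and> \<beta> \<in> coboundaries p X}) \<rparr>"

definition cochain_pullback ::
  "nat \<Rightarrow> 'a topology \<Rightarrow> ('a \<Rightarrow> 'b) \<Rightarrow> ('b, 'k::field) cochain \<Rightarrow> ('a, 'k) cochain" where
  "cochain_pullback p X f \<phi> =
     (\<lambda>\<sigma>. if singular_simplex p X \<sigma> then \<phi> (simplex_map p f \<sigma>) else 0)"

text \<open>
  The map \<open>H\<^sup>p(Y) \<rightarrow> H\<^sup>p(X)\<close> induced by a continuous \<open>f : X \<rightarrow> Y\<close>; it sends the class of \<open>\<phi>\<close>
  to the class of the pullback of \<open>\<phi>\<close>.  The union merely avoids choosing a representative.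
\<close>

definition cohomology_induced ::
  "nat \<Rightarrow> 'a topology \<Rightarrow> ('a \<Rightarrow> 'b) \<Rightarrow> ('b, 'k::field) cochain set \<Rightarrow> ('a, 'k) cochain set" where
  "cohomology_induced p X f A = (\<Union>\<phi>\<in>A. cohomology_class p X (cochain_pullback p X f \<phi>))"

definition cohomology_image ::
  "nat \<Rightarrow> 'a topology \<Rightarrow> 'b topology \<Rightarrow> ('a \<Rightarrow> 'b) \<Rightarrow> ('k::field, ('a, 'k) cochain set) module" where
  "cohomology_image p X Y f =
     (cohomology p X)\<lparr>carrier := cohomology_induced p X f ` carrier (cohomology p Y)\<rparr>"

text \<open>\<open>vectorspace.dim\<close> is meaningful only in combination with \<open>fin_dim\<close>.\<close>

definition has_dim :: "('k, 'm) ring_scheme \<Rightarrow> ('k, 'v, 'n) module_scheme \<Rightarrow> nat \<Rightarrow> bool" where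
  "has_dim K V n \<longleftrightarrow> vectorspace K V \<and> vectorspace.fin_dim K V \<and> vectorspace.dim K V = n"



definition linear_closed :: "('s \<Rightarrow> 'k::field) set \<Rightarrow> bool" where
  "linear_closed W \<longleftrightarrow> (\<lambda>_. 0) \<in> W \<and> (\<forall>\<phi>\<in>W. \<forall>\<psi>\<in>W. \<forall>c. (\<lambda>s. c * \<phi> s + \<psi> s) \<in> W)"

lemma linear_closedD:
  assumes "linear_closed W"
  shows "(\<lambda>_. 0) \<in> W"
    and "\<phi> \<in> W \<Longrightarrow> \<psi> \<in> W \<Longrightarrow> (\<lambda>s. c * \<phi> s + \<psi> s) \<in> W"
    and "\<phi> \<in> W \<Longrightarrow> \<psi> \<in> W \<Longrightarrow> (\<lambda>s. \<phi> s + \<psi> s) \<in> W"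
    and "\<phi> \<in> W \<Longrightarrow> \<psi> \<in> W \<Longrightarrow> (\<lambda>s. \<phi> s - \<psi> s) \<in> W"
    and "\<phi> \<in> W \<Longrightarrow> (\<lambda>s. c * \<phi> s) \<in> W"
    and "\<phi> \<in> W \<Longrightarrow> (\<lambda>s. - \<phi> s) \<in> W"
proof -
  show 0: "(\<lambda>_. 0) \<in> W" using assms by (auto simp: linear_closed_def)
  show 1: "(\<lambda>s. c * \<phi> s + \<psi> s) \<in> W" if "\<phi> \<in> W" "\<psi> \<in> W" for \<phi> \<psi> c
    using assms that by (auto simp: linear_closed_def)
  show "(\<lambda>s. \<phi> s + \<psi> s) \<in> W" if "\<phi> \<in> W" "\<psi> \<in> W" using 1[of \<phi> \<psi> 1] that by simp
  show "(\<lambda>s. \<phi> s - \<psi> s) \<in> W" if "\<phi> \<in> W" "\<psi> \<in> W" using 1[of \<psi> \<phi> "-1"] that by simp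
  show "(\<lambda>s. c * \<phi> s) \<in> W" if "\<phi> \<in> W" using 1[of \<phi> "\<lambda>_. 0" c] 0 that by simp
  show "(\<lambda>s. - \<phi> s) \<in> W" if "\<phi> \<in> W" using 1[of \<phi> "\<lambda>_. 0" "-1"] 0 that by simp
qed

lemma linear_closed_cochains: "linear_closed (cochains p X)"
  by (auto simp: linear_closed_def cochains_def)

lemma coboundary_linear:
  "coboundary p X (\<lambda>\<sigma>. c * \<phi> \<sigma> + \<psi> \<sigma>) = (\<lambda>\<sigma>. c * coboundary p X \<phi> \<sigma> + coboundary p X \<psi> \<sigma>)"
  by (auto simp: coboundary_def fun_eq_iff ring_distribs sum.distrib sum_distrib_left mult_ac
      simp del: sum.atMost_Suc)

lemma coboundary_zero: "coboundary p X (\<lambda>_. 0) = (\<lambda>_. 0)"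
  by (simp add: coboundary_def fun_eq_iff)

lemma linear_closed_cocycles: "linear_closed (cocycles p X)"
  using linear_closed_cochains[of p X]
  by (auto simp: linear_closed_def cocycles_def coboundary_linear coboundary_zero)

lemma linear_closed_image:
  assumes W: "linear_closed W" and T0: "T (\<lambda>_. 0) = (\<lambda>_. 0)"
    and T: "\<And>c \<phi> \<psi>. T (\<lambda>s. c * \<phi> s + \<psi> s) = (\<lambda>s. c * T \<phi> s + T \<psi> s)"
  shows "linear_closed (T ` W)"
  unfolding linear_closed_def
proof (intro conjI ballI allI)
  show "(\<lambda>_. 0) \<in> T ` W"
    using linear_closedD(1)[OF W] by (rule image_eqI[where f = T, OF T0[symmetric]])
next
  fix a b c assume "a \<in> T ` W" "b \<in> T ` W"
  then obtain \<phi> \<psi> where p: "\<phi> \<in> W" "a = T \<phi>" "\<psi> \<in> W" "b = T \<psi>" by auto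
  show "(\<lambda>s. c * a s + b s) \<in> T ` W"
    using linear_closedD(2)[OF W p(1,3)] unfolding p(2,4) T[symmetric] by (rule imageI)
qed

lemma linear_closed_coboundaries:
  "linear_closed (coboundaries p X :: ('a, 'k::field) cochain set)"
proof (cases p)
  case 0
  then show ?thesis by (auto simp: coboundaries_def linear_closed_def)
next
  case (Suc q)
  show ?thesis
    unfolding coboundaries_def Suc nat.case
    by (rule linear_closed_image[OF linear_closed_cochains coboundary_zero coboundary_linear])
qed

text \<open>Extension of a cochain to integral chains.\<close>

definition cochain_eval :: "('a, 'k::field) cochain \<Rightarrow> 'a chain \<Rightarrow> 'k" where
  "cochain_eval \<phi> c = (\<Sum>\<sigma>\<in>Poly_Mapping.keys c. of_int (poly_mapping.lookup c \<sigma>) * \<phi> \<sigma>)"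

lemma cochain_eval_superset:
  assumes "finite A" "Poly_Mapping.keys c \<subseteq> A"
  shows "cochain_eval \<phi> c = (\<Sum>\<sigma>\<in>A. of_int (poly_mapping.lookup c \<sigma>) * \<phi> \<sigma>)"
  unfolding cochain_eval_def
  by (rule sum.mono_neutral_left) (use assms in \<open>auto simp: in_keys_iff\<close>)

lemma cochain_eval_add: "cochain_eval \<phi> (c + d) = cochain_eval \<phi> c + cochain_eval \<phi> d"
proof -
  let ?A = "Poly_Mapping.keys c \<union> Poly_Mapping.keys d"
  have "Poly_Mapping.keys (c + d) \<subseteq> ?A" by (rule keys_add)
  then show ?thesis
    by (simp add: cochain_eval_superset[of ?A] lookup_add ring_distribs sum.distrib)
qed

lemma cochain_eval_zero [simp]: "cochain_eval \<phi> 0 = 0"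
  by (simp add: cochain_eval_def)

lemma cochain_eval_minus: "cochain_eval \<phi> (- c) = - cochain_eval \<phi> c"
  using cochain_eval_add[of \<phi> c "- c"] by (simp add: eq_neg_iff_add_eq_0 add.commute)

lemma cochain_eval_of [simp]: "cochain_eval \<phi> (frag_of \<sigma>) = \<phi> \<sigma>"
  by (simp add: cochain_eval_def)

lemma cochain_eval_sum: "cochain_eval \<phi> (sum f A) = (\<Sum>i\<in>A. cochain_eval \<phi> (f i))"
  by (induction A rule: infinite_finite_induct) (auto simp: cochain_eval_add)

lemma cochain_eval_sign:
  "cochain_eval \<phi> (frag_cmul ((-1) ^ k) c) = (-1) ^ k * cochain_eval \<phi> c"
  by (cases "even k") (auto simp: cochain_eval_minus)

lemma coboundary_eval:
  assumes "singular_simplex (Suc p) X \<sigma>"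
  shows "coboundary p X \<phi> \<sigma> = cochain_eval \<phi> (chain_boundary (Suc p) (frag_of \<sigma>))"
  using assms
  by (simp add: coboundary_def chain_boundary_of cochain_eval_sum cochain_eval_sign
      del: sum.atMost_Suc)

lemma cochain_eval_coboundary:
  assumes "singular_chain (Suc p) X c"
  shows "cochain_eval (coboundary p X \<phi>) c = cochain_eval \<phi> (chain_boundary (Suc p) c)"
  using assms unfolding singular_chain_def
proof (induction c rule: frag_induction)
  case (one \<sigma>)
  then show ?case by (simp add: coboundary_eval)
next
  case (diff a b)
  then show ?case
    by (simp only: diff_conv_add_uminus cochain_eval_add cochain_eval_minus chain_boundary_add
        chain_boundary_minus)
qed simp

lemma coboundary_coboundary: "coboundary (Suc p) X (coboundary p X \<phi>) = (\<lambda>_. 0)"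
proof
  fix \<sigma>
  show "coboundary (Suc p) X (coboundary p X \<phi>) \<sigma> = 0"
  proof (cases "singular_simplex (Suc (Suc p)) X \<sigma>")
    case True
    then have c: "singular_chain (Suc (Suc p)) X (frag_of \<sigma>)" by (simp add: singular_chain_of)
    then have "singular_chain (Suc p) X (chain_boundary (Suc (Suc p)) (frag_of \<sigma>))"
      by (rule singular_chain_boundary_alt)
    then show ?thesis
      using True chain_boundary_boundary_alt[OF c]
      by (simp add: coboundary_eval cochain_eval_coboundary)
  qed (simp add: coboundary_def)
qed

lemma coboundaries_subset_cocycles: "coboundaries p X \<subseteq> cocycles p X"
proof (cases p)
  case 0
  then show ?thesis
    using linear_closedD(1)[OF linear_closed_cocycles[of p X]] by (simp add: coboundaries_def)
next
  case (Suc q)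
  then show ?thesis
    by (auto simp: coboundaries_def cocycles_def coboundary_coboundary)
       (auto simp: cochains_def coboundary_def)
qed

lemma cohomology_classI:
  "\<beta> \<in> coboundaries p X \<Longrightarrow> \<eta> = (\<lambda>\<sigma>. \<phi> \<sigma> + \<beta> \<sigma>) \<Longrightarrow> \<eta> \<in> cohomology_class p X \<phi>"
  by (auto simp: cohomology_class_def)

lemma cohomology_class_eq_iff:
  "cohomology_class p X \<phi> = cohomology_class p X \<psi> \<longleftrightarrow> (\<lambda>\<sigma>. \<phi> \<sigma> - \<psi> \<sigma>) \<in> coboundaries p X"
    (is "?L \<longleftrightarrow> ?R")
proof
  note B = linear_closedD[OF linear_closed_coboundaries[of p X]]
  assume ?L
  moreover have "\<phi> \<in> cohomology_class p X \<phi>"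
    using B(1) by (force simp: cohomology_class_def)
  ultimately obtain \<beta> where "\<beta> \<in> coboundaries p X" "\<phi> = (\<lambda>\<sigma>. \<psi> \<sigma> + \<beta> \<sigma>)"
    by (auto simp: cohomology_class_def)
  then show ?R by simp
next
  note B = linear_closedD[OF linear_closed_coboundaries[of p X]]
  assume R: ?R
  have "cohomology_class p X \<phi> \<subseteq> cohomology_class p X \<psi>"
  proof
    fix \<eta> assume "\<eta> \<in> cohomology_class p X \<phi>"
    then obtain \<beta> where \<beta>: "\<beta> \<in> coboundaries p X" "\<eta> = (\<lambda>\<sigma>. \<phi> \<sigma> + \<beta> \<sigma>)"
      by (auto simp: cohomology_class_def)
    have "\<eta> = (\<lambda>\<sigma>. \<psi> \<sigma> + ((\<phi> \<sigma> - \<psi> \<sigma>) + \<beta> \<sigma>))" by (simp add: \<beta> algebra_simps)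
    then show "\<eta> \<in> cohomology_class p X \<psi>"
      using B(3)[OF R \<beta>(1)] by (intro cohomology_classI)
  qed
  moreover have "cohomology_class p X \<psi> \<subseteq> cohomology_class p X \<phi>"
  proof
    fix \<eta> assume "\<eta> \<in> cohomology_class p X \<psi>"
    then obtain \<beta> where \<beta>: "\<beta> \<in> coboundaries p X" "\<eta> = (\<lambda>\<sigma>. \<psi> \<sigma> + \<beta> \<sigma>)"
      by (auto simp: cohomology_class_def)
    have "\<eta> = (\<lambda>\<sigma>. \<phi> \<sigma> + (\<beta> \<sigma> - (\<phi> \<sigma> - \<psi> \<sigma>)))" by (simp add: \<beta> algebra_simps)
    then show "\<eta> \<in> cohomology_class p X \<phi>"
      using B(4)[OF \<beta>(1) R] by (intro cohomology_classI)
  qed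
  ultimately show ?L by blast
qed

lemma cohomology_add_class:
  "cohomology_class p X \<phi> \<oplus>\<^bsub>cohomology p X\<^esub> cohomology_class p X \<psi>
     = cohomology_class p X (\<lambda>\<sigma>. \<phi> \<sigma> + \<psi> \<sigma>)" (is "?L = ?R")
proof
  note B = linear_closedD[OF linear_closed_coboundaries[of p X]]
  show "?L \<subseteq> ?R"
  proof
    fix \<eta> assume "\<eta> \<in> ?L"
    then obtain \<beta> \<gamma> where bg: "\<beta> \<in> coboundaries p X" "\<gamma> \<in> coboundaries p X"
      "\<eta> = (\<lambda>\<sigma>. (\<phi> \<sigma> + \<beta> \<sigma>) + (\<psi> \<sigma> + \<gamma> \<sigma>))"
      by (auto simp: cohomology_def cohomology_class_def)
    then have "\<eta> = (\<lambda>\<sigma>. (\<phi> \<sigma> + \<psi> \<sigma>) + (\<beta> \<sigma> + \<gamma> \<sigma>))" by (simp add: algebra_simps)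
    then show "\<eta> \<in> ?R" using B(3)[OF bg(1,2)] by (intro cohomology_classI)
  qed
  show "?R \<subseteq> ?L"
  proof
    fix \<eta> assume "\<eta> \<in> ?R"
    then obtain \<beta> where b: "\<beta> \<in> coboundaries p X" "\<eta> = (\<lambda>\<sigma>. (\<phi> \<sigma> + \<psi> \<sigma>) + \<beta> \<sigma>)"
      by (auto simp: cohomology_class_def)
    then have "\<eta> = (\<lambda>\<sigma>. (\<phi> \<sigma> + \<beta> \<sigma>) + (\<psi> \<sigma> + (\<lambda>_. 0) \<sigma>))" by (simp add: algebra_simps)
    then show "\<eta> \<in> ?L"
      unfolding cohomology_def cohomology_class_def using B(1) b(1) by fastforce
  qed
qed

lemma cohomology_smult_class:
  "c \<odot>\<^bsub>cohomology p X\<^esub> cohomology_class p X \<phi> = cohomology_class p X (\<lambda>\<sigma>. c * \<phi> \<sigma>)"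
    (is "?L = ?R")
proof
  note B = linear_closedD[OF linear_closed_coboundaries[of p X]]
  show "?L \<subseteq> ?R"
  proof
    fix \<eta> assume "\<eta> \<in> ?L"
    then obtain \<beta> \<gamma> where bg: "\<beta> \<in> coboundaries p X" "\<gamma> \<in> coboundaries p X"
      "\<eta> = (\<lambda>\<sigma>. c * (\<phi> \<sigma> + \<beta> \<sigma>) + \<gamma> \<sigma>)"
      by (auto simp: cohomology_def cohomology_class_def)
    then have "\<eta> = (\<lambda>\<sigma>. c * \<phi> \<sigma> + (c * \<beta> \<sigma> + \<gamma> \<sigma>))" by (simp add: algebra_simps)
    then show "\<eta> \<in> ?R" using B(2)[OF bg(1,2)] by (intro cohomology_classI)
  qed
  show "?R \<subseteq> ?L"
  proof
    fix \<eta> assume "\<eta> \<in> ?R"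
    then obtain \<beta> where b: "\<beta> \<in> coboundaries p X" "\<eta> = (\<lambda>\<sigma>. c * \<phi> \<sigma> + \<beta> \<sigma>)"
      by (auto simp: cohomology_class_def)
    then have "\<eta> = (\<lambda>\<sigma>. c * (\<phi> \<sigma> + (\<lambda>_. 0) \<sigma>) + \<beta> \<sigma>)" by simp
    then show "\<eta> \<in> ?L"
      unfolding cohomology_def cohomology_class_def using B(1) b(1) by fastforce
  qed
qed

lemma cohomology_zero_class: "\<zero>\<^bsub>cohomology p X\<^esub> = cohomology_class p X (\<lambda>_. 0)"
  by (auto simp: cohomology_def cohomology_class_def)

lemma carrier_cohomology: "carrier (cohomology p X) = cohomology_class p X ` cocycles p X"
  by (simp add: cohomology_def)

lemma vectorspace_cohomology_subspace:
  fixes W :: "('a, 'k::field) cochain set"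
  assumes W: "linear_closed W"
  shows "vectorspace class_ring ((cohomology p X)\<lparr>carrier := cohomology_class p X ` W\<rparr>)"
proof -
  let ?H = "(cohomology p X)\<lparr>carrier := cohomology_class p X ` W\<rparr>"
  note W' = linear_closedD[OF W]
  have add: "x \<oplus>\<^bsub>?H\<^esub> y = x \<oplus>\<^bsub>cohomology p X\<^esub> y" for x y by simp
  have sm: "c \<odot>\<^bsub>?H\<^esub> y = c \<odot>\<^bsub>cohomology p X\<^esub> y" for c y by simp
  have z: "\<zero>\<^bsub>?H\<^esub> = cohomology_class p X (\<lambda>_. 0)" by (simp add: cohomology_zero_class)
  note s = add sm z cohomology_add_class cohomology_smult_class
  have "abelian_group ?H"
  proof (rule abelian_groupI)
    show "\<zero>\<^bsub>?H\<^esub> \<in> carrier ?H" unfolding z using W'(1) by simp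
  next
    fix x assume "x \<in> carrier ?H"
    then obtain \<phi> where \<phi>: "\<phi> \<in> W" "x = cohomology_class p X \<phi>" by auto
    show "\<exists>y\<in>carrier ?H. y \<oplus>\<^bsub>?H\<^esub> x = \<zero>\<^bsub>?H\<^esub>"
      by (rule bexI[of _ "cohomology_class p X (\<lambda>\<sigma>. - \<phi> \<sigma>)"])
         (use W'(6) \<phi> in \<open>auto simp only: s, auto\<close>)
  qed (use W'(3) in \<open>auto simp: s algebra_simps simp del: module.simps\<close>)
  moreover have "cring (class_ring :: 'k ring)"
    using class_field.field_axioms[where 'a = 'k] by (simp add: field_def domain_def)
  ultimately have "module class_ring ?H"
    by (intro moduleI)
       (use W'(5) in \<open>auto simp: s algebra_simps simp del: module.simps\<close>)
  then show ?thesis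
    unfolding vectorspace_def using class_field.field_axioms[where 'a = 'k] by (rule conjI)
qed

lemma vectorspace_cohomology:
  "vectorspace class_ring (cohomology p X :: ('k::field, ('a, 'k) cochain set) module)"
  using vectorspace_cohomology_subspace[OF linear_closed_cocycles[of p X], where p = p and X = X]
  by (simp add: carrier_cohomology[symmetric])

lemma cochain_pullback_linear:
  "cochain_pullback p X f (\<lambda>\<sigma>. c * \<phi> \<sigma> + \<psi> \<sigma>)
     = (\<lambda>\<sigma>. c * cochain_pullback p X f \<phi> \<sigma> + cochain_pullback p X f \<psi> \<sigma>)"
  by (auto simp: cochain_pullback_def)

lemma cochain_pullback_coboundary:
  assumes "continuous_map X Y f"
  shows "cochain_pullback (Suc p) X f (coboundary p Y \<phi>)
       = coboundary p X (cochain_pullback p X f \<phi>)"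
proof
  fix \<sigma>
  show "cochain_pullback (Suc p) X f (coboundary p Y \<phi>) \<sigma>
      = coboundary p X (cochain_pullback p X f \<phi>) \<sigma>"
  proof (cases "singular_simplex (Suc p) X \<sigma>")
    case True
    have "singular_simplex p X (singular_face (Suc p) k \<sigma>)
        \<and> singular_face (Suc p) k (simplex_map (Suc p) f \<sigma>)
            = simplex_map p f (singular_face (Suc p) k \<sigma>)" if "k \<le> Suc p" for k
      using singular_simplex_singular_face[OF True _ that]
        singular_face_simplex_map[of "Suc p" k f \<sigma>] that
      by (auto simp: singular_face_def simplex_map_def)
    then show ?thesis
      using True singular_simplex_simplex_map[OF True assms]
      by (simp add: cochain_pullback_def coboundary_def del: sum.atMost_Suc)
  qed (simp add: cochain_pullback_def coboundary_def)
qed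

lemma cochain_pullback_cocycles:
  assumes "continuous_map X Y f" "\<phi> \<in> cocycles p Y"
  shows "cochain_pullback p X f \<phi> \<in> cocycles p X"
proof -
  have "coboundary p X (cochain_pullback p X f \<phi>) = cochain_pullback (Suc p) X f (\<lambda>_. 0)"
    using assms(2) by (simp add: cochain_pullback_coboundary[OF assms(1), symmetric] cocycles_def)
  then show ?thesis
    by (auto simp: cocycles_def cochains_def cochain_pullback_def)
qed

lemma cochain_pullback_coboundaries:
  assumes "continuous_map X Y f" "\<beta> \<in> coboundaries p Y"
  shows "cochain_pullback p X f \<beta> \<in> coboundaries p X"
proof (cases p)
  case 0
  then show ?thesis using assms(2) by (simp add: coboundaries_def cochain_pullback_def)
next
  case (Suc q)
  then obtain \<phi> where \<phi>: "\<beta> = coboundary q Y \<phi>"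
    using assms(2) by (auto simp: coboundaries_def)
  have "cochain_pullback q X f \<phi> \<in> cochains q X"
    by (simp add: cochains_def cochain_pullback_def)
  then show ?thesis
    by (auto simp: Suc \<phi> cochain_pullback_coboundary[OF assms(1)] coboundaries_def)
qed

lemma cohomology_induced_class:
  assumes "continuous_map X Y f"
  shows "cohomology_induced p X f (cohomology_class p Y \<phi>)
       = cohomology_class p X (cochain_pullback p X f \<phi>)"
proof -
  have "cohomology_class p X (cochain_pullback p X f \<psi>)
      = cohomology_class p X (cochain_pullback p X f \<phi>)" if psi: "\<psi> \<in> cohomology_class p Y \<phi>" for \<psi>
  proof -
    obtain \<beta> where b: "\<beta> \<in> coboundaries p Y" "\<psi> = (\<lambda>\<sigma>. \<phi> \<sigma> + \<beta> \<sigma>)"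
      using psi unfolding cohomology_class_def by blast
    have "(\<lambda>\<sigma>. cochain_pullback p X f \<psi> \<sigma> - cochain_pullback p X f \<phi> \<sigma>)
        = cochain_pullback p X f \<beta>"
      by (auto simp: b cochain_pullback_def)
    then show ?thesis
      using cochain_pullback_coboundaries[OF assms b(1)] by (simp add: cohomology_class_eq_iff)
  qed
  moreover have "\<phi> \<in> cohomology_class p Y \<phi>"
    using linear_closedD(1)[OF linear_closed_coboundaries[of p Y]] by (rule cohomology_classI) simp
  ultimately show ?thesis
    unfolding cohomology_induced_def by blast
qed

lemma vectorspace_cohomology_image:
  fixes X :: "'a topology" and Y :: "'b topology"
  assumes "continuous_map X Y f"
  shows "vectorspace class_ring
    (cohomology_image p X Y f :: ('k::field, ('a, 'k) cochain set) module)"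
proof -
  let ?W = "cochain_pullback p X f ` (cocycles p Y :: ('b, 'k) cochain set)"
  have "linear_closed ?W"
    by (rule linear_closed_image[OF linear_closed_cocycles _ cochain_pullback_linear])
       (simp add: cochain_pullback_def)
  then show ?thesis
    using vectorspace_cohomology_subspace[of ?W p X]
    by (simp add: cohomology_image_def carrier_cohomology image_image
        cohomology_induced_class[OF assms])
qed


section \<open>Hausdorff and Gromov-Hausdorff distance\<close>

definition hausdorff_dist :: "'a metric \<Rightarrow> 'a set \<Rightarrow> 'a set \<Rightarrow> ennreal" where
  "hausdorff_dist m S T = Inf {ennreal r | r. r > 0 \<and>
     (\<forall>x\<in>S. \<exists>y\<in>T. mdist m x y < r) \<and> (\<forall>y\<in>T. \<exists>x\<in>S. mdist m x y < r)}"

definition extends_to_disjoint_union ::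
  "'a metric \<Rightarrow> 'b metric \<Rightarrow> ('a + 'b) metric \<Rightarrow> bool" where
  "extends_to_disjoint_union A B D \<longleftrightarrow>
     mspace D = Inl ` mspace A \<union> Inr ` mspace B \<and>
     (\<forall>x\<in>mspace A. \<forall>y\<in>mspace A. mdist D (Inl x) (Inl y) = mdist A x y) \<and>
     (\<forall>x\<in>mspace B. \<forall>y\<in>mspace B. mdist D (Inr x) (Inr y) = mdist B x y)"

definition gromov_hausdorff_dist :: "'a metric \<Rightarrow> 'b metric \<Rightarrow> ennreal" where
  "gromov_hausdorff_dist A B = Inf {hausdorff_dist D (Inl ` mspace A) (Inr ` mspace B) | D.
     extends_to_disjoint_union A B D}"

definition gromov_hausdorff_converges :: "(nat \<Rightarrow> 'a metric) \<Rightarrow> 'b metric \<Rightarrow> bool" where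
  "gromov_hausdorff_converges X Y \<longleftrightarrow> (\<lambda>i. gromov_hausdorff_dist (X i) Y) \<longlonglongrightarrow> 0"


section \<open>Angles of hyperbolic triangles\<close>

text \<open>
  The hyperbolic plane of curvature \<open>-1\<close> in the hyperboloid model, inside \<open>\<real>\<^sup>2 \<times> \<real>\<close> with the
  Minkowski form; the factor \<open>\<real>\<^sup>2\<close> is represented by the type \<^typ>\<open>complex\<close>.
\<close>

definition minkowski :: "complex \<times> real \<Rightarrow> complex \<times> real \<Rightarrow> real" where
  "minkowski u v = inner (fst u) (fst v) - snd u * snd v"

definition hyperbolic_plane :: "(complex \<times> real) set" where
  "hyperbolic_plane = {u. minkowski u u = -1 \<and> snd u > 0}"

definition hyperbolic_dist :: "complex \<times> real \<Rightarrow> complex \<times> real \<Rightarrow> real" where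
  "hyperbolic_dist u v = arcosh (- minkowski u v)"

text \<open>
  The component of \<open>v\<close> in the tangent space \<open>u\<^sup>\<bottom>\<close> at \<open>u\<close>, which is a positive multiple of the
  initial direction of the geodesic from \<open>u\<close> to \<open>v\<close>.
\<close>

definition hyperbolic_direction :: "complex \<times> real \<Rightarrow> complex \<times> real \<Rightarrow> complex \<times> real" where
  "hyperbolic_direction u v = v + minkowski u v *\<^sub>R u"

definition hyperbolic_angle ::
  "complex \<times> real \<Rightarrow> complex \<times> real \<Rightarrow> complex \<times> real \<Rightarrow> real" where
  "hyperbolic_angle v u w =
     (let s = hyperbolic_direction u v; t = hyperbolic_direction u w
      in arccos (minkowski s t / (sqrt (minkowski s s) * sqrt (minkowski t t))))"

text \<open>
  The angle opposite to the side of length \<open>c\<close> in the hyperbolic triangle with side lengths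
  \<open>a, b, c\<close>.  It is determined if \<open>a, b > 0\<close> and the triangle inequalities hold, see
  \<open>comparison_angle_cosine_law\<close> below.
\<close>

definition comparison_angle :: "real \<Rightarrow> real \<Rightarrow> real \<Rightarrow> real" where
  "comparison_angle a b c = (THE \<theta>.
     \<exists>u\<in>hyperbolic_plane. \<exists>v\<in>hyperbolic_plane. \<exists>w\<in>hyperbolic_plane.
       hyperbolic_dist u v = a \<and> hyperbolic_dist u w = b \<and> hyperbolic_dist v w = c \<and>
       \<theta> = hyperbolic_angle v u w)"

lemma minkowski_commute: "minkowski u v = minkowski v u"
  by (simp add: minkowski_def inner_commute)

lemma minkowski_add_scaleR:
  "minkowski (v + a *\<^sub>R u) w = minkowski v w + a * minkowski u w"
  "minkowski w (v + a *\<^sub>R u) = minkowski w v + a * minkowski w u"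
  by (simp_all add: minkowski_def inner_add_left inner_add_right algebra_simps)

lemma minkowski_directions:
  assumes "u \<in> hyperbolic_plane"
  shows "minkowski (hyperbolic_direction u v) (hyperbolic_direction u w)
       = minkowski v w + minkowski u v * minkowski u w"
proof -
  have "minkowski u u = -1"
    using assms by (simp add: hyperbolic_plane_def)
  then show ?thesis
    by (simp add: hyperbolic_direction_def minkowski_add_scaleR minkowski_commute[of v u]
        algebra_simps)
qed

lemma minkowski_le_neg_1:
  assumes "u \<in> hyperbolic_plane" "v \<in> hyperbolic_plane"
  shows "minkowski u v \<le> -1"
proof -
  define z w where "z = fst u" and "w = fst v"
  have u: "snd u ^ 2 = 1 + inner z z" "snd u > 0" and v: "snd v ^ 2 = 1 + inner w w" "snd v > 0"
    using assms by (auto simp: hyperbolic_plane_def minkowski_def power2_eq_square z_def w_def)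
  have "(inner z w)\<^sup>2 \<le> (inner z z) * (inner w w)" by (rule Cauchy_Schwarz_ineq)
  moreover have "0 \<le> inner (z - w) (z - w)" by simp
  then have "2 * (inner z w) \<le> inner z z + inner w w"
    by (simp add: inner_diff_left inner_diff_right inner_commute)
  ultimately have "(1 + inner z w)\<^sup>2 \<le> (1 + inner z z) * (1 + inner w w)"
    by (simp add: power2_eq_square algebra_simps)
  also have "\<dots> = (snd u * snd v)\<^sup>2" by (simp add: power_mult_distrib u v)
  finally have "1 + inner z w \<le> snd u * snd v"
    using u(2) v(2) by (smt (verit) mult_pos_pos power2_le_imp_le)
  then show ?thesis by (simp add: minkowski_def z_def w_def)
qed

lemma cosh_hyperbolic_dist:
  assumes "u \<in> hyperbolic_plane" "v \<in> hyperbolic_plane"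
  shows "minkowski u v = - cosh (hyperbolic_dist u v)" "hyperbolic_dist u v \<ge> 0"
  using minkowski_le_neg_1[OF assms] by (simp_all add: hyperbolic_dist_def)

lemma hyperbolic_angle_cosine_law:
  assumes "u \<in> hyperbolic_plane" "v \<in> hyperbolic_plane" "w \<in> hyperbolic_plane"
    and "a = hyperbolic_dist u v" "b = hyperbolic_dist u w" "c = hyperbolic_dist v w"
  shows "hyperbolic_angle v u w = arccos ((cosh a * cosh b - cosh c) / (sinh a * sinh b))"
proof -
  have sq: "cosh x * cosh x - 1 = (sinh x)\<^sup>2" for x :: real
    using cosh_square_eq[of x] by (simp add: power2_eq_square)
  have n: "minkowski u v = - cosh a" "minkowski u w = - cosh b" "minkowski v w = - cosh c"
    "a \<ge> 0" "b \<ge> 0"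
    using assms cosh_hyperbolic_dist by auto
  moreover have "minkowski v v = -1" "minkowski w w = -1"
    using assms by (auto simp: hyperbolic_plane_def)
  ultimately show ?thesis
    using assms(1) by (simp add: hyperbolic_angle_def Let_def minkowski_directions sq)
qed

lemma comparison_angle_cosine_law:
  assumes ab: "a > 0" "b > 0" and c: "\<bar>a - b\<bar> \<le> c" "c \<le> a + b"
  shows "comparison_angle a b c = arccos ((cosh a * cosh b - cosh c) / (sinh a * sinh b))"
proof -
  define q where "q = (cosh a * cosh b - cosh c) / (sinh a * sinh b)"
  have s: "sinh a > 0" "sinh b > 0" using ab by auto
  have "cosh (a - b) \<le> cosh c" "cosh c \<le> cosh (a + b)"
    using c ab cosh_real_nonneg_le_iff[of "\<bar>a - b\<bar>" c] cosh_real_nonneg_le_iff[of c "a + b"]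
    by (auto simp: cosh_real_abs)
  then have q: "-1 \<le> q" "q \<le> 1"
    using s by (auto simp: q_def cosh_add cosh_diff divide_simps)
  define \<theta> where "\<theta> = arccos q"
  define u where "u = (0 :: complex, 1 :: real)"
  define v where "v = (complex_of_real (sinh a), cosh a)"
  define w where "w = (Complex (sinh b * cos \<theta>) (sinh b * sin \<theta>), cosh b)"
  have sq: "cosh x * cosh x = 1 + sinh x * sinh x" for x :: real
    using cosh_square_eq[of x] by (simp add: power2_eq_square)
  have cs: "cos \<theta> * cos \<theta> = 1 - sin \<theta> * sin \<theta>"
    using sin_cos_squared_add[of \<theta>] by (simp add: power2_eq_square)
  have "(sinh b * cos \<theta>) * (sinh b * cos \<theta>) + (sinh b * sin \<theta>) * (sinh b * sin \<theta>)
      = sinh b * sinh b * (cos \<theta> * cos \<theta> + sin \<theta> * sin \<theta>)"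
    by (simp only: algebra_simps)
  then have "w \<in> hyperbolic_plane"
    by (simp add: hyperbolic_plane_def minkowski_def w_def inner_complex_def sq cs)
  then have H: "u \<in> hyperbolic_plane" "v \<in> hyperbolic_plane" "w \<in> hyperbolic_plane"
    by (auto simp: hyperbolic_plane_def minkowski_def u_def v_def inner_complex_def sq)
  have m: "minkowski u v = - cosh a" "minkowski u w = - cosh b"
    by (auto simp: minkowski_def u_def v_def w_def)
  have "minkowski v w = sinh a * sinh b * q - cosh a * cosh b"
    using q by (simp add: minkowski_def v_def w_def inner_complex_def \<theta>_def cos_arccos)
  also have "\<dots> = - cosh c" using s by (simp add: q_def)
  finally have m3: "minkowski v w = - cosh c" .
  have d: "hyperbolic_dist u v = a" "hyperbolic_dist u w = b" "hyperbolic_dist v w = c"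
    using ab c by (auto simp: hyperbolic_dist_def m m3 arcosh_cosh_real)
  show ?thesis
    unfolding comparison_angle_def
  proof (rule the_equality)
    show "\<exists>u\<in>hyperbolic_plane. \<exists>v\<in>hyperbolic_plane. \<exists>w\<in>hyperbolic_plane.
       hyperbolic_dist u v = a \<and> hyperbolic_dist u w = b \<and> hyperbolic_dist v w = c \<and>
       arccos ((cosh a * cosh b - cosh c) / (sinh a * sinh b)) = hyperbolic_angle v u w"
      using H d hyperbolic_angle_cosine_law by metis
  qed (use hyperbolic_angle_cosine_law in blast)
qed


section \<open>Length metrics of curvature at least \<open>-1\<close>\<close>

definition curve_length :: "'a metric \<Rightarrow> (real \<Rightarrow> 'a) \<Rightarrow> ennreal" where
  "curve_length m \<gamma> = (SUP (n, t) \<in> {(n :: nat, t). mono t \<and> range t \<subseteq> {0..1}}.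
     \<Sum>i<n. ennreal (mdist m (\<gamma> (t i)) (\<gamma> (t (Suc i)))))"

definition intrinsic_metric :: "'a metric \<Rightarrow> bool" where
  "intrinsic_metric m \<longleftrightarrow> (\<forall>x\<in>mspace m. \<forall>y\<in>mspace m. ennreal (mdist m x y) =
     (INF \<gamma> \<in> {\<gamma>. pathin (mtopology_of m) \<gamma> \<and> \<gamma> 0 = x \<and> \<gamma> 1 = y}. curve_length m \<gamma>))"

definition shortest_path :: "'a metric \<Rightarrow> (real \<Rightarrow> 'a) \<Rightarrow> bool" where
  "shortest_path m \<gamma> \<longleftrightarrow> pathin (mtopology_of m) \<gamma> \<and>
     curve_length m \<gamma> = ennreal (mdist m (\<gamma> 0) (\<gamma> 1))"

text \<open>
  The points \<open>y, y'\<close> (resp. \<open>z, z'\<close>) are the points of \<open>\<psi>\<close> (resp. \<open>\<xi>\<close>) at distances \<open>a \<le> a'\<close>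
  (resp. \<open>b \<le> b'\<close>) from \<open>x\<close>; a shortest path issuing from \<open>x\<close> has at most one point at a given
  distance from \<open>x\<close>.  The values \<open>a = 0\<close> and \<open>b = 0\<close> are excluded because the angle of the
  comparison triangle is undefined there.
\<close>

definition angle_monotone_at :: "'a metric \<Rightarrow> 'a \<Rightarrow> 'a set \<Rightarrow> bool" where
  "angle_monotone_at m x U \<longleftrightarrow>
     (\<forall>\<psi> \<xi> a\<^sub>0 b\<^sub>0.
        shortest_path m \<psi> \<and> \<psi> 0 = x \<and> shortest_path m \<xi> \<and> \<xi> 0 = x \<and>
        (\<forall>y\<in>\<psi> ` {0..1}. mdist m x y \<le> a\<^sub>0 \<longrightarrow> y \<in> U) \<and>
        (\<forall>z\<in>\<xi> ` {0..1}. mdist m x z \<le> b\<^sub>0 \<longrightarrow> z \<in> U) \<longrightarrow>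
        (\<forall>y\<in>\<psi> ` {0..1}. \<forall>y'\<in>\<psi> ` {0..1}. \<forall>z\<in>\<xi> ` {0..1}. \<forall>z'\<in>\<xi> ` {0..1}.
           0 < mdist m x y \<and> mdist m x y \<le> mdist m x y' \<and> mdist m x y' \<le> a\<^sub>0 \<and>
           0 < mdist m x z \<and> mdist m x z \<le> mdist m x z' \<and> mdist m x z' \<le> b\<^sub>0 \<longrightarrow>
           comparison_angle (mdist m x y') (mdist m x z') (mdist m y' z')
             \<le> comparison_angle (mdist m x y) (mdist m x z) (mdist m y z)))"

text \<open>Metrics of curvature at least \<open>-1\<close> in the sense of Alexandrov on the topological space \<open>S\<close>.\<close>

definition cbb_metric_on :: "'a topology \<Rightarrow> 'a metric \<Rightarrow> bool" where
  "cbb_metric_on S m \<longleftrightarrow>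
     mtopology_of m = S \<and> mcomplete_of m \<and> intrinsic_metric m \<and>
     (\<forall>x\<in>mspace m. \<exists>U V. openin S V \<and> x \<in> V \<and> V \<subseteq> U \<and> U \<subseteq> mspace m \<and> angle_monotone_at m x U)"


section \<open>Collapse to a segment\<close>

definition segment :: "real \<Rightarrow> real \<Rightarrow> real metric" where
  "segment l r = submetric euclidean_metric {l..r}"

text \<open>The set of points of \<open>X\<close> at distance less than \<open>\<epsilon>\<close> from the point \<open>x\<close> of the other space.\<close>

definition cross_ball :: "'b metric \<Rightarrow> ('a + 'b) metric \<Rightarrow> 'a \<Rightarrow> real \<Rightarrow> 'b set" where
  "cross_ball X D x \<epsilon> = {y \<in> mspace X. mdist D (Inl x) (Inr y) < \<epsilon>}"

text \<open>
  The image of the restriction map from \<open>H\<^sup>a\<close> of the ball of radius \<open>\<epsilon>\<^sub>2\<close> to \<open>H\<^sup>a\<close> of the ball of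
  radius \<open>\<epsilon>\<^sub>1\<close>.
\<close>

definition ball_restriction_image ::
  "nat \<Rightarrow> 'b metric \<Rightarrow> ('a + 'b) metric \<Rightarrow> 'a \<Rightarrow> real \<Rightarrow> real
     \<Rightarrow> ('k::field, ('b, 'k) cochain set) module" where
  "ball_restriction_image a X D x \<epsilon>\<^sub>1 \<epsilon>\<^sub>2 =
     cohomology_image a
       (subtopology (mtopology_of X) (cross_ball X D x \<epsilon>\<^sub>1))
       (subtopology (mtopology_of X) (cross_ball X D x \<epsilon>\<^sub>2)) id"

end

theory Submission
  imports Defs "HOL-Complex_Analysis.Complex_Analysis"
begin

text \<open>
  A near-isometry \<open>f : X \<rightarrow> I\<close> and almost shortest paths show that any two points whose \<open>f\<close>-values lie
  in an interval are joined by a path with \<open>f\<close>-values in a slightly larger interval.  Hence the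
  smaller ball lies in a single component of a slightly larger one, and the complement of the
  larger ball has one part (\<open>x\<close> an endpoint) or two parts (\<open>x\<close> an interior point), each of which is
  connected inside the complement of a slightly smaller ball, the two parts being separated by that
  ball.  Removing from the sphere a point far away from the ball and filling the inessential holes,
  one finds a planar domain \<open>C\<close> between the two balls which is simply connected (endpoint) or whose
  complement consists of a compact connected set around \<open>0\<close> and an unbounded connected set
  (interior point).  In the first case \<open>C\<close> is homeomorphic to a disc by Riemann's mapping theorem.
  In the second case \<open>exp -` C\<close> is simply connected, hence acyclic, and the cohomology of \<open>C\<close> is that
  of its deck group \<open>\<int>\<close>, acting by the translations by \<open>2\<pi>i\<int>\<close>; thus \<open>H\<^sup>1(C)\<close> is spanned by the
  class of \<open>d arg / 2\<pi>\<close>.  This class restricts nontrivially to the smaller ball, because the image of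
  a large circle under a Riemann map is a loop of winding number one in it.
\<close>

section \<open>Images of restriction maps in cohomology\<close>

text \<open>The balls themselves may have many small holes near their boundary; only what persists
  from one radius to the other is controlled. The restriction is therefore factored as small ball ->
  C -> large ball through a domain with known cohomology, which bounds the rank from above, and in
  degree 1 a loop that already lies in the small ball bounds it from below. The loop requires a
  second, slightly smaller domain. Hence the five levels \<open>e\<^sub>1 - 2 * \<eta>\<close>, ...,
  \<open>e\<^sub>1 + 2 * \<eta>\<close>, where \<eta> is the loss of one connectivity argument.
  Write D for the pullback along the generator of the deck group. Cochains of C are the D-invariant
  cochains of its covering, and D - 1 is onto on cochains of the covering; with an acyclic covering,
  a short diagram chase then gives the cohomology of C. Since the coefficient field is arbitrary,
  the argument function is replaced by an integer labelling of the sheets, so that the period of the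
  angular class is the element 1 of the field.\<close>

lemma cochain_pullback_compose:
  assumes "continuous_map X Y f"
  shows "cochain_pullback p X f (cochain_pullback p Y g \<phi>) = cochain_pullback p X (g \<circ> f) \<phi>"
proof
  fix \<sigma>
  have "simplex_map p g (simplex_map p f \<sigma>) = simplex_map p (g \<circ> f) \<sigma>"
    by (auto simp: simplex_map_def)
  then show "cochain_pullback p X f (cochain_pullback p Y g \<phi>) \<sigma> = cochain_pullback p X (g \<circ> f) \<phi> \<sigma>"
    using singular_simplex_simplex_map[OF _ assms, of p \<sigma>] by (simp add: cochain_pullback_def)
qed

lemma cochain_pullback_cong:
  assumes "\<And>x. x \<in> topspace X \<Longrightarrow> f x = g x"
  shows "cochain_pullback p X f \<phi> = cochain_pullback p X g \<phi>"
proof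
  fix \<sigma>
  show "cochain_pullback p X f \<phi> \<sigma> = cochain_pullback p X g \<phi> \<sigma>"
  proof (cases "singular_simplex p X \<sigma>")
    case True
    then have "simplex_map p f \<sigma> = simplex_map p g \<sigma>"
      using assms by (auto simp: simplex_map_def singular_simplex_def continuous_map_def Pi_iff)
    then show ?thesis by (simp add: cochain_pullback_def)
  qed (simp add: cochain_pullback_def)
qed

lemma cochain_pullback_id:
  assumes "\<phi> \<in> cochains p X"
  shows "cochain_pullback p X id \<phi> = \<phi>"
proof
  fix \<sigma>
  have "simplex_map p id \<sigma> = \<sigma>" if "singular_simplex p X \<sigma>"
    using that by (simp add: simplex_map_def singular_simplex_def extensional_restrict)
  then show "cochain_pullback p X id \<phi> \<sigma> = \<phi> \<sigma>"
    using assms by (auto simp: cochain_pullback_def cochains_def)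
qed

lemma cocycles_subset_coboundaries_homeomorphic:
  assumes "X homeomorphic_space Y" "(cocycles p Y :: ('b, 'k::field) cochain set) \<subseteq> coboundaries p Y"
  shows "(cocycles p X :: ('a, 'k) cochain set) \<subseteq> coboundaries p X"
proof
  fix \<phi> :: "('a, 'k) cochain" assume \<phi>: "\<phi> \<in> cocycles p X"
  obtain f g where fg: "continuous_map X Y f" "continuous_map Y X g" "\<And>x. x \<in> topspace X \<Longrightarrow> g (f x) = x"
    using assms(1) by (auto simp: homeomorphic_space_def homeomorphic_maps_def)
  have "cochain_pullback p Y g \<phi> \<in> coboundaries p Y"
    using cochain_pullback_cocycles[OF fg(2) \<phi>] assms(2) by blast
  then have "cochain_pullback p X f (cochain_pullback p Y g \<phi>) \<in> coboundaries p X"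
    by (rule cochain_pullback_coboundaries[OF fg(1)])
  also have "cochain_pullback p X f (cochain_pullback p Y g \<phi>) = cochain_pullback p X id \<phi>"
    unfolding cochain_pullback_compose[OF fg(1)] using fg(3) by (intro cochain_pullback_cong) simp
  also have "\<dots> = \<phi>" using \<phi> by (intro cochain_pullback_id) (simp add: cocycles_def)
  finally show "\<phi> \<in> coboundaries p X" .
qed

text \<open>Both parts translate a statement about quotient spaces into one about representing
  cochains, so that everything later is checked on cocycles and coboundaries. In the second part the
  class of the pulled back \<omega> is a one-element basis of the image.\<close>

lemma
  fixes X :: "'a topology" and Y :: "'b topology"
  assumes f: "continuous_map X Y f"
  shows has_dim_cohomology_image_0:
    "(\<And>\<phi> :: ('b, 'k) cochain. \<phi> \<in> cocycles p Y \<Longrightarrow> cochain_pullback p X f \<phi> \<in> coboundaries p X) \<Longrightarrow>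
      has_dim class_ring (cohomology_image p X Y f :: ('k::field, ('a, 'k) cochain set) module) 0"
  and has_dim_cohomology_image_1:
    "(\<omega> :: ('b, 'k) cochain) \<in> cocycles p Y \<Longrightarrow> cochain_pullback p X f \<omega> \<notin> coboundaries p X \<Longrightarrow>
      (\<And>\<phi> :: ('b, 'k) cochain. \<phi> \<in> cocycles p Y \<Longrightarrow>
        \<exists>c. (\<lambda>\<sigma>. cochain_pullback p X f \<phi> \<sigma> - c * cochain_pullback p X f \<omega> \<sigma>) \<in> coboundaries p X) \<Longrightarrow>
      has_dim class_ring (cohomology_image p X Y f :: ('k::field, ('a, 'k) cochain set) module) 1"
proof -
  let ?V = "cohomology_image p X Y f :: ('k, ('a, 'k) cochain set) module"
  let ?cl = "\<lambda>\<phi>. cohomology_class p X (cochain_pullback p X f \<phi>) :: ('a, 'k) cochain set"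
  interpret V: vectorspace class_ring ?V
    by (rule vectorspace_cohomology_image[OF f])
  have car: "carrier ?V = ?cl ` cocycles p Y"
    by (simp add: cohomology_image_def carrier_cohomology image_image cohomology_induced_class[OF f])
  have zero: "\<zero>\<^bsub>?V\<^esub> = cohomology_class p X (\<lambda>_. 0)"
    by (simp add: cohomology_image_def cohomology_zero_class)
  have smult: "c \<odot>\<^bsub>?V\<^esub> ?cl \<omega> = cohomology_class p X (\<lambda>\<sigma>. c * cochain_pullback p X f \<omega> \<sigma>)" for c \<omega>
    by (simp add: cohomology_image_def cohomology_smult_class)
  show "has_dim class_ring ?V 0"
    if *: "\<And>\<phi> :: ('b, 'k) cochain. \<phi> \<in> cocycles p Y \<Longrightarrow> cochain_pullback p X f \<phi> \<in> coboundaries p X"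
  proof -
    have "?cl \<phi> = \<zero>\<^bsub>?V\<^esub>" if "\<phi> \<in> cocycles p Y" for \<phi>
      using *[OF that] by (simp add: zero cohomology_class_eq_iff)
    then have "carrier ?V = {\<zero>\<^bsub>?V\<^esub>}"
      using V.M.zero_closed unfolding car by blast
    then have gen: "V.gen_set {\<zero>\<^bsub>?V\<^esub>}"
      using V.in_own_span[of "{\<zero>\<^bsub>?V\<^esub>}"] V.span_is_subset2[of "{\<zero>\<^bsub>?V\<^esub>}"] by auto
    then have "V.fin_dim" unfolding V.fin_dim_def by (intro exI[of _ "{\<zero>\<^bsub>?V\<^esub>}"]) auto
    then show ?thesis
      unfolding has_dim_def using V.dim0I[OF gen] V.vectorspace_axioms by blast
  qed
  show "has_dim class_ring ?V 1"
    if \<omega>: "\<omega> \<in> cocycles p Y" "cochain_pullback p X f \<omega> \<notin> coboundaries p X"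
      and *: "\<And>\<phi> :: ('b, 'k) cochain. \<phi> \<in> cocycles p Y \<Longrightarrow>
        \<exists>c. (\<lambda>\<sigma>. cochain_pullback p X f \<phi> \<sigma> - c * cochain_pullback p X f \<omega> \<sigma>) \<in> coboundaries p X"
    for \<omega> :: "('b, 'k) cochain"
  proof -
    have v: "?cl \<omega> \<in> carrier ?V" "?cl \<omega> \<noteq> \<zero>\<^bsub>?V\<^esub>"
      using \<omega> by (auto simp: car zero cohomology_class_eq_iff)
    have sub: "submodule class_ring (V.span {?cl \<omega>}) ?V"
      using v by (intro V.span_is_submodule) auto
    have "x \<in> V.span {?cl \<omega>}" if x: "x \<in> carrier ?V" for x
    proof -
      obtain \<phi> where \<phi>: "\<phi> \<in> cocycles p Y" "x = ?cl \<phi>" using x unfolding car by blast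
      obtain c where "(\<lambda>\<sigma>. cochain_pullback p X f \<phi> \<sigma> - c * cochain_pullback p X f \<omega> \<sigma>) \<in> coboundaries p X"
        using *[OF \<phi>(1)] by blast
      then have "x = c \<odot>\<^bsub>?V\<^esub> ?cl \<omega>"
        by (simp add: \<phi>(2) smult cohomology_class_eq_iff)
      moreover have "?cl \<omega> \<in> V.span {?cl \<omega>}" using V.in_own_span[of "{?cl \<omega>}"] v by auto
      ultimately show ?thesis
        using submodule.smult_closed[OF sub, of c "?cl \<omega>"] by simp
    qed
    then have gen: "V.gen_set {?cl \<omega>}"
      using V.span_is_subset2[of "{?cl \<omega>}"] v by blast
    then have "V.fin_dim" unfolding V.fin_dim_def using v by (intro exI[of _ "{?cl \<omega>}"]) auto
    then show ?thesis
      unfolding has_dim_def using V.dim1I[OF gen v(2,1)] V.vectorspace_axioms by blast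
  qed
qed

section \<open>Paths as singular 1-simplices, and cohomology in degree 0\<close>

lemma singular_simplex_path:
  assumes "pathin X g"
  shows "singular_simplex 1 X (restrict (\<lambda>t. g (t 1)) (standard_simplex 1))"
proof -
  have "continuous_map (subtopology (powertop_real UNIV) (standard_simplex 1)) (top_of_set {0..1}) (\<lambda>t. t 1)"
    by (auto simp: euclidean_product_topology standard_simplex_def
        intro: continuous_on_subset[OF continuous_on_product_coordinates])
  then have "continuous_map (subtopology (powertop_real UNIV) (standard_simplex 1)) X (g \<circ> (\<lambda>t. t 1))"
    using assms unfolding pathin_def by (rule continuous_map_compose)
  then show ?thesis
    by (auto simp: singular_simplex_def o_def elim: continuous_map_eq)
qed

text \<open>A path g is read as the 1-simplex t -> g (t 1), so it starts at the vertex with t 0 = 1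
  and ends at the vertex with t 1 = 1. Face 0 omits the former, which makes the coboundary in
  \<open>coboundary_path\<close> the value at the end minus the value at the start.\<close>

lemma simplical_face_vertex:
  "simplical_face 0 (\<lambda>j. if j = 0 then 1 else 0) = (\<lambda>j. if j = 1 then 1 else (0::real))"
  "simplical_face (Suc 0) (\<lambda>j. if j = 0 then 1 else 0) = (\<lambda>j. if j = 0 then 1 else (0::real))"
  by (auto simp: simplical_face_def fun_eq_iff)

lemma singular_face_path:
  "singular_face 1 0 (restrict (\<lambda>t. g (t 1)) (standard_simplex 1)) = restrict (\<lambda>_. g 1) (standard_simplex 0)"
  "singular_face 1 1 (restrict (\<lambda>t. g (t 1)) (standard_simplex 1)) = restrict (\<lambda>_. g 0) (standard_simplex 0)"
  by (auto simp: singular_face_def standard_simplex_0 simplical_face_vertex)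

lemma coboundary_path:
  assumes "pathin X g"
  shows "coboundary 0 X \<phi> (restrict (\<lambda>t. g (t 1)) (standard_simplex 1))
       = \<phi> (restrict (\<lambda>_. g 1) (standard_simplex 0)) - \<phi> (restrict (\<lambda>_. g 0) (standard_simplex 0))"
  using singular_simplex_path[OF assms] singular_face_path[of g] by (simp add: coboundary_def)

lemma singular_simplex_0:
  "singular_simplex 0 X \<sigma> \<longleftrightarrow> (\<exists>x\<in>topspace X. \<sigma> = restrict (\<lambda>_. x) (standard_simplex 0))"
proof
  assume \<sigma>: "singular_simplex 0 X \<sigma>"
  then have "\<sigma> (\<lambda>j. if j = 0 then 1 else 0) \<in> topspace X"
    by (auto simp: singular_simplex_def continuous_map_def standard_simplex_0)
  moreover have "\<sigma> = restrict (\<lambda>_. \<sigma> (\<lambda>j. if j = 0 then 1 else 0)) (standard_simplex 0)"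
    using \<sigma> by (auto simp: singular_simplex_def standard_simplex_0 extensional_def)
  ultimately show "\<exists>x\<in>topspace X. \<sigma> = restrict (\<lambda>_. x) (standard_simplex 0)" by blast
next
  assume "\<exists>x\<in>topspace X. \<sigma> = restrict (\<lambda>_. x) (standard_simplex 0)"
  then show "singular_simplex 0 X \<sigma>"
    by (auto simp: singular_simplex_def)
qed

lemma simplex_map_point:
  "simplex_map 0 f (restrict (\<lambda>_. x) (standard_simplex 0)) = restrict (\<lambda>_. f x) (standard_simplex 0)"
  by (auto simp: simplex_map_def)

lemma cocycle_0_path:
  assumes "\<phi> \<in> cocycles 0 X" "pathin X g"
  shows "\<phi> (restrict (\<lambda>_. g 1) (standard_simplex 0)) = \<phi> (restrict (\<lambda>_. g 0) (standard_simplex 0))"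
  using coboundary_path[OF assms(2), of \<phi>] assms(1) by (simp add: cocycles_def)

text \<open>A 0-cocycle of Y is constant along paths in Y, so on the image of X it is a multiple of
  the constant 1. The joining paths may leave that image; X itself may be disconnected.\<close>

lemma has_dim_cohomology_image_path_connected:
  fixes X :: "'a topology" and Y :: "'b topology"
  assumes f: "continuous_map X Y f" and ne: "topspace X \<noteq> {}"
    and path: "\<And>x y. x \<in> topspace X \<Longrightarrow> y \<in> topspace X \<Longrightarrow> \<exists>g. pathin Y g \<and> g 0 = f x \<and> g 1 = f y"
  shows "has_dim class_ring (cohomology_image 0 X Y f :: ('k::field, ('a, 'k) cochain set) module) 1"
proof (rule has_dim_cohomology_image_1[OF f])
  let ?o = "\<lambda>\<sigma>. if singular_simplex 0 Y \<sigma> then 1 else 0 :: 'k"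
  have "coboundary 0 Y ?o \<sigma> = 0" for \<sigma>
    using singular_simplex_singular_face[of 1 Y \<sigma>] by (auto simp: coboundary_def)
  then show "?o \<in> cocycles 0 Y" by (auto simp: cocycles_def cochains_def)
  have o: "cochain_pullback 0 X f ?o \<sigma> = (if singular_simplex 0 X \<sigma> then 1 else 0)" for \<sigma>
    using singular_simplex_simplex_map[OF _ f, of 0 \<sigma>] by (auto simp: cochain_pullback_def)
  obtain x where x: "x \<in> topspace X" using ne by blast
  have "singular_simplex 0 X (restrict (\<lambda>_. x) (standard_simplex 0))"
    using x by (auto simp: singular_simplex_0)
  with o show "cochain_pullback 0 X f ?o \<notin> coboundaries 0 X"
    by (auto simp: coboundaries_def fun_eq_iff)
  fix \<phi> :: "('b, 'k) cochain" assume \<phi>: "\<phi> \<in> cocycles 0 Y"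
  have "cochain_pullback 0 X f \<phi> \<sigma>
      - \<phi> (restrict (\<lambda>_. f x) (standard_simplex 0)) * cochain_pullback 0 X f ?o \<sigma> = 0" for \<sigma>
  proof (cases "singular_simplex 0 X \<sigma>")
    case True
    then obtain y where y: "y \<in> topspace X" "\<sigma> = restrict (\<lambda>_. y) (standard_simplex 0)"
      unfolding singular_simplex_0 by blast
    obtain g where g: "pathin Y g" "g 0 = f x" "g 1 = f y" using path[OF x y(1)] by blast
    show ?thesis
      using cocycle_0_path[OF \<phi> g(1)] True unfolding o g by (simp add: cochain_pullback_def y simplex_map_point)
  qed (simp add: o cochain_pullback_def)
  then show "\<exists>c. (\<lambda>\<sigma>. cochain_pullback 0 X f \<phi> \<sigma> - c * cochain_pullback 0 X f ?o \<sigma>) \<in> coboundaries 0 X"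
    by (intro exI[of _ "\<phi> (restrict (\<lambda>_. f x) (standard_simplex 0))"]) (simp add: coboundaries_def)
qed

section \<open>Acyclicity of convex sets\<close>

lemma singular_simplex_euclidean:
  "singular_simplex p (top_of_set S) \<sigma> \<longleftrightarrow>
     continuous_on (standard_simplex p) \<sigma> \<and> \<sigma> ` standard_simplex p \<subseteq> S \<and> \<sigma> \<in> extensional (standard_simplex p)"
  by (auto simp: singular_simplex_def euclidean_product_topology continuous_map_in_subtopology)

lemma singular_simplex_restrict:
  assumes "continuous_on (standard_simplex p) g" "g ` standard_simplex p \<subseteq> S"
  shows "singular_simplex p (top_of_set S) (restrict g (standard_simplex p))"
  using assms by (auto simp: singular_simplex_euclidean elim: continuous_on_eq)

text \<open>These are the barycentric coordinates of the projection of x from vertex 0 onto the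
  opposite face.\<close>

lemma standard_simplex_tail:
  assumes "x \<in> standard_simplex (Suc p)" "x 0 \<noteq> 1"
  shows "(\<lambda>i. x (Suc i) / (1 - x 0)) \<in> standard_simplex p"
proof -
  have x: "\<And>i. 0 \<le> x i" "\<And>i. i > Suc p \<Longrightarrow> x i = 0" "x 0 + (\<Sum>i\<le>p. x (Suc i)) = 1" "x 0 < 1"
    using assms by (auto simp: standard_simplex_def sum.atMost_Suc_shift less_le simp del: sum.atMost_Suc)
  have s: "(\<Sum>i\<le>p. x (Suc i)) = 1 - x 0" using x(3) by simp
  have "x (Suc i) \<le> 1 - x 0" for i
  proof (cases "i \<le> p")
    case True
    then have "x (Suc i) \<le> (\<Sum>i\<le>p. x (Suc i))" using x(1) by (intro member_le_sum) auto
    then show ?thesis using s by simp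
  qed (use x(2)[of "Suc i"] x(4) in auto)
  then show ?thesis
    using x s by (auto simp: standard_simplex_def sum_divide_distrib[symmetric])
qed

text \<open>The cone over \<open>\<sigma>\<close> with apex \<open>0\<close>, which is the image of the vertex \<open>x 0 = 1\<close>.\<close>

definition cone_simplex :: "nat \<Rightarrow> ((nat \<Rightarrow> real) \<Rightarrow> 'a::real_normed_vector) \<Rightarrow> (nat \<Rightarrow> real) \<Rightarrow> 'a" where
  "cone_simplex p \<sigma> = restrict (\<lambda>x. if x 0 = 1 then 0
     else (1 - x 0) *\<^sub>R \<sigma> (\<lambda>i. x (Suc i) / (1 - x 0))) (standard_simplex (Suc p))"

lemma compact_standard_simplex: "compact (standard_simplex p)"
  using compactin_standard_simplex[of p] by (simp add: euclidean_product_topology)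

text \<open>The delicate point is continuity at the apex: the projected point need not converge
  there, but \<sigma> is bounded by compactness of the simplex and the factor 1 - x 0 tends to 0.
  Convexity keeps the segments from 0 to the values of \<sigma> inside S.\<close>

lemma singular_simplex_cone:
  fixes S :: "'a::real_normed_vector set"
  assumes \<sigma>: "singular_simplex p (top_of_set S) \<sigma>" and S: "convex S" "0 \<in> S"
  shows "singular_simplex (Suc p) (top_of_set S) (cone_simplex p \<sigma>)"
proof -
  let ?D = "standard_simplex (Suc p)"
  let ?q = "\<lambda>x i. x (Suc i) / (1 - x 0) :: real"
  let ?g = "\<lambda>x. if x 0 = 1 then 0 else (1 - x 0) *\<^sub>R \<sigma> (?q x)"
  have c: "continuous_on (standard_simplex p) \<sigma>" and S\<sigma>: "\<sigma> ` standard_simplex p \<subseteq> S"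
    using \<sigma> by (auto simp: singular_simplex_euclidean)
  have x0: "0 \<le> x 0" "x 0 \<le> 1" if "x \<in> ?D" for x using that by (auto simp: standard_simplex_def)
  obtain M where M: "norm (\<sigma> x) \<le> M" if "x \<in> standard_simplex p" for x
    using compact_imp_bounded[OF compact_continuous_image[OF c compact_standard_simplex]]
    by (auto simp: bounded_iff)
  have "continuous (at x within ?D) ?g" if x: "x \<in> ?D" for x
  proof (cases "x 0 = 1")
    case True
    have "((\<lambda>y. y 0) \<longlongrightarrow> x 0) (at x within ?D)"
      using continuous_on_subset[OF continuous_on_product_coordinates[of 0] subset_UNIV[of ?D]] x
      by (auto simp: continuous_on_def)
    then have "((\<lambda>y. (1 - y 0) * M) \<longlongrightarrow> (1 - x 0) * M) (at x within ?D)" by (intro tendsto_intros)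
    moreover have "\<forall>\<^sub>F y in at x within ?D. norm (?g y) \<le> (1 - y 0) * M"
      using M[OF standard_simplex_tail] x0 by (auto simp: eventually_at_filter mult_left_mono)
    ultimately have "(?g \<longlongrightarrow> 0) (at x within ?D)"
      using True by (intro Lim_null_comparison[of ?g "\<lambda>y. (1 - y 0) * M"]) auto
    then show ?thesis using True by (simp add: continuous_within)
  next
    case False
    have "continuous_on {y \<in> ?D. y 0 \<noteq> 1} (\<lambda>y. (1 - y 0) *\<^sub>R \<sigma> (?q y))"
      by (intro continuous_intros continuous_on_compose2[OF c] continuous_on_coordinatewise_then_product
          continuous_on_subset[OF continuous_on_product_coordinates]) (auto intro: standard_simplex_tail)
    then have "continuous_on {y \<in> ?D. y 0 \<noteq> 1} ?g"
      by (rule continuous_on_eq) auto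
    then have "continuous (at x within {y \<in> ?D. y 0 \<noteq> 1}) ?g"
      using x False by (auto simp: continuous_on_eq_continuous_within)
    moreover have "open {y::nat \<Rightarrow> real. y 0 \<noteq> 1}"
      by (intro open_Collect_neq continuous_on_product_coordinates continuous_on_const)
    then have "at x within ?D = at x within {y \<in> ?D. y 0 \<noteq> 1}"
      using False by (intro at_within_nhd[of _ "{y. y 0 \<noteq> 1}"]) auto
    ultimately show ?thesis by simp
  qed
  then have contg: "continuous_on ?D ?g" by (simp add: continuous_on_eq_continuous_within)
  have gS: "?g x \<in> S" if x: "x \<in> ?D" for x
  proof (cases "x 0 = 1")
    case False
    then have "\<sigma> (?q x) \<in> S" using S\<sigma> standard_simplex_tail[OF x] by auto
    then show ?thesis
      using convexD[OF S(1) S(2), of "\<sigma> (?q x)" "x 0" "1 - x 0"] x0[OF x] False by auto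
  qed (use S in auto)
  have "?g ` ?D \<subseteq> S" using gS by blast
  with contg show ?thesis
    unfolding cone_simplex_def by (rule singular_simplex_restrict)
qed

lemma singular_face_cone_0:
  assumes "\<sigma> \<in> extensional (standard_simplex p)"
  shows "singular_face (Suc p) 0 (cone_simplex p \<sigma>) = \<sigma>"
proof
  fix x
  have "simplical_face 0 x \<in> standard_simplex (Suc p)" if "x \<in> standard_simplex p"
    using simplical_face_in_standard_simplex[of "Suc p" 0 x] that by simp
  then show "singular_face (Suc p) 0 (cone_simplex p \<sigma>) x = \<sigma> x"
    using assms by (auto simp: singular_face_def cone_simplex_def extensional_def simplical_face_def)
qed

lemma singular_face_cone_Suc:
  assumes "k \<le> Suc p"
  shows "singular_face (Suc (Suc p)) (Suc k) (cone_simplex (Suc p) \<sigma>) = cone_simplex p (singular_face (Suc p) k \<sigma>)"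
proof
  fix x
  show "singular_face (Suc (Suc p)) (Suc k) (cone_simplex (Suc p) \<sigma>) x = cone_simplex p (singular_face (Suc p) k \<sigma>) x"
  proof (cases "x \<in> standard_simplex (Suc p)")
    case True
    have "simplical_face (Suc k) x \<in> standard_simplex (Suc (Suc p))"
      using simplical_face_in_standard_simplex[of "Suc (Suc p)" "Suc k" x] True assms by simp
    moreover have "simplical_face (Suc k) x 0 = x 0" by (simp add: simplical_face_def)
    moreover have "(\<lambda>i. simplical_face (Suc k) x (Suc i) / (1 - x 0)) = simplical_face k (\<lambda>i. x (Suc i) / (1 - x 0))"
      by (rule ext) (simp add: simplical_face_def Suc_diff_le not_less Suc_leI split: nat.split; cases "k = 0"; simp)
    ultimately show ?thesis
      using True standard_simplex_tail[OF True] by (auto simp: singular_face_def cone_simplex_def)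
  qed (simp add: singular_face_def cone_simplex_def)
qed

text \<open>The cone operator is a contracting homotopy: the boundary of the cone over \<sigma> is
  \<sigma> minus the cone over the boundary of \<sigma>. Evaluating the cocycle on cones therefore
  gives a primitive. In degree 0 the value at the apex would remain.\<close>

lemma cocycles_subset_coboundaries_convex:
  fixes S :: "'a::real_normed_vector set"
  assumes S: "convex S" "0 \<in> S"
  shows "(cocycles (Suc p) (top_of_set S) :: ('a, 'k::field) cochain set) \<subseteq> coboundaries (Suc p) (top_of_set S)"
proof
  fix \<phi> :: "('a, 'k) cochain" assume \<phi>: "\<phi> \<in> cocycles (Suc p) (top_of_set S)"
  define \<psi> where "\<psi> = (\<lambda>\<sigma>. if singular_simplex p (top_of_set S) \<sigma> then \<phi> (cone_simplex p \<sigma>) else 0)"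
  have "coboundary p (top_of_set S) \<psi> \<sigma> = \<phi> \<sigma>" for \<sigma>
  proof (cases "singular_simplex (Suc p) (top_of_set S) \<sigma>")
    case True
    have "singular_simplex p (top_of_set S) (singular_face (Suc p) k \<sigma>)" if "k \<le> Suc p" for k
      using singular_simplex_singular_face[OF True _ that] by simp
    then have 1: "coboundary p (top_of_set S) \<psi> \<sigma> = (\<Sum>k\<le>Suc p. (-1) ^ k * \<phi> (cone_simplex p (singular_face (Suc p) k \<sigma>)))"
      using True by (simp add: coboundary_def \<psi>_def del: sum.atMost_Suc)
    have "0 = coboundary (Suc p) (top_of_set S) \<phi> (cone_simplex (Suc p) \<sigma>)"
      using \<phi> by (simp add: cocycles_def)
    also have "\<dots> = \<phi> \<sigma> + (\<Sum>k\<le>Suc p. - ((-1) ^ k) * \<phi> (cone_simplex p (singular_face (Suc p) k \<sigma>)))"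
      using singular_simplex_cone[OF True S] True
      by (simp add: coboundary_def sum.atMost_Suc_shift[of _ "Suc p"] singular_face_cone_0
          singular_face_cone_Suc singular_simplex_def del: sum.atMost_Suc)
    also have "\<dots> = \<phi> \<sigma> - coboundary p (top_of_set S) \<psi> \<sigma>"
      unfolding 1 by (simp add: sum_negf del: sum.atMost_Suc)
    finally show ?thesis by simp
  qed (use \<phi> in \<open>auto simp: coboundary_def cocycles_def cochains_def\<close>)
  then have "\<phi> = coboundary p (top_of_set S) \<psi>" by auto
  moreover have "\<psi> \<in> cochains p (top_of_set S)" by (simp add: cochains_def \<psi>_def)
  ultimately show "\<phi> \<in> coboundaries (Suc p) (top_of_set S)" by (simp add: coboundaries_def)
qed

section \<open>The exponential covering\<close>

text \<open>The slices at 0 and at 1 are linked by N small steps. By uniform continuity the quotient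
  \<open>G\<close> of consecutive slices stays within distance 1 of the number 1, where the
  principal logarithm is continuous, and the exponential of the sum of these logarithms telescopes.
  The constant slice at 0 supplies the initial logarithm.\<close>

lemma continuous_logarithm_homotopy:
  fixes F :: "real \<times> 'a::metric_space \<Rightarrow> complex"
  assumes K: "compact K" and F: "continuous_on ({0..1} \<times> K) F"
    and nz: "\<And>s x. s \<in> {0..1} \<Longrightarrow> x \<in> K \<Longrightarrow> F (s, x) \<noteq> 0"
    and F0: "\<And>x. x \<in> K \<Longrightarrow> F (0, x) = c"
  shows "\<exists>g. continuous_on K g \<and> (\<forall>x\<in>K. exp (g x) = F (1, x))"
proof (cases "K = {}")
  case False
  let ?P = "{0..1::real} \<times> K"
  have P: "compact ?P" "?P \<noteq> {}" using compact_Times[OF compact_Icc K] False by auto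
  obtain m where m: "m > 0" "\<And>z. z \<in> ?P \<Longrightarrow> m \<le> norm (F z)"
  proof -
    obtain z where "z \<in> ?P" "\<And>w. w \<in> ?P \<Longrightarrow> norm (F z) \<le> norm (F w)"
      using continuous_attains_inf[OF P continuous_on_norm[OF F]] by blast
    then show ?thesis using that[of "norm (F z)"] nz by (auto simp del: norm_le_zero_iff)
  qed
  obtain d where d: "d > 0" "\<And>z w. z \<in> ?P \<Longrightarrow> w \<in> ?P \<Longrightarrow> dist w z < d \<Longrightarrow> dist (F w) (F z) < m"
    using compact_uniformly_continuous[OF F P(1)] m(1) unfolding uniformly_continuous_on_def by metis
  obtain N :: nat where N: "N > 0" "1 / real N < d"
    using d(1) by (metis nat_approx_posE zero_less_Suc)
  define G where "G j x = F (real (Suc j) / real N, x) / F (real j / real N, x)" for j x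
  have I: "real j / real N \<in> {0..1}" if "j \<le> N" for j using that N by auto
  have G: "G j x \<notin> \<real>\<^sub>\<le>\<^sub>0" if j: "j < N" and x: "x \<in> K" for j x
  proof -
    have P2: "(real (Suc j) / real N, x) \<in> ?P" "(real j / real N, x) \<in> ?P"
      using I[of j] I[of "Suc j"] j x by auto
    have "dist (real (Suc j) / real N, x) (real j / real N, x) = 1 / real N"
      using N by (simp add: dist_Pair_Pair dist_real_def diff_divide_distrib[symmetric])
    then have "dist (F (real (Suc j) / real N, x)) (F (real j / real N, x)) < m"
      using d(2)[OF P2(2,1)] N by simp
    also have "m \<le> norm (F (real j / real N, x))" by (rule m(2)[OF P2(2)])
    finally have *: "norm (F (real (Suc j) / real N, x) - F (real j / real N, x)) < norm (F (real j / real N, x))"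
      by (simp add: dist_norm)
    have "F (real j / real N, x) \<noteq> 0" using m P2(2) by fastforce
    then have "norm (G j x - 1) = norm (F (real (Suc j) / real N, x) - F (real j / real N, x)) / norm (F (real j / real N, x))"
      by (simp add: G_def norm_divide[symmetric] diff_divide_distrib)
    then have lt: "norm (G j x - 1) < 1" using * by (simp add: divide_less_eq)
    show ?thesis
    proof
      assume "G j x \<in> \<real>\<^sub>\<le>\<^sub>0"
      then have "Re (G j x) \<le> 0" by (simp add: complex_nonpos_Reals_iff)
      moreover have "\<bar>Re (G j x - 1)\<bar> < 1" using lt abs_Re_le_cmod by (rule le_less_trans[rotated])
      ultimately show False by simp
    qed
  qed
  define g where "g n x = Ln c + (\<Sum>j<n. Ln (G j x))" for n x
  have cF: "continuous_on K (\<lambda>x. F (real j / real N, x))" if "j \<le> N" for j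
    by (rule continuous_on_compose2[OF F]) (use I[OF that] in \<open>auto intro!: continuous_intros\<close>)
  have "continuous_on K (G j)" if "j < N" for j
    unfolding G_def by (intro continuous_intros cF) (use that nz I[of j] in auto)
  then have "continuous_on K (g N)"
    unfolding g_def by (intro continuous_intros) (auto simp: G)
  moreover have "exp (g n x) = F (real n / real N, x)" if "n \<le> N" "x \<in> K" for n x
    using that
  proof (induction n)
    case 0
    have "c \<noteq> 0" using nz[of 0 x] F0[OF \<open>x \<in> K\<close>] \<open>x \<in> K\<close> by auto
    then show ?case using F0[OF \<open>x \<in> K\<close>] by (simp add: g_def)
  next
    case (Suc n)
    have "exp (g (Suc n) x) = exp (g n x) * exp (Ln (G n x))" by (simp add: g_def exp_add)
    also have "G n x \<noteq> 0" using G[of n x] Suc.prems by auto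
    then have "exp (g n x) * exp (Ln (G n x)) = F (real n / real N, x) * G n x"
      using Suc by simp
    also have "\<dots> = F (real (Suc n) / real N, x)"
      using nz[of "real n / real N" x] I[of n] Suc.prems by (simp add: G_def)
    finally show ?case .
  qed
  ultimately show ?thesis using N(1) by (intro exI[of _ "g N"]) auto
qed auto

section \<open>Deck translations and lifts of singular simplices\<close>

abbreviation vertex0 :: "nat \<Rightarrow> real" where
  "vertex0 \<equiv> \<lambda>j. if j = 0 then 1 else 0"

definition deck :: "int \<Rightarrow> complex \<Rightarrow> complex" where
  "deck n z = z + of_int n * (2 * of_real pi * \<i>)"

lemma exp_deck [simp]: "exp (deck n z) = exp z"
  by (simp add: exp_eq deck_def algebra_simps)

lemma deck_deck: "deck m (deck n z) = deck (m + n) z"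
  by (simp add: deck_def algebra_simps)

lemma deck_0: "deck 0 z = z"
  by (simp add: deck_def)

lemma continuous_on_deck: "continuous_on S (deck n)"
  unfolding deck_def by (intro continuous_intros)

lemma singular_simplex_lift_exp:
  fixes C :: "complex set"
  assumes \<sigma>: "singular_simplex p (top_of_set C) \<sigma>" and C: "0 \<notin> C"
  shows "\<exists>\<tau>. singular_simplex p (top_of_set (exp -` C)) \<tau> \<and> simplex_map p exp \<tau> = \<sigma>"
proof -
  \<comment> \<open>Straight-line contraction of the simplex: at parameter 0 everything is at
    \<open>vertex0\<close>, at parameter 1 it is the identity. Composed with \<sigma> it is the
    homotopy whose logarithm yields the lift.\<close>
  let ?h = "\<lambda>z i. (1 - fst z) * vertex0 i + fst z * snd z i :: real"
  have h: "?h (s, x) \<in> standard_simplex p" if "s \<in> {0..1}" "x \<in> standard_simplex p" for s x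
    using convex_standard_simplex[of vertex0 p x s] that by simp
  have \<sigma>': "continuous_on (standard_simplex p) \<sigma>" "\<sigma> ` standard_simplex p \<subseteq> C" "\<sigma> \<in> extensional (standard_simplex p)"
    using \<sigma> by (auto simp: singular_simplex_euclidean)
  have "continuous_on ({0..1} \<times> standard_simplex p) (\<sigma> \<circ> ?h)"
  proof (rule continuous_on_compose)
    show "continuous_on ({0..1} \<times> standard_simplex p) ?h"
      by (intro continuous_on_coordinatewise_then_product continuous_intros
          continuous_on_compose2[OF continuous_on_product_coordinates continuous_on_snd]) auto
    show "continuous_on (?h ` ({0..1} \<times> standard_simplex p)) \<sigma>"
      by (rule continuous_on_subset[OF \<sigma>'(1)]) (use h in auto)
  qed
  then have "\<exists>g. continuous_on (standard_simplex p) g \<and> (\<forall>x\<in>standard_simplex p. exp (g x) = (\<sigma> \<circ> ?h) (1, x))"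
  proof (rule continuous_logarithm_homotopy[OF compact_standard_simplex])
    show "(\<sigma> \<circ> ?h) (s, x) \<noteq> 0" if "s \<in> {0..1}" "x \<in> standard_simplex p" for s x
      using h[OF that] \<sigma>'(2) C by auto
    show "(\<sigma> \<circ> ?h) (0, x) = \<sigma> vertex0" for x by simp
  qed
  then obtain g where g: "continuous_on (standard_simplex p) g"
      "\<And>x. x \<in> standard_simplex p \<Longrightarrow> exp (g x) = (\<sigma> \<circ> ?h) (1, x)"
    by blast
  have g': "exp (g x) = \<sigma> x" if "x \<in> standard_simplex p" for x
    using g(2)[OF that] by simp
  have "simplex_map p exp (restrict g (standard_simplex p)) = \<sigma>"
    using g' \<sigma>'(3) by (auto simp: simplex_map_def extensional_def)
  moreover have "singular_simplex p (top_of_set (exp -` C)) (restrict g (standard_simplex p))"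
    using g(1) g' \<sigma>'(2) by (intro singular_simplex_restrict) auto
  ultimately show ?thesis by blast
qed

text \<open>The difference of the two lifts divided by 2 pi i is continuous and integer valued on a
  connected simplex, hence constant.\<close>

lemma singular_simplex_lift_exp_unique:
  assumes \<tau>: "singular_simplex p (top_of_set S) \<tau>" and \<tau>': "singular_simplex p (top_of_set S') \<tau>'"
    and eq: "simplex_map p exp \<tau> = simplex_map p exp \<tau>'"
  shows "\<exists>n. \<tau>' = simplex_map p (deck n) \<tau>"
proof -
  let ?S = "standard_simplex p"
  define f where "f x = (\<tau>' x - \<tau> x) / (2 * of_real pi * \<i>)" for x
  have c: "continuous_on ?S \<tau>" "continuous_on ?S \<tau>'" "\<tau> \<in> extensional ?S" "\<tau>' \<in> extensional ?S"
    using \<tau> \<tau>' by (auto simp: singular_simplex_euclidean)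
  have f: "\<exists>n::int. f x = of_int n" if x: "x \<in> ?S" for x
  proof -
    have "exp (\<tau>' x) = exp (\<tau> x)" using fun_cong[OF eq, of x] x by (simp add: simplex_map_def)
    then obtain n :: int where "\<tau>' x = \<tau> x + of_int (2 * n) * of_real pi * \<i>" by (auto simp: exp_eq)
    then show ?thesis by (intro exI[of _ n]) (simp add: f_def)
  qed
  have conn: "connected ?S"
    using connectedin_standard_simplex[of p] by (simp add: euclidean_product_topology)
  have "f constant_on ?S"
  proof (rule continuous_discrete_range_constant[OF conn])
    show "continuous_on ?S f" unfolding f_def by (intro continuous_intros c) auto
    fix x assume "x \<in> ?S"
    then obtain n :: int where n: "f x = of_int n" using f by blast
    have "1 \<le> norm (f y - f x)" if y: "y \<in> ?S" "f y \<noteq> f x" for y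
    proof -
      obtain m :: int where m: "f y = of_int m" using f y by blast
      have "norm (f y - f x) = \<bar>of_int (m - n)\<bar>" unfolding m n of_int_diff[symmetric] norm_of_int ..
      moreover have "m \<noteq> n" using y(2) m n by auto
      ultimately show ?thesis by linarith
    qed
    then show "\<exists>e>0. \<forall>y. y \<in> ?S \<and> f y \<noteq> f x \<longrightarrow> e \<le> norm (f y - f x)"
      by (intro exI[of _ 1]) auto
  qed
  then obtain a where a: "\<And>x. x \<in> ?S \<Longrightarrow> f x = a" by (auto simp: constant_on_def)
  moreover obtain n :: int where "f vertex0 = of_int n" using f[of vertex0] by auto
  ultimately have "f x = of_int n" if "x \<in> ?S" for x using that a[of vertex0] by simp
  then have "\<tau>' x = deck n (\<tau> x)" if "x \<in> ?S" for x
    using that by (simp add: f_def deck_def field_simps)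
  then have "\<tau>' = simplex_map p (deck n) \<tau>"
    using c by (auto simp: simplex_map_def extensional_def)
  then show ?thesis ..
qed

lemma continuous_map_deck: "continuous_map (top_of_set (exp -` C)) (top_of_set (exp -` C)) (deck n)"
  by (auto simp: continuous_on_deck)

lemma continuous_map_exp_vimage: "continuous_map (top_of_set (exp -` C)) (top_of_set (C :: complex set)) exp"
  by (simp add: continuous_on_exp)

lemma simplex_map_deck_deck: "simplex_map p (deck m) (simplex_map p (deck n) \<tau>) = simplex_map p (deck (m + n)) \<tau>"
  by (auto simp: simplex_map_def deck_deck fun_eq_iff)

lemma simplex_map_deck_0:
  "singular_simplex p X \<tau> \<Longrightarrow> simplex_map p (deck 0) \<tau> = \<tau>"
  by (auto simp: simplex_map_def singular_simplex_def extensional_def fun_eq_iff deck_0)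

lemma singular_simplex_deck:
  "singular_simplex p (top_of_set (exp -` C)) \<tau> \<Longrightarrow> singular_simplex p (top_of_set (exp -` C)) (simplex_map p (deck n) \<tau>)"
  using singular_simplex_simplex_map continuous_map_deck by blast

text \<open>Injectivity is the existence of lifts. Together with
  \<open>deck_invariant_descends\<close> it identifies the cochains on C with the deck-invariant
  cochains on the covering.\<close>

lemma cochain_pullback_exp_inject:
  fixes C :: "complex set"
  assumes C: "0 \<notin> C" and \<phi>: "\<phi> \<in> cochains p (top_of_set C)" and \<phi>': "\<phi>' \<in> cochains p (top_of_set C)"
    and eq: "cochain_pullback p (top_of_set (exp -` C)) exp \<phi> = cochain_pullback p (top_of_set (exp -` C)) exp \<phi>'"
  shows "\<phi> = \<phi>'"
proof
  fix \<sigma>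
  show "\<phi> \<sigma> = \<phi>' \<sigma>"
  proof (cases "singular_simplex p (top_of_set C) \<sigma>")
    case True
    then obtain \<tau> where "singular_simplex p (top_of_set (exp -` C)) \<tau>" "simplex_map p exp \<tau> = \<sigma>"
      using singular_simplex_lift_exp C by blast
    then show ?thesis using fun_cong[OF eq, of \<tau>] by (simp add: cochain_pullback_def)
  qed (use \<phi> \<phi>' in \<open>auto simp: cochains_def\<close>)
qed

text \<open>All lifts of a simplex form one deck orbit, so an invariant cochain has the same value
  on whichever lift is chosen.\<close>

lemma deck_invariant_descends:
  fixes \<psi> :: "(complex, 'k::field) cochain"
  assumes C: "0 \<notin> C" and \<psi>: "\<psi> \<in> cochains p (top_of_set (exp -` C))"
    and inv: "cochain_pullback p (top_of_set (exp -` C)) (deck 1) \<psi> = \<psi>"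
  shows "\<exists>\<eta>\<in>cochains p (top_of_set C). cochain_pullback p (top_of_set (exp -` C)) exp \<eta> = \<psi>"
proof -
  let ?E = "top_of_set (exp -` C) :: complex topology"
  have inv1: "\<psi> (simplex_map p (deck 1) \<tau>) = \<psi> \<tau>" if "singular_simplex p ?E \<tau>" for \<tau>
    using fun_cong[OF inv, of \<tau>] that by (simp add: cochain_pullback_def)
  have inv: "\<psi> (simplex_map p (deck n) \<tau>) = \<psi> \<tau>" if \<tau>: "singular_simplex p ?E \<tau>" for \<tau> n
  proof (induction n rule: int_induct[of _ 0])
    case base
    then show ?case using simplex_map_deck_0[OF \<tau>] by simp
  next
    case (step1 i)
    then show ?case
      using inv1[OF singular_simplex_deck[OF \<tau>, of i]] by (simp add: simplex_map_deck_deck add.commute)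
  next
    case (step2 i)
    then show ?case
      using inv1[OF singular_simplex_deck[OF \<tau>, of "i - 1"]] by (simp add: simplex_map_deck_deck)
  qed
  define lift where "lift \<sigma> = (SOME \<tau>. singular_simplex p ?E \<tau> \<and> simplex_map p exp \<tau> = \<sigma>)" for \<sigma>
  have lift: "singular_simplex p ?E (lift \<sigma>) \<and> simplex_map p exp (lift \<sigma>) = \<sigma>"
    if "singular_simplex p (top_of_set C) \<sigma>" for \<sigma>
    using someI_ex[OF singular_simplex_lift_exp[OF that C]] unfolding lift_def .
  define \<eta> where "\<eta> \<sigma> = (if singular_simplex p (top_of_set C) \<sigma> then \<psi> (lift \<sigma>) else 0)" for \<sigma>
  have "cochain_pullback p ?E exp \<eta> \<tau> = \<psi> \<tau>" for \<tau>
  proof (cases "singular_simplex p ?E \<tau>")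
    case True
    have s: "singular_simplex p (top_of_set C) (simplex_map p exp \<tau>)"
      by (rule singular_simplex_simplex_map[OF True continuous_map_exp_vimage])
    obtain n where "lift (simplex_map p exp \<tau>) = simplex_map p (deck n) \<tau>"
      using singular_simplex_lift_exp_unique[OF True, of "exp -` C" "lift (simplex_map p exp \<tau>)"] lift[OF s] by metis
    then show ?thesis using True s inv[OF True] by (simp add: cochain_pullback_def \<eta>_def)
  qed (use \<psi> in \<open>simp add: cochain_pullback_def cochains_def\<close>)
  then show ?thesis by (intro bexI[of _ \<eta>]) (auto simp: cochains_def \<eta>_def)
qed

text \<open>Numbers the strips 2 pi n \<le> Im z < 2 pi (n + 1). It is discontinuous, but it is
  evaluated only at one vertex of a simplex, where it fixes an origin in each deck orbit; what
  matters is its equivariance \<open>sheet_deck\<close>.\<close>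

definition sheet :: "complex \<Rightarrow> int" where
  "sheet z = \<lfloor>Im z / (2 * pi)\<rfloor>"

lemma sheet_deck [simp]: "sheet (deck n z) = sheet z + n"
proof -
  have "Im (deck n z) / (2 * pi) = Im z / (2 * pi) + of_int n"
    by (simp add: deck_def field_simps)
  then show ?thesis by (simp add: sheet_def)
qed

text \<open>Since the deck group acts freely on singular simplices, the difference equation
  can be solved along each orbit.\<close>

lemma deck_difference_surj:
  fixes \<theta> :: "(complex, 'k::field) cochain"
  assumes \<theta>: "\<theta> \<in> cochains p (top_of_set (exp -` C))"
  shows "\<exists>\<omega>\<in>cochains p (top_of_set (exp -` C)).
    (\<lambda>\<tau>. cochain_pullback p (top_of_set (exp -` C)) (deck 1) \<omega> \<tau> - \<omega> \<tau>) = \<theta>"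
proof -
  let ?E = "top_of_set (exp -` C) :: complex topology"
  let ?n = "\<lambda>\<tau>. sheet (\<tau> vertex0)"
  \<comment> \<open>A discrete antiderivative along the deck orbit, normalised to vanish on sheet 0:
    a simplex on sheet n collects the values of \<theta> on its translates to the sheets 0, ..., n -
    1, or with opposite sign to n, ..., -1 if n < 0. The translate to sheet k is by k - n.\<close>
  define \<omega> where "\<omega> \<tau> = (if singular_simplex p ?E \<tau> then
      (\<Sum>k\<in>{0..<?n \<tau>}. \<theta> (simplex_map p (deck (k - ?n \<tau>)) \<tau>))
    - (\<Sum>k\<in>{?n \<tau>..<0}. \<theta> (simplex_map p (deck (k - ?n \<tau>)) \<tau>)) else 0)" for \<tau>
  have "cochain_pullback p ?E (deck 1) \<omega> \<tau> - \<omega> \<tau> = \<theta> \<tau>" for \<tau>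
  proof (cases "singular_simplex p ?E \<tau>")
    case True
    define n where "n = ?n \<tau>"
    define u where "u k = \<theta> (simplex_map p (deck (k - n)) \<tau>)" for k
    have u: "u n = \<theta> \<tau>" using simplex_map_deck_0[OF True] by (simp add: u_def)
    have n: "?n (simplex_map p (deck 1) \<tau>) = n + 1"
      by (simp add: simplex_map_def n_def)
    have 1: "\<omega> (simplex_map p (deck 1) \<tau>) = (\<Sum>k\<in>{0..<n + 1}. u k) - (\<Sum>k\<in>{n + 1..<0}. u k)"
      using singular_simplex_deck[OF True, of 1] by (simp add: \<omega>_def n simplex_map_deck_deck u_def algebra_simps)
    have 2: "\<omega> \<tau> = (\<Sum>k\<in>{0..<n}. u k) - (\<Sum>k\<in>{n..<0}. u k)"
      using True by (simp add: \<omega>_def u_def n_def)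
    have "\<omega> (simplex_map p (deck 1) \<tau>) - \<omega> \<tau> = u n"
    proof (cases "n \<ge> 0")
      case True
      then have "{0..<n + 1} = insert n {0..<n}" "{n + 1..<0} = {}" "{n..<0} = {}" by auto
      then show ?thesis unfolding 1 2 by simp
    next
      case False
      then have "{n..<0} = insert n {n + 1..<0}" "{0..<n + 1} = {}" "{0..<n} = {}" by auto
      then show ?thesis unfolding 1 2 by simp
    qed
    then show ?thesis using True u by (simp add: cochain_pullback_def)
  qed (use \<theta> in \<open>auto simp: cochain_pullback_def cochains_def \<omega>_def\<close>)
  then show ?thesis by (intro bexI[of _ \<omega>]) (auto simp: cochains_def \<omega>_def)
qed

section \<open>Cohomology of C from its acyclic covering\<close>

lemma coboundary_diff:
  "coboundary p X (\<lambda>\<sigma>. \<phi> \<sigma> - c * \<psi> \<sigma>) = (\<lambda>\<sigma>. coboundary p X \<phi> \<sigma> - c * coboundary p X \<psi> \<sigma>)"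
  using coboundary_linear[of p X "- c" \<psi> \<phi>] by simp

lemma cochain_pullback_diff:
  "cochain_pullback p X f (\<lambda>\<sigma>. \<phi> \<sigma> - c * \<psi> \<sigma>) = (\<lambda>\<sigma>. cochain_pullback p X f \<phi> \<sigma> - c * cochain_pullback p X f \<psi> \<sigma>)"
  using cochain_pullback_linear[of p X f "- c" \<psi> \<phi>] by simp

lemma coboundary_in_cochains: "coboundary p X \<phi> \<in> cochains (Suc p) X"
  by (simp add: coboundary_def cochains_def)

lemma cochain_pullback_deck_exp:
  "cochain_pullback p (top_of_set (exp -` C)) (deck n) (cochain_pullback p (top_of_set (exp -` C)) exp \<phi>)
     = cochain_pullback p (top_of_set (exp -` C)) exp \<phi>"
  by (simp add: cochain_pullback_compose[OF continuous_map_deck] o_def)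

text \<open>On the covering \<phi> becomes d \<psi>. The defect D \<psi> - \<psi> is closed because
  the pullback of \<phi> is invariant; its degree is positive, so it is d \<theta>. Solving D
  \<omega> - \<omega> = \<theta> makes \<psi> - d \<omega> invariant, and this descends to a
  primitive of \<phi>. Degree at least 2 is what gives the defect positive degree.\<close>

lemma cocycles_subset_coboundaries_exp:
  fixes C :: "complex set"
  assumes C: "0 \<notin> C"
    and E: "\<And>q. (cocycles (Suc q) (top_of_set (exp -` C)) :: (complex, 'k::field) cochain set)
        \<subseteq> coboundaries (Suc q) (top_of_set (exp -` C))"
  shows "(cocycles (Suc (Suc p)) (top_of_set C) :: (complex, 'k) cochain set)
        \<subseteq> coboundaries (Suc (Suc p)) (top_of_set C)"
proof
  fix \<phi> :: "(complex, 'k) cochain" assume \<phi>: "\<phi> \<in> cocycles (Suc (Suc p)) (top_of_set C)"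
  let ?E = "top_of_set (exp -` C) :: complex topology"
  let ?D = "\<lambda>q. cochain_pullback q ?E (deck 1)"
  note ce = continuous_map_exp_vimage[of C] and cd = continuous_map_deck[of C 1]
  obtain \<psi> where \<psi>: "\<psi> \<in> cochains (Suc p) ?E" "cochain_pullback (Suc (Suc p)) ?E exp \<phi> = coboundary (Suc p) ?E \<psi>"
    using E[of "Suc p"] cochain_pullback_cocycles[OF ce \<phi>] by (auto simp: coboundaries_def)
  define \<theta>' where "\<theta>' = (\<lambda>\<tau>. ?D (Suc p) \<psi> \<tau> - 1 * \<psi> \<tau>)"
  have "\<theta>' \<in> cochains (Suc p) ?E"
    using \<psi>(1) by (auto simp: \<theta>'_def cochains_def cochain_pullback_def)
  moreover have "coboundary (Suc p) ?E \<theta>' = (\<lambda>_. 0)"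
    unfolding \<theta>'_def coboundary_diff cochain_pullback_coboundary[OF cd, symmetric] \<psi>(2)[symmetric]
      cochain_pullback_deck_exp by simp
  ultimately have "\<theta>' \<in> coboundaries (Suc p) ?E" using E[of p] by (auto simp: cocycles_def)
  then obtain \<theta> where \<theta>: "\<theta> \<in> cochains p ?E" "\<theta>' = coboundary p ?E \<theta>" by (auto simp: coboundaries_def)
  obtain \<omega> where \<omega>: "\<omega> \<in> cochains p ?E" "(\<lambda>\<tau>. ?D p \<omega> \<tau> - \<omega> \<tau>) = \<theta>"
    using deck_difference_surj[OF \<theta>(1)] by blast
  define \<psi>' where "\<psi>' = (\<lambda>\<tau>. \<psi> \<tau> - 1 * coboundary p ?E \<omega> \<tau>)"
  have "coboundary p ?E (\<lambda>\<tau>. ?D p \<omega> \<tau> - 1 * \<omega> \<tau>) = \<theta>'" using \<omega>(2) \<theta>(2) by simp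
  then have "?D (Suc p) \<psi>' \<tau> = \<psi>' \<tau>" for \<tau>
    unfolding \<theta>'_def \<psi>'_def coboundary_diff cochain_pullback_diff cochain_pullback_coboundary[OF cd]
    by (auto simp: fun_eq_iff algebra_simps)
  then have "?D (Suc p) \<psi>' = \<psi>'" ..
  moreover have "\<psi>' \<in> cochains (Suc p) ?E"
    using \<psi>(1) coboundary_in_cochains[of p ?E \<omega>] by (auto simp: \<psi>'_def cochains_def)
  ultimately obtain \<eta> where \<eta>: "\<eta> \<in> cochains (Suc p) (top_of_set C)" "cochain_pullback (Suc p) ?E exp \<eta> = \<psi>'"
    using deck_invariant_descends[OF C] by blast
  have "cochain_pullback (Suc (Suc p)) ?E exp (coboundary (Suc p) (top_of_set C) \<eta>)
      = cochain_pullback (Suc (Suc p)) ?E exp \<phi>"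
    unfolding cochain_pullback_coboundary[OF ce] \<eta>(2) \<psi>(2) \<psi>'_def coboundary_diff coboundary_coboundary
    by simp
  then have "coboundary (Suc p) (top_of_set C) \<eta> = \<phi>"
    using \<phi> by (intro cochain_pullback_exp_inject[OF C coboundary_in_cochains]) (auto simp: cocycles_def)
  then show "\<phi> \<in> coboundaries (Suc (Suc p)) (top_of_set C)" using \<eta>(1) by (auto simp: coboundaries_def)
qed

text \<open>An integer valued stand-in for Im z / (2 pi): the deck generator raises it by 1, and
  integers map into a field of any characteristic.\<close>

definition sheet_cochain :: "complex topology \<Rightarrow> (complex, 'k::field) cochain" where
  "sheet_cochain X \<tau> = (if singular_simplex 0 X \<tau> then of_int (sheet (\<tau> vertex0)) else 0)"

lemma sheet_cochain_deck:
  assumes "singular_simplex 0 (top_of_set (exp -` C)) \<tau>"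
  shows "cochain_pullback 0 (top_of_set (exp -` C)) (deck 1) (sheet_cochain (top_of_set (exp -` C))) \<tau>
    = (sheet_cochain (top_of_set (exp -` C)) \<tau> + 1 :: 'k::field)"
  using singular_simplex_deck[OF assms, of 1] assms
  by (simp add: cochain_pullback_def sheet_cochain_def simplex_map_def)

text \<open>The class of \<open>d arg / 2\<pi>\<close> on the punctured plane, with values in the prime field.\<close>

lemma angular_cocycle_exists:
  "\<exists>\<omega> :: (complex, 'k::field) cochain. \<omega> \<in> cocycles 1 (top_of_set (- {0})) \<and>
     cochain_pullback 1 (top_of_set (exp -` (- {0}))) exp \<omega>
       = coboundary 0 (top_of_set (exp -` (- {0}))) (sheet_cochain (top_of_set (exp -` (- {0}))))"
proof -
  let ?C = "- {0} :: complex set"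
  let ?E = "top_of_set (exp -` ?C) :: complex topology"
  let ?s = "sheet_cochain ?E :: (complex, 'k) cochain"
  note ce = continuous_map_exp_vimage[of ?C] and cd = continuous_map_deck[of ?C 1]
  \<comment> \<open>The deck generator adds the constant 1 to the labels, and constants cancel in
    the difference of the two endpoints.\<close>
  have "cochain_pullback (Suc 0) ?E (deck 1) (coboundary 0 ?E ?s) \<tau> = coboundary 0 ?E ?s \<tau>" for \<tau>
  proof (cases "singular_simplex (Suc 0) ?E \<tau>")
    case True
    have "singular_simplex 0 ?E (singular_face (Suc 0) k \<tau>)" if "k \<le> Suc 0" for k
      using singular_simplex_singular_face[OF True _ that] by simp
    then show ?thesis
      unfolding cochain_pullback_coboundary[OF cd] using True by (simp add: coboundary_def sheet_cochain_deck)
  qed (simp add: cochain_pullback_def coboundary_def)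
  then have "cochain_pullback (Suc 0) ?E (deck 1) (coboundary 0 ?E ?s) = coboundary 0 ?E ?s" ..
  then obtain \<omega> where \<omega>: "\<omega> \<in> cochains (Suc 0) (top_of_set ?C)" "cochain_pullback (Suc 0) ?E exp \<omega> = coboundary 0 ?E ?s"
    using deck_invariant_descends[of ?C "coboundary 0 ?E ?s" "Suc 0"] coboundary_in_cochains[of 0 ?E ?s] by auto
  have "cochain_pullback (Suc (Suc 0)) ?E exp (coboundary (Suc 0) (top_of_set ?C) \<omega>)
     = cochain_pullback (Suc (Suc 0)) ?E exp (\<lambda>_. 0)"
    unfolding cochain_pullback_coboundary[OF ce] \<omega>(2) coboundary_coboundary by (simp add: cochain_pullback_def)
  then have "coboundary (Suc 0) (top_of_set ?C) \<omega> = (\<lambda>_. 0)"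
    by (intro cochain_pullback_exp_inject[OF _ coboundary_in_cochains, of ?C]) (auto simp: cochains_def)
  then show ?thesis using \<omega> by (intro exI[of _ \<omega>]) (simp add: cocycles_def)
qed

text \<open>By \<open>cochain_pullback_exp_inject\<close> exactly one cochain qualifies, so the
  choice is harmless.\<close>

definition angular_cocycle :: "(complex, 'k::field) cochain" where
  "angular_cocycle = (SOME \<omega>. \<omega> \<in> cocycles 1 (top_of_set (- {0})) \<and>
     cochain_pullback 1 (top_of_set (exp -` (- {0}))) exp \<omega>
       = coboundary 0 (top_of_set (exp -` (- {0}))) (sheet_cochain (top_of_set (exp -` (- {0})))))"

lemma angular_cocycle:
  "(angular_cocycle :: (complex, 'k::field) cochain) \<in> cocycles 1 (top_of_set (- {0}))"
  and cochain_pullback_exp_angular: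
  "cochain_pullback 1 (top_of_set (exp -` (- {0}))) exp (angular_cocycle :: (complex, 'k::field) cochain)
       = coboundary 0 (top_of_set (exp -` (- {0}))) (sheet_cochain (top_of_set (exp -` (- {0}))))"
  using someI_ex[OF angular_cocycle_exists[where 'k = 'k]] unfolding angular_cocycle_def by auto

text \<open>Here the defect D \<psi> - \<psi> is a closed 0-cochain on a path-connected space, hence
  a constant c, the period of \<phi>. The sheet cochain has defect 1, so \<psi> minus c times the
  sheet cochain is invariant and descends to a primitive of \<phi> minus c times the angular
  class.\<close>

lemma cocycle_1_exp:
  fixes C :: "complex set" and \<phi> :: "(complex, 'k::field) cochain"
  assumes C: "0 \<notin> C" and conn: "path_connected (exp -` C :: complex set)"
    and E: "(cocycles 1 (top_of_set (exp -` C)) :: (complex, 'k) cochain set)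
        \<subseteq> coboundaries 1 (top_of_set (exp -` C))"
    and \<phi>: "\<phi> \<in> cocycles 1 (top_of_set C)"
  shows "\<exists>c. (\<lambda>\<sigma>. \<phi> \<sigma> - c * cochain_pullback 1 (top_of_set C) id angular_cocycle \<sigma>) \<in> coboundaries 1 (top_of_set C)"
proof -
  let ?U = "top_of_set (exp -` (- {0})) :: complex topology"
  let ?E = "top_of_set (exp -` C) :: complex topology"
  let ?D = "\<lambda>q. cochain_pullback q ?E (deck 1)"
  let ?s = "sheet_cochain ?E :: (complex, 'k) cochain"
  let ?\<omega> = "cochain_pullback 1 (top_of_set C) id angular_cocycle :: (complex, 'k) cochain"
  note ce = continuous_map_exp_vimage[of C] and cd = continuous_map_deck[of C 1]
  have EU: "continuous_map ?E ?U id" using C by auto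
  \<comment> \<open>The angular class restricted to C still becomes the coboundary of the sheet
    labels on the part of the covering that lies over C.\<close>
  have "cochain_pullback 1 ?E exp ?\<omega> = cochain_pullback 1 ?E id (cochain_pullback 1 ?U exp angular_cocycle)"
    unfolding cochain_pullback_compose[OF ce] cochain_pullback_compose[OF EU] by simp
  also have "\<dots> = coboundary 0 ?E (cochain_pullback 0 ?E id (sheet_cochain ?U))"
    unfolding cochain_pullback_exp_angular using cochain_pullback_coboundary[OF EU, of 0] by simp
  also have "cochain_pullback 0 ?E id (sheet_cochain ?U) = ?s"
  proof
    fix \<tau>
    show "cochain_pullback 0 ?E id (sheet_cochain ?U) \<tau> = ?s \<tau>"
      using singular_simplex_simplex_map[OF _ EU, of 0 \<tau>]
      by (auto simp: cochain_pullback_def sheet_cochain_def simplex_map_def)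
  qed
  finally have \<omega>: "cochain_pullback 1 ?E exp ?\<omega> = coboundary 0 ?E ?s" .
  obtain \<psi> where \<psi>: "\<psi> \<in> cochains 0 ?E" "cochain_pullback 1 ?E exp \<phi> = coboundary 0 ?E \<psi>"
    using E cochain_pullback_cocycles[OF ce \<phi>] by (auto simp: coboundaries_def)
  define \<theta> where "\<theta> = (\<lambda>\<tau>. ?D 0 \<psi> \<tau> - 1 * \<psi> \<tau>)"
  have "\<theta> \<in> cochains 0 ?E" using \<psi>(1) by (auto simp: \<theta>_def cochains_def cochain_pullback_def)
  moreover have "coboundary 0 ?E \<theta> = (\<lambda>_. 0)"
    unfolding \<theta>_def coboundary_diff cochain_pullback_coboundary[OF cd, symmetric] \<psi>(2)[symmetric]
      One_nat_def[symmetric] cochain_pullback_deck_exp by simp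
  ultimately have \<theta>: "\<theta> \<in> cocycles 0 ?E" by (simp add: cocycles_def)
  have "\<exists>c. \<forall>\<tau>. singular_simplex 0 ?E \<tau> \<longrightarrow> \<theta> \<tau> = c"
  proof (cases "exp -` C = ({} :: complex set)")
    case False
    then obtain a where a: "a \<in> exp -` C" by blast
    have "\<theta> \<tau> = \<theta> (restrict (\<lambda>_. a) (standard_simplex 0))" if \<tau>: "singular_simplex 0 ?E \<tau>" for \<tau>
    proof -
      obtain b where b: "b \<in> exp -` C" "\<tau> = restrict (\<lambda>_. b) (standard_simplex 0)"
        using \<tau> by (auto simp: singular_simplex_0)
      obtain g where g: "path g" "path_image g \<subseteq> exp -` C" "pathstart g = a" "pathfinish g = b"
        using conn[unfolded path_connected_def] a b(1) by blast
      then have "pathin ?E g" by (auto simp: pathin_def path_def path_image_def)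
      then show ?thesis using cocycle_0_path[OF \<theta>, of g] g(3,4) b by (simp add: pathstart_def pathfinish_def)
    qed
    then show ?thesis by blast
  qed (auto simp: singular_simplex_empty)
  then obtain c where c: "\<And>\<tau>. singular_simplex 0 ?E \<tau> \<Longrightarrow> \<theta> \<tau> = c" by blast
  define \<psi>' where "\<psi>' = (\<lambda>\<tau>. \<psi> \<tau> - c * ?s \<tau>)"
  have "?D 0 \<psi>' \<tau> = \<psi>' \<tau>" for \<tau>
  proof (cases "singular_simplex 0 ?E \<tau>")
    case True
    then have "?D 0 \<psi> \<tau> = \<psi> \<tau> + c" using c[OF True] by (simp add: \<theta>_def algebra_simps)
    then show ?thesis
      unfolding \<psi>'_def cochain_pullback_diff using sheet_cochain_deck[OF True, where 'k = 'k] by (simp add: algebra_simps)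
  qed (use \<psi>(1) in \<open>simp add: cochain_pullback_def \<psi>'_def cochains_def sheet_cochain_def\<close>)
  then have "?D 0 \<psi>' = \<psi>'" ..
  moreover have "\<psi>' \<in> cochains 0 ?E"
    using \<psi>(1) by (auto simp: \<psi>'_def cochains_def sheet_cochain_def)
  ultimately obtain \<eta> where \<eta>: "\<eta> \<in> cochains 0 (top_of_set C)" "cochain_pullback 0 ?E exp \<eta> = \<psi>'"
    using deck_invariant_descends[OF C] by blast
  have "cochain_pullback 1 ?E exp (coboundary 0 (top_of_set C) \<eta>)
      = cochain_pullback 1 ?E exp (\<lambda>\<sigma>. \<phi> \<sigma> - c * ?\<omega> \<sigma>)"
    unfolding cochain_pullback_diff \<omega> \<psi>(2) coboundary_diff[symmetric] \<psi>'_def[symmetric] \<eta>(2)[symmetric]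
    using cochain_pullback_coboundary[OF ce, of 0] by simp
  then have "coboundary 0 (top_of_set C) \<eta> = (\<lambda>\<sigma>. \<phi> \<sigma> - c * ?\<omega> \<sigma>)"
  proof (rule cochain_pullback_exp_inject[OF C, rotated 2])
    show "coboundary 0 (top_of_set C) \<eta> \<in> cochains 1 (top_of_set C)"
      using coboundary_in_cochains[of 0] by simp
    have "\<phi> \<in> cochains 1 (top_of_set C)" using \<phi> by (simp add: cocycles_def)
    then show "(\<lambda>\<sigma>. \<phi> \<sigma> - c * ?\<omega> \<sigma>) \<in> cochains 1 (top_of_set C)"
      by (simp add: cochains_def cochain_pullback_def)
  qed
  then show ?thesis using \<eta>(1) by (intro exI[of _ c]) (simp add: coboundaries_def rev_image_eqI)
qed

text \<open>On the covering the angular class is exact, so only the endpoints of the lift g count.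
  If g 1 = deck 1 (g 0) the value is 1, which is nonzero in every field.\<close>

lemma angular_cocycle_loop:
  assumes "path g"
  shows "angular_cocycle (restrict (\<lambda>t. exp (g (t 1))) (standard_simplex 1))
    = (of_int (sheet (g 1)) - of_int (sheet (g 0)) :: 'k::field)"
proof -
  let ?U = "top_of_set (exp -` (- {0})) :: complex topology"
  let ?\<tau> = "restrict (\<lambda>t. g (t 1)) (standard_simplex 1)"
  have g: "pathin ?U g" using assms by (simp add: pathin_def path_def)
  have "angular_cocycle (simplex_map 1 exp ?\<tau>) = cochain_pullback 1 ?U exp (angular_cocycle :: (complex, 'k) cochain) ?\<tau>"
    using singular_simplex_path[OF g] by (simp add: cochain_pullback_def)
  also have "\<dots> = of_int (sheet (g 1)) - of_int (sheet (g 0))"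
    unfolding cochain_pullback_exp_angular coboundary_path[OF g]
    by (auto simp: sheet_cochain_def singular_simplex_0)
  also have "simplex_map 1 exp ?\<tau> = restrict (\<lambda>t. exp (g (t 1))) (standard_simplex 1)"
    by (auto simp: simplex_map_def)
  finally show ?thesis .
qed

section \<open>Planar domains\<close>

lemma cocycles_subset_coboundaries_empty:
  assumes "topspace X = {}"
  shows "(cocycles (Suc p) X :: ('a, 'k::field) cochain set) \<subseteq> coboundaries (Suc p) X"
proof
  fix \<phi> :: "('a, 'k) cochain" assume "\<phi> \<in> cocycles (Suc p) X"
  then have "\<phi> = (\<lambda>_. 0)"
    using singular_simplex_empty[OF assms, of "Suc p"] by (auto simp: cocycles_def cochains_def)
  then show "\<phi> \<in> coboundaries (Suc p) X"
    using linear_closedD(1)[OF linear_closed_coboundaries] by simp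
qed

lemma cocycles_subset_coboundaries_simply_connected:
  fixes S :: "complex set"
  assumes "open S" "simply_connected S"
  shows "(cocycles (Suc p) (top_of_set S) :: (complex, 'k::field) cochain set) \<subseteq> coboundaries (Suc p) (top_of_set S)"
proof (cases "S = {}")
  case False
  then have "S homeomorphic ball (0::complex) 1"
    using assms simply_connected_eq_homeomorphic_to_disc by blast
  then have "top_of_set S homeomorphic_space top_of_set (ball (0::complex) 1)"
    by simp
  then show ?thesis
    by (rule cocycles_subset_coboundaries_homeomorphic) (intro cocycles_subset_coboundaries_convex, auto)
qed (simp add: cocycles_subset_coboundaries_empty)

text \<open>The set - outside V is V with its bounded complementary components filled in. Its
  complement is a single component of the complement of V, and the complement of such a component is
  connected because V is. For a bounded open set, connectedness of the set and of its complement
  amounts to simple connectivity.\<close>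

lemma
  fixes V :: "complex set"
  assumes V: "open V" "connected V" "bounded V"
  shows closed_outside: "closed (outside V)"
    and unbounded_connected_outside: "connected (outside V)" "\<not> bounded (outside V)"
    and simply_connected_filled: "simply_connected (- outside V)"
    and bounded_filled: "bounded (- outside V)"
proof -
  have comp: "outside V \<in> components (- V)" and ub: "\<not> bounded (outside V)"
    using bounded_unique_outside[of V "outside V"] V(3) by auto
  show cl: "closed (outside V)" using closed_components[OF _ comp] V(1) by auto
  show conn: "connected (outside V)" using comp by (rule in_components_connected)
  show "\<not> bounded (outside V)" by fact
  show b: "bounded (- outside V)"
    using V(3) bounded_inside[OF V(3)] by (simp add: union_with_inside[symmetric])
  have "connected (- outside V)" by (rule component_complement_connected[OF V(2) comp])
  then show "simply_connected (- outside V)"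
    using cl b conn by (subst simply_connected_iff_simple) auto
qed

text \<open>The trace of U on M is clopen in M. In the applications K is a closed set that contains
  U and adds to it only points off M.\<close>

lemma connected_clopen_subset:
  assumes "connected M" "open U" "closed K" "M \<inter> U = M \<inter> K" "M \<inter> U \<noteq> {}"
  shows "M \<subseteq> U"
proof -
  have "openin (top_of_set M) (M \<inter> U)" using assms(2) by auto
  moreover have "closedin (top_of_set M) (M \<inter> U)"
    unfolding assms(4) using assms(3) by (rule closedin_closed_Int)
  ultimately have "M \<inter> U = M"
    using assms(1,5) unfolding connected_clopen by blast
  then show ?thesis by blast
qed

text \<open>Suppose a loop in the preimage encloses a point z outside the preimage. Let
  \<open>?Q\<close> be the inside of the loop and \<open>?K\<close> its union with the loop. The
  image of \<open>?Q\<close> is open by the open mapping theorem, that of \<open>?K\<close> is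
  compact, and both meet L \<union> R in the same set because the loop avoids the preimage of L
  \<union> R. So L or R, whichever contains exp z, lies in the image of \<open>?Q\<close>. For L
  this fails because 0 is not a value of \<open>exp\<close>, for R because R is unbounded.\<close>

lemma simply_connected_exp_vimage:
  fixes L R :: "complex set"
  assumes L: "connected L" "closed L" "0 \<in> L" and R: "connected R" "closed R" "\<not> bounded R"
    and conn: "connected (exp -` (- (L \<union> R)) :: complex set)"
  shows "simply_connected (exp -` (- (L \<union> R)) :: complex set)"
proof -
  let ?E = "exp -` (- (L \<union> R)) :: complex set"
  have "exp (0 :: complex) \<noteq> exp (of_real (ln 2))"
    by (simp only: exp_of_real) simp
  then have exp_nonconst: "\<not> (exp :: complex \<Rightarrow> complex) constant_on UNIV"
    unfolding constant_on_def by (metis UNIV_I)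
  have "open (- (L \<union> R))" using L R by (intro open_Compl closed_Un)
  then have E: "open ?E" by (rule open_vimage) (intro continuous_intros)
  have "winding_number g z = 0"
    if g: "path g" "path_image g \<subseteq> ?E" "pathfinish g = pathstart g" and z: "z \<notin> ?E" for g z
  proof (rule winding_number_zero_in_outside[OF g(1,3)], rule ccontr)
    let ?Q = "inside (path_image g)"
    let ?K = "path_image g \<union> ?Q"
    assume "z \<notin> outside (path_image g)"
    then have zQ: "z \<in> ?Q" using z g(2) inside_Un_outside[of "path_image g"] by blast
    have "compact ?K"
      using closed_path_image_Un_inside[OF g(1)] bounded_path_image[OF g(1)] bounded_inside
      by (auto simp: compact_eq_bounded_closed)
    then have eK: "compact (exp ` ?K)" by (intro compact_continuous_image continuous_intros)
    have "open ?Q" using g(1) by (intro open_inside closed_path_image)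
    then have eQ: "open (exp ` ?Q)"
      using exp_nonconst by (intro open_mapping_thm[of exp UNIV]) (auto simp: holomorphic_on_exp)
    have sub: "M \<subseteq> exp ` ?Q" if M: "connected M" "M \<subseteq> L \<union> R" "exp z \<in> M" for M
    proof (rule connected_clopen_subset[OF M(1) eQ compact_imp_closed[OF eK]])
      show "M \<inter> exp ` ?Q = M \<inter> exp ` ?K" using g(2) M(2) by blast
      show "M \<inter> exp ` ?Q \<noteq> {}" using M(3) zQ by blast
    qed
    have "exp z \<in> L \<or> exp z \<in> R" using z by auto
    then show False
    proof
      assume "exp z \<in> L"
      from sub[OF L(1) _ this] L(3) show False by auto
    next
      assume "exp z \<in> R"
      from sub[OF R(1) _ this] have "R \<subseteq> exp ` ?K" by auto
      then show False using R(3) bounded_subset[OF compact_imp_bounded[OF eK]] by blast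
    qed
  qed
  then show ?thesis using conn by (subst simply_connected_eq_winding_number_zero[OF E]) auto
qed

lemma exp_eq_deck: "exp z = exp w \<Longrightarrow> \<exists>n. z = deck n w"
  by (auto simp: exp_eq deck_def algebra_simps)

text \<open>Lifting a path of C joins any point of the preimage to some deck translate of the base
  point g 0, and the translates of g join all these translates to each other.\<close>

lemma path_connected_exp_vimage:
  assumes C: "path_connected C" "0 \<notin> C"
    and g: "path g" "\<And>t. t \<in> {0..1} \<Longrightarrow> exp (g t) \<in> C" "g 1 = deck 1 (g 0)"
  shows "path_connected (exp -` C :: complex set)"
proof -
  let ?E = "exp -` C :: complex set"
  let ?b = "g 0"
  have step: "path_component ?E (deck n ?b) (deck (n + 1) ?b)" for n
  proof -
    have "path (deck n \<circ> g)" using g(1) by (intro path_continuous_image continuous_on_deck)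
    moreover have "path_image (deck n \<circ> g) \<subseteq> ?E" using g(2) by (auto simp: path_image_def)
    ultimately show ?thesis
      unfolding path_component_def using g(3)
      by (intro exI[of _ "deck n \<circ> g"]) (auto simp: pathstart_def pathfinish_def deck_deck)
  qed
  have base: "?b \<in> ?E" using g(2)[of 0] by simp
  have deck: "path_component ?E (deck n ?b) ?b" for n
  proof (induction n rule: int_induct[of _ 0])
    case base
    then show ?case using \<open>?b \<in> ?E\<close> by (simp add: deck_0 path_component_refl)
  next
    case (step1 i)
    then show ?case using step[of i] by (metis path_component_sym path_component_trans)
  next
    case (step2 i)
    then show ?case using step[of "i - 1"] by (metis diff_add_cancel path_component_trans)
  qed
  have "path_component ?E e ?b" if e: "e \<in> ?E" for e
  proof -
    have "exp e \<in> C" "exp ?b \<in> C" using e base by auto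
    then obtain \<gamma> where \<gamma>: "path \<gamma>" "path_image \<gamma> \<subseteq> C" "\<gamma> 0 = exp e" "\<gamma> 1 = exp ?b"
      using C(1) unfolding path_connected_def pathstart_def pathfinish_def by metis
    have \<gamma>C: "\<gamma> t \<in> C" if "t \<in> {0..1}" for t using \<gamma>(2) that by (auto simp: path_image_def)
    have st: "s * t \<in> {0..1}" if "s \<in> {0..1}" "t \<in> {0..1}" for s t :: real
      using that by (auto intro: mult_le_one)
    \<comment> \<open>The homotopy (s, t) -> \<gamma> (s t) is constant at s = 0 and equals \<gamma>
      at s = 1, so its logarithm lifts \<gamma>.\<close>
    have "\<exists>h. continuous_on {0..1} h \<and> (\<forall>t\<in>{0..1}. exp (h t) = (\<gamma> \<circ> (\<lambda>z. fst z * snd z)) (1, t))"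
    proof (rule continuous_logarithm_homotopy)
      show "continuous_on ({0..1} \<times> {0..1}) (\<gamma> \<circ> (\<lambda>z. fst z * snd z))"
        using \<gamma>(1) st unfolding path_def
        by (intro continuous_on_compose continuous_intros) (auto elim!: continuous_on_subset)
      show "(\<gamma> \<circ> (\<lambda>z. fst z * snd z)) (s, t) \<noteq> 0" if "s \<in> {0..1}" "t \<in> {0..1}" for s t
        using \<gamma>C[OF st[OF that]] C(2) by auto
    qed auto
    then obtain h where h: "path h" "\<And>t. t \<in> {0..1} \<Longrightarrow> exp (h t) = \<gamma> t"
      by (auto simp: path_def)
    obtain n where n: "e = deck n (h 0)" using exp_eq_deck[of e "h 0"] h(2)[of 0] \<gamma>(3) by auto
    obtain m where m: "h 1 = deck m ?b" using exp_eq_deck[of "h 1" ?b] h(2)[of 1] \<gamma>(4) by auto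
    have "path (deck n \<circ> h)" using h(1) by (intro path_continuous_image continuous_on_deck)
    moreover have "path_image (deck n \<circ> h) \<subseteq> ?E" using h(2) \<gamma>C by (auto simp: path_image_def)
    ultimately have "path_component ?E e (deck (n + m) ?b)"
      unfolding path_component_def using n m
      by (intro exI[of _ "deck n \<circ> h"]) (auto simp: pathstart_def pathfinish_def deck_deck)
    then show ?thesis using deck path_component_trans by blast
  qed
  then show ?thesis
    unfolding path_connected_component by (metis path_component_sym path_component_trans)
qed

text \<open>The loop is the image of a large circle under a Riemann map of \<open>F\<close>; \<open>g\<close> is a logarithm of it.\<close>

lemma winding_loop_exists:
  fixes F K :: "complex set"
  assumes F: "open F" "simply_connected F" "bounded F" "0 \<in> F" and K: "compact K" "K \<subseteq> F"
  shows "\<exists>g. path g \<and> g 1 = deck 1 (g 0) \<and> (\<forall>t. exp (g t) \<in> F - K)"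
proof -
  let ?D = "ball 0 1 :: complex set"
  have "F \<noteq> UNIV" using F(3) not_bounded_UNIV by blast
  then have "\<exists>f g. f holomorphic_on F \<and> g holomorphic_on ?D \<and>
      (\<forall>z\<in>F. f z \<in> ?D \<and> g (f z) = z) \<and> (\<forall>z\<in>?D. g z \<in> F \<and> f (g z) = z)"
    using F(2,4) unfolding simply_connected_eq_biholomorphic_to_disc[OF F(1)] by blast
  then obtain f \<psi> where f: "f holomorphic_on F" and \<psi>: "\<psi> holomorphic_on ?D"
    and f\<psi>: "\<And>z. z \<in> F \<Longrightarrow> f z \<in> ?D \<and> \<psi> (f z) = z"
    and \<psi>f: "\<And>z. z \<in> ?D \<Longrightarrow> \<psi> z \<in> F \<and> f (\<psi> z) = z"
    by blast
  define a where "a = f 0"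
  have a: "a \<in> ?D" "\<psi> a = 0" using f\<psi>[OF F(4)] by (auto simp: a_def)
  \<comment> \<open>The injective map \<psi> vanishes only at a, and to first order. The quotient q
    of \<psi> by z - a is thus free of zeros and has a logarithm h on the disc.\<close>
  define q where "q z = (if z = a then deriv \<psi> a else (\<psi> z - \<psi> a) / (z - a))" for z
  have "inj_on \<psi> ?D" using \<psi>f by (metis inj_onI)
  then have "deriv \<psi> a \<noteq> 0" using holomorphic_injective_imp_regular[OF \<psi> open_ball _ a(1)] by blast
  moreover have "\<psi> z \<noteq> 0" if "z \<in> ?D" "z \<noteq> a" for z using \<psi>f[OF that(1)] that(2) by (auto simp: a_def)
  ultimately have q0: "q z \<noteq> 0" if "z \<in> ?D" for z using that a by (auto simp: q_def)
  have "q holomorphic_on ?D"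
    unfolding q_def using pole_lemma_open[OF \<psi> open_ball, of a] by simp
  moreover have "simply_connected ?D" by (intro convex_imp_simply_connected) auto
  ultimately obtain h where h: "h holomorphic_on ?D" "\<And>z. z \<in> ?D \<Longrightarrow> q z = exp (h z)"
    using q0 unfolding simply_connected_eq_holomorphic_log[OF open_ball] by metis
  \<comment> \<open>Adding 0 to K makes the circle of radius \<rho> enclose a = f 0 as well as the
    image of K.\<close>
  have "compact (f ` insert 0 K)"
    using K F(4) holomorphic_on_imp_continuous_on[OF f]
    by (intro compact_continuous_image) (auto elim: continuous_on_subset)
  moreover have "f ` insert 0 K \<noteq> {}" by simp
  ultimately obtain w where w: "w \<in> f ` insert 0 K" "\<And>v. v \<in> f ` insert 0 K \<Longrightarrow> norm v \<le> norm w"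
    using continuous_attains_sup[of "f ` insert 0 K" norm] continuous_on_norm_id by auto
  have "norm w < 1" using w(1) f\<psi> K(2) F(4) by auto
  then obtain \<rho> where \<rho>: "norm w < \<rho>" "\<rho> < 1" using dense by blast
  have \<rho>0: "\<rho> > 0" using \<rho>(1) norm_ge_zero[of w] by linarith
  have a\<rho>: "norm a < \<rho>" using w(2)[of a] \<rho>(1) by (auto simp: a_def)
  define c where "c t = of_real \<rho> * exp (2 * of_real pi * \<i> * of_real t)" for t :: real
  have nc: "norm (c t) = \<rho>" for t using \<rho>0 by (simp add: c_def norm_mult)
  then have cD: "c t \<in> ?D" for t using \<rho>(2) by simp
  \<comment> \<open>A logarithm of \<psi> (c t), from the factorisation of \<psi> z into z, 1 - a /
    z and q z. Since |a| < \<rho>, the second factor stays in the right half-plane, so the last two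
    logarithms return to their initial values after one turn; the logarithm of the first gains 2 pi
    i.\<close>
  define g where "g t = of_real (ln \<rho>) + 2 * of_real pi * \<i> * of_real t + Ln (1 - a / c t) + h (c t)" for t
  have ac: "norm (a / c t) < 1" for t using a\<rho> \<rho>0 by (simp add: norm_divide nc)
  have Re: "Re (1 - a / c t) > 0" for t
    using abs_Re_le_cmod[of "a / c t"] ac[of t] by simp
  have c0: "c t \<noteq> 0" for t using nc[of t] \<rho>0 by auto
  have cc: "continuous_on {0..1} c" unfolding c_def by (intro continuous_intros)
  have c1: "continuous_on {0..1} (\<lambda>t. 1 - a / c t)" using c0 by (intro continuous_intros cc) auto
  have cLn: "continuous_on {0..1} (\<lambda>t. Ln (1 - a / c t))"
    by (rule continuous_on_Ln'[OF c1]) (use Re in \<open>auto simp: complex_nonpos_Reals_iff not_le\<close>)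
  have ch: "continuous_on {0..1} (\<lambda>t. h (c t))"
    by (rule continuous_on_compose2[OF holomorphic_on_imp_continuous_on[OF h(1)] cc]) (use cD in auto)
  have "continuous_on {0..1} g"
    unfolding g_def by (intro continuous_on_add cLn ch continuous_on_mult continuous_on_of_real
        continuous_on_id continuous_on_const)
  moreover have "exp (g t) = \<psi> (c t)" for t
  proof -
    have ne: "1 - a / c t \<noteq> 0" using Re[of t] by auto
    then have ca: "c t \<noteq> a" using c0[of t] by auto
    have "exp (g t) = of_real \<rho> * exp (2 * of_real pi * \<i> * of_real t) * (1 - a / c t) * exp (h (c t))"
      unfolding g_def exp_add using ne \<rho>0 by (simp add: exp_of_real)
    also have "\<dots> = c t * (1 - a / c t) * q (c t)" using h(2)[OF cD] by (simp add: c_def)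
    also have "\<dots> = \<psi> (c t)" using ca c0[of t] a(2) by (simp add: q_def field_simps)
    finally show ?thesis .
  qed
  moreover have "\<psi> (c t) \<in> F - K" for t
  proof -
    have "f (\<psi> (c t)) \<notin> f ` insert 0 K"
      using \<psi>f[OF cD[of t]] w(2)[of "c t"] nc[of t] \<rho>(1) by auto
    then show ?thesis using \<psi>f[OF cD[of t]] by blast
  qed
  moreover have "c 1 = c 0" using exp_deck[of 1 0] by (simp add: c_def deck_def)
  then have "g 1 = deck 1 (g 0)" by (simp add: g_def deck_def)
  ultimately show ?thesis by (intro exI[of _ g]) (auto simp: path_def)
qed

text \<open>The domain is V with every bounded hole filled except the hole L around 0. It is
  connected since L is a component of the filled domain minus V, and removing a component of the
  complement of a connected subset from a connected set leaves a connected set.\<close>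

lemma
  fixes V L :: "complex set"
  assumes V: "open V" "connected V" "bounded V"
    and L: "L = connected_component_set (- V) 0" "bounded L" "0 \<notin> V"
  shows slit_subset: "V \<subseteq> - (L \<union> outside V)"
    and slit_open: "open (- (L \<union> outside V))"
    and slit_connected: "connected (- (L \<union> outside V))"
    and zero_in_inside: "0 \<in> inside V"
    and slit_connected_closed: "connected L" "closed L" "0 \<in> L"
proof -
  show clL: "closed L" unfolding L(1) using V(1) by (intro closed_connected_component) auto
  show "connected L" "0 \<in> L" unfolding L(1) using L(3) by (auto simp: connected_component_refl)
  show "V \<subseteq> - (L \<union> outside V)"
    using connected_component_subset[of "- V" 0] outside_no_overlap[of V] unfolding L(1) by blast
  show "open (- (L \<union> outside V))" using clL closed_outside[OF V] by auto
  show z: "0 \<in> inside V" using L by (auto simp: inside_def)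
  have sub: "L \<subseteq> inside V"
    using inside_same_component[OF _ z] unfolding L(1) by auto
  have "L = connected_component_set (inside V) 0"
  proof
    show "L \<subseteq> connected_component_set (inside V) 0"
      by (rule connected_component_maximal) (use sub \<open>connected L\<close> \<open>0 \<in> L\<close> in auto)
    show "connected_component_set (inside V) 0 \<subseteq> L"
      unfolding L(1) by (rule connected_component_mono) (use inside_no_overlap[of V] in blast)
  qed
  then have "L \<in> components (inside V)" using z by (auto simp: components_def)
  moreover have "inside V = - outside V - V"
    using inside_Un_outside[of V] inside_Int_outside[of V] inside_no_overlap[of V] outside_no_overlap[of V] by blast
  ultimately have comp: "L \<in> components (- outside V - V)" by metis
  have "V \<subseteq> - outside V" using outside_no_overlap[of V] by blast
  from component_diff_connected[OF V(2) simply_connected_imp_connected[OF simply_connected_filled[OF V]] this comp]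
  have "connected (- outside V - L)" .
  moreover have "- outside V - L = - (L \<union> outside V)" by blast
  ultimately show "connected (- (L \<union> outside V))" by simp
qed

section \<open>Restriction maps that factor through a planar domain\<close>

lemma has_dim_cohomology_image_disc:
  fixes X :: "'a topology" and Y :: "'b topology" and C :: "complex set"
  assumes f: "continuous_map X Y f" and j: "continuous_map X (top_of_set C) j" and k: "continuous_map (top_of_set C) Y k"
    and kj: "\<And>x. x \<in> topspace X \<Longrightarrow> k (j x) = f x"
    and C: "open C" "simply_connected C"
  shows "has_dim class_ring (cohomology_image (Suc p) X Y f :: ('k::field, ('a, 'k) cochain set) module) 0"
proof (rule has_dim_cohomology_image_0[OF f])
  fix \<phi> :: "('b, 'k) cochain" assume "\<phi> \<in> cocycles (Suc p) Y"
  then have "cochain_pullback (Suc p) (top_of_set C) k \<phi> \<in> coboundaries (Suc p) (top_of_set C)"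
    using cochain_pullback_cocycles[OF k] cocycles_subset_coboundaries_simply_connected[OF C] by blast
  then have "cochain_pullback (Suc p) X j (cochain_pullback (Suc p) (top_of_set C) k \<phi>) \<in> coboundaries (Suc p) X"
    by (rule cochain_pullback_coboundaries[OF j])
  also have "cochain_pullback (Suc p) X j (cochain_pullback (Suc p) (top_of_set C) k \<phi>) = cochain_pullback (Suc p) X f \<phi>"
    unfolding cochain_pullback_compose[OF j] using kj by (intro cochain_pullback_cong) auto
  finally show "cochain_pullback (Suc p) X f \<phi> \<in> coboundaries (Suc p) X" .
qed

text \<open>Degrees above 1 vanish already on C. In degree 1, factoring through C shows that the
  image is spanned by the angular class, which i defines on all of Y. The class survives because l
  carries the loop into X: coboundaries vanish on closed paths, whereas the angular class takes the
  value 1.\<close>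

lemma has_dim_cohomology_image_annulus:
  fixes X :: "'a topology" and Y :: "'b topology" and C :: "complex set"
  assumes f: "continuous_map X Y f" and j: "continuous_map X (top_of_set C) j" and k: "continuous_map (top_of_set C) Y k"
    and kj: "\<And>x. x \<in> topspace X \<Longrightarrow> k (j x) = f x"
    and C: "0 \<notin> C" "open C" "path_connected (exp -` C :: complex set)" "simply_connected (exp -` C :: complex set)"
    and i: "continuous_map Y (top_of_set (- {0})) i" "\<And>x. x \<in> topspace X \<Longrightarrow> i (f x) = j x"
    and g: "path g" "g 1 = deck 1 (g 0)" "\<And>t. t \<in> {0..1} \<Longrightarrow> exp (g t) \<in> W"
    and l: "continuous_map (top_of_set W) X l" "\<And>w. w \<in> W \<Longrightarrow> j (l w) = w"
  shows "has_dim class_ring (cohomology_image (Suc p) X Y f :: ('k::field, ('a, 'k) cochain set) module)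
    (if p = 0 then 1 else 0)"
proof -
  have E: "(cocycles (Suc q) (top_of_set (exp -` C)) :: (complex, 'k) cochain set)
        \<subseteq> coboundaries (Suc q) (top_of_set (exp -` C))" for q
    using C by (intro cocycles_subset_coboundaries_simply_connected open_vimage continuous_intros)
  have factor: "cochain_pullback q X f \<phi> = cochain_pullback q X j (cochain_pullback q (top_of_set C) k \<phi>)"
    for q and \<phi> :: "('b, 'k) cochain"
    unfolding cochain_pullback_compose[OF j] using kj by (intro cochain_pullback_cong) auto
  show ?thesis
  proof (cases p)
    case (Suc r)
    have "has_dim class_ring (cohomology_image (Suc (Suc r)) X Y f :: ('k, ('a, 'k) cochain set) module) 0"
    proof (rule has_dim_cohomology_image_0[OF f])
      fix \<phi> :: "('b, 'k) cochain" assume "\<phi> \<in> cocycles (Suc (Suc r)) Y"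
      then have "cochain_pullback (Suc (Suc r)) (top_of_set C) k \<phi> \<in> coboundaries (Suc (Suc r)) (top_of_set C)"
        using cochain_pullback_cocycles[OF k] cocycles_subset_coboundaries_exp[OF C(1) E] by blast
      then show "cochain_pullback (Suc (Suc r)) X f \<phi> \<in> coboundaries (Suc (Suc r)) X"
        unfolding factor by (rule cochain_pullback_coboundaries[OF j])
    qed
    then show ?thesis by (simp add: Suc)
  next
    case 0
    let ?a = "angular_cocycle :: (complex, 'k) cochain"
    let ?\<omega> = "cochain_pullback 1 Y i ?a"
    have C0: "continuous_map (top_of_set C) (top_of_set (- {0})) id" using C(1) by auto
    have \<omega>: "cochain_pullback 1 X f ?\<omega> = cochain_pullback 1 X j (cochain_pullback 1 (top_of_set C) id ?a)"
      unfolding cochain_pullback_compose[OF f] cochain_pullback_compose[OF j]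
      using i(2) by (intro cochain_pullback_cong) auto
    have \<omega>': "cochain_pullback 1 X f ?\<omega> = cochain_pullback 1 X j ?a"
      unfolding cochain_pullback_compose[OF f] using i(2) by (intro cochain_pullback_cong) auto
    have "has_dim class_ring (cohomology_image 1 X Y f :: ('k, ('a, 'k) cochain set) module) 1"
    proof (rule has_dim_cohomology_image_1[OF f])
      show "?\<omega> \<in> cocycles 1 Y" by (rule cochain_pullback_cocycles[OF i(1) angular_cocycle])
      show "cochain_pullback 1 X f ?\<omega> \<notin> coboundaries 1 X"
      proof
        assume "cochain_pullback 1 X f ?\<omega> \<in> coboundaries 1 X"
        then obtain \<eta> where \<eta>: "cochain_pullback 1 X j ?a = coboundary 0 X \<eta>"
          unfolding \<omega>' by (auto simp: coboundaries_def)
        \<comment> \<open>The lift g is not closed, but its exponential is, since deck translates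
          have equal exponentials.\<close>
        let ?h = "\<lambda>t. l (exp (g t))"
        let ?\<sigma> = "restrict (\<lambda>t. ?h (t 1)) (standard_simplex 1)"
        have "continuous_map (top_of_set {0..1}) (top_of_set W) (\<lambda>t. exp (g t))"
          using g(1,3) by (auto simp: path_def intro!: continuous_intros)
        from continuous_map_compose[OF this l(1)] have h: "pathin X ?h" by (simp add: pathin_def o_def)
        have t1: "t 1 \<in> {0..1}" if "t \<in> standard_simplex 1" for t
          using that by (auto simp: standard_simplex_def)
        have "simplex_map 1 j ?\<sigma> = restrict (\<lambda>t. exp (g (t 1))) (standard_simplex 1)"
          using l(2) g(3) t1 by (auto simp: simplex_map_def)
        then have "cochain_pullback 1 X j ?a ?\<sigma> = of_int (sheet (g 1)) - of_int (sheet (g 0))"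
          using singular_simplex_path[OF h] angular_cocycle_loop[OF g(1), where 'k = 'k] by (simp add: cochain_pullback_def)
        also have "\<dots> = 1" by (simp add: g(2))
        finally have "cochain_pullback 1 X j ?a ?\<sigma> = 1" .
        moreover have "coboundary 0 X \<eta> ?\<sigma> = 0"
          unfolding coboundary_path[OF h] by (simp add: g(2))
        ultimately show False unfolding \<eta> by simp
      qed
      fix \<phi> :: "('b, 'k) cochain" assume "\<phi> \<in> cocycles 1 Y"
      then have "cochain_pullback 1 (top_of_set C) k \<phi> \<in> cocycles 1 (top_of_set C)"
        by (rule cochain_pullback_cocycles[OF k])
      from cocycle_1_exp[OF C(1,3) _ this] E[of 0] obtain c
        where "(\<lambda>\<sigma>. cochain_pullback 1 (top_of_set C) k \<phi> \<sigma> - c * cochain_pullback 1 (top_of_set C) id ?a \<sigma>) \<in> coboundaries 1 (top_of_set C)"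
        by auto
      from cochain_pullback_coboundaries[OF j this]
      show "\<exists>c. (\<lambda>\<sigma>. cochain_pullback 1 X f \<phi> \<sigma> - c * cochain_pullback 1 X f ?\<omega> \<sigma>) \<in> coboundaries 1 X"
        by (intro exI[of _ c]) (simp only: \<omega> factor[of 1 \<phi>] cochain_pullback_diff)
    qed
    then show ?thesis by (simp add: 0)
  qed
qed

section \<open>Domains between sublevel sets of a function on the plane\<close>

lemma level_domain:
  fixes U :: "complex \<Rightarrow> real"
  assumes U: "continuous_on UNIV U" and b: "bounded {z. U z < s}" and m: "U m < t"
    and conn: "\<And>z z'. U z < t \<Longrightarrow> U z' < t \<Longrightarrow> connected_component {z. U z < s} z z'"
  obtains V where "open V" "connected V" "bounded V" "{z. U z < t} \<subseteq> V" "V \<subseteq> {z. U z < s}"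
proof
  \<comment> \<open>The sublevel set of s may have further components; the one through m contains
    the whole sublevel set of t.\<close>
  let ?V = "connected_component_set {z. U z < s} m"
  have "open {z. U z < s}" using U by (intro open_Collect_less continuous_intros)
  then show "open ?V" by (rule open_connected_component)
  show "connected ?V" by simp
  show V: "?V \<subseteq> {z. U z < s}" by (rule connected_component_subset)
  then show "bounded ?V" using b bounded_subset by blast
  show "{z. U z < t} \<subseteq> ?V" using conn[OF m] by auto
qed

text \<open>In use t < s < t'. The component of 0 in the complement of V stays in U \<ge> t, where W
  has no zero, so W < 0 on it by connectedness, and this bounds it. Points with U \<ge> t' are
  joined to 0, or lie in an unbounded connected set, within U \<ge> s, hence off V.\<close>

lemma level_domain_separating:
  fixes U W :: "complex \<Rightarrow> real"
  assumes U: "continuous_on UNIV U" and W: "continuous_on UNIV W" and b: "bounded {z. U z < s}" and m: "U m < t"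
    and conn: "\<And>z z'. U z < t \<Longrightarrow> U z' < t \<Longrightarrow> connected_component {z. U z < s} z z'"
    and left: "\<And>z. U z \<ge> t' \<Longrightarrow> W z < 0 \<Longrightarrow> connected_component {z. U z \<ge> s} 0 z"
    and right: "\<And>z. U z \<ge> t' \<Longrightarrow> W z > 0 \<Longrightarrow> \<not> bounded (connected_component_set {z. U z \<ge> s} z)"
    and W0: "\<And>z. U z \<ge> t \<Longrightarrow> W z \<noteq> 0" and bW: "bounded {z. U z \<ge> t \<and> W z \<le> 0}"
    and z: "U 0 \<ge> s" "W 0 < 0"
  obtains V where "open V" "connected V" "bounded V" "{z. U z < t} \<subseteq> V" "V \<subseteq> {z. U z < s}" "0 \<notin> V"
    "bounded (connected_component_set (- V) 0)"
    "\<And>z. U z \<ge> t' \<Longrightarrow> W z < 0 \<Longrightarrow> z \<in> connected_component_set (- V) 0"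
    "\<And>z. U z \<ge> t' \<Longrightarrow> W z > 0 \<Longrightarrow> z \<in> outside V"
proof -
  obtain V where V: "open V" "connected V" "bounded V" "{z. U z < t} \<subseteq> V" "V \<subseteq> {z. U z < s}"
    using level_domain[of U s m t] U b m conn by blast
  have sV: "{z. U z \<ge> s} \<subseteq> - V" using V(5) by auto
  let ?L = "connected_component_set (- V) 0"
  have 0: "0 \<notin> V" using V(5) z by auto
  have L0: "0 \<in> ?L" using 0 by (simp add: connected_component_refl)
  have L: "?L \<subseteq> {z. U z \<ge> t}" using connected_component_subset[of "- V" 0] V(4) by (auto simp: not_less[symmetric])
  have "?L \<subseteq> {z. W z < 0}"
  proof (rule connected_clopen_subset[of _ _ "{z. W z \<le> 0}"])
    show "open {z. W z < 0}" "closed {z. W z \<le> 0}"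
      using W by (auto intro!: open_Collect_less closed_Collect_le continuous_intros)
    show "?L \<inter> {z. W z < 0} = ?L \<inter> {z. W z \<le> 0}" using L W0 by force
    show "?L \<inter> {z. W z < 0} \<noteq> {}" using L0 z(2) by blast
  qed simp
  then have "bounded ?L" using L bounded_subset[OF bW] by (smt (verit) mem_Collect_eq subset_iff)
  moreover have "z \<in> ?L" if "U z \<ge> t'" "W z < 0" for z
    using left[OF that] connected_component_of_subset[OF _ sV] by auto
  moreover have "z \<in> outside V" if "U z \<ge> t'" "W z > 0" for z
    using right[OF that] bounded_subset[OF _ connected_component_mono[OF sV]] by (auto simp: outside)
  ultimately show thesis using that V 0 by blast
qed

text \<open>C must contain U < \<open>e\<^sub>1\<close>, whereas the loop must lie in it, so two
  domains are built: \<open>V'\<close> at the levels \<open>e\<^sub>1 - 2 * \<eta>\<close>,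
  \<open>e\<^sub>1 - \<eta>\<close>, \<open>e\<^sub>1\<close> for the loop, and \<open>V\<close> at
  the levels \<open>e\<^sub>1\<close>, \<open>e\<^sub>1 + \<eta>\<close>,
  \<open>e\<^sub>1 + 2 * \<eta>\<close> for C.\<close>

lemma annulus_between:
  fixes U W :: "complex \<Rightarrow> real"
  assumes U: "continuous_on UNIV U" and W: "continuous_on UNIV W" and \<eta>: "0 < \<eta>" "e\<^sub>1 + 2 * \<eta> \<le> e\<^sub>2"
    and m: "U m < e\<^sub>1 - 2 * \<eta>" and z: "U 0 \<ge> e\<^sub>2" "W 0 < 0"
    and conn: "\<And>s z z'. s = e\<^sub>1 - \<eta> \<or> s = e\<^sub>1 + \<eta> \<Longrightarrow> U z < s - \<eta> \<Longrightarrow> U z' < s - \<eta> \<Longrightarrow>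
      connected_component {z. U z < s} z z'"
    and left: "\<And>s z. s = e\<^sub>1 - \<eta> \<or> s = e\<^sub>1 + \<eta> \<Longrightarrow> U z \<ge> s + \<eta> \<Longrightarrow> W z < 0 \<Longrightarrow>
      connected_component {z. U z \<ge> s} 0 z"
    and right: "\<And>s z. s = e\<^sub>1 - \<eta> \<or> s = e\<^sub>1 + \<eta> \<Longrightarrow> U z \<ge> s + \<eta> \<Longrightarrow> W z > 0 \<Longrightarrow>
      \<not> bounded (connected_component_set {z. U z \<ge> s} z)"
    and W0: "\<And>z. U z \<ge> e\<^sub>1 - 2 * \<eta> \<Longrightarrow> W z \<noteq> 0" and bW: "bounded {z. U z \<ge> e\<^sub>1 - 2 * \<eta> \<and> W z \<le> 0}"
    and b: "bounded {z. U z < e\<^sub>1 + \<eta>}"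
  obtains C g where "{z. U z < e\<^sub>1} \<subseteq> C" "C \<subseteq> {z. U z < e\<^sub>2}" "open C" "0 \<notin> C"
    "path_connected (exp -` C :: complex set)" "simply_connected (exp -` C :: complex set)"
    "path g" "g 1 = deck 1 (g 0)" "\<And>t. U (exp (g t)) < e\<^sub>1"
proof -
  note left' = left[of "e\<^sub>1 - \<eta>"] left[of "e\<^sub>1 + \<eta>"] and right' = right[of "e\<^sub>1 - \<eta>"] right[of "e\<^sub>1 + \<eta>"]
    and conn' = conn[of "e\<^sub>1 - \<eta>"] conn[of "e\<^sub>1 + \<eta>"]
  have bs: "bounded {z. U z < s}" if "s \<le> e\<^sub>1 + \<eta>" for s
    using that by (intro bounded_subset[OF b]) auto
  have bWs: "bounded {z. U z \<ge> s \<and> W z \<le> 0}" if "s \<ge> e\<^sub>1 - 2 * \<eta>" for s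
    using that by (intro bounded_subset[OF bW]) auto
  obtain V' where V': "open V'" "connected V'" "bounded V'" "{z. U z < e\<^sub>1 - 2 * \<eta>} \<subseteq> V'" "V' \<subseteq> {z. U z < e\<^sub>1 - \<eta>}" "0 \<notin> V'"
    "bounded (connected_component_set (- V') 0)"
    "\<And>z. U z \<ge> e\<^sub>1 \<Longrightarrow> W z < 0 \<Longrightarrow> z \<in> connected_component_set (- V') 0"
    "\<And>z. U z \<ge> e\<^sub>1 \<Longrightarrow> W z > 0 \<Longrightarrow> z \<in> outside V'"
    by (rule level_domain_separating[of U W "e\<^sub>1 - \<eta>" m "e\<^sub>1 - 2 * \<eta>" e\<^sub>1])
       (use U W \<eta> m z left'(1) right'(1) conn'(1) W0 bW bs[of "e\<^sub>1 - \<eta>"] in auto)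
  let ?F = "- outside V'"
  let ?K = "{z. U z \<ge> e\<^sub>1 \<and> W z \<le> 0}"
  have in0: "0 \<in> inside V'" by (rule zero_in_inside[OF V'(1-3) refl V'(7,6)])
  have "closed ?K"
    using U W by (intro closed_Collect_conj closed_Collect_le continuous_intros)
  then have K: "compact ?K" using bWs[of e\<^sub>1] \<eta> by (auto simp: compact_eq_bounded_closed)
  have W0': "W z \<noteq> 0" if "U z \<ge> e\<^sub>1" for z using W0[of z] that \<eta> by auto
  have KF: "?K \<subseteq> ?F"
  proof
    fix z assume "z \<in> ?K"
    then have "U z \<ge> e\<^sub>1" "W z < 0" using W0'[of z] by auto
    from V'(8)[OF this] have "z \<in> inside V'" using inside_same_component[OF _ in0] by simp
    then show "z \<in> ?F" using inside_Int_outside[of V'] by blast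
  qed
  obtain g where g: "path g" "g 1 = deck 1 (g 0)" "\<And>t. exp (g t) \<in> ?F - ?K"
    using winding_loop_exists[OF _ simply_connected_filled[OF V'(1-3)] bounded_filled[OF V'(1-3)] _ K KF]
      closed_outside[OF V'(1-3)] in0 inside_Int_outside[of V'] by blast
  \<comment> \<open>A point of \<open>?F\<close> with U \<ge> \<open>e\<^sub>1\<close> has W \<le>
    0, since W > 0 would place it in the outside of \<open>V'\<close>. It is then in
    \<open>?K\<close>, which the loop avoids.\<close>
  have gU: "U (exp (g t)) < e\<^sub>1" for t
    using g(3)[of t] V'(9)[of "exp (g t)"] by force
  obtain V where V: "open V" "connected V" "bounded V" "{z. U z < e\<^sub>1} \<subseteq> V" "V \<subseteq> {z. U z < e\<^sub>1 + \<eta>}" "0 \<notin> V"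
    "bounded (connected_component_set (- V) 0)"
    "\<And>z. U z \<ge> e\<^sub>1 + 2 * \<eta> \<Longrightarrow> W z < 0 \<Longrightarrow> z \<in> connected_component_set (- V) 0"
    "\<And>z. U z \<ge> e\<^sub>1 + 2 * \<eta> \<Longrightarrow> W z > 0 \<Longrightarrow> z \<in> outside V"
    by (rule level_domain_separating[of U W "e\<^sub>1 + \<eta>" m e\<^sub>1 "e\<^sub>1 + 2 * \<eta>"])
       (use U W \<eta> m z left'(2) right'(2) conn'(2) W0' bWs[of e\<^sub>1] b in auto)
  define L where "L = connected_component_set (- V) 0"
  let ?C = "- (L \<union> outside V)"
  note slit = slit_subset slit_open slit_connected zero_in_inside slit_connected_closed
  note slit = slit[OF V(1-3) L_def V(7)[folded L_def] V(6)]
  have sub1: "{z. U z < e\<^sub>1} \<subseteq> ?C" using V(4) slit(1) by blast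
  have sub2: "?C \<subseteq> {z. U z < e\<^sub>2}"
  proof
    fix z assume z: "z \<in> ?C"
    show "z \<in> {z. U z < e\<^sub>2}"
    proof (rule ccontr)
      assume "z \<notin> {z. U z < e\<^sub>2}"
      then have "U z \<ge> e\<^sub>1 + 2 * \<eta>" using \<eta> by auto
      moreover from this have "W z < 0 \<or> W z > 0" using W0'[of z] \<eta> by linarith
      ultimately show False using z V(8,9)[of z] by (auto simp: L_def)
    qed
  qed
  have pc: "path_connected (exp -` ?C :: complex set)"
  proof (rule path_connected_exp_vimage[OF _ _ g(1) _ g(2)])
    show "path_connected ?C" by (rule connected_open_path_connected[OF slit(2,3)])
    show "0 \<notin> ?C" using slit(7) by blast
    show "exp (g t) \<in> ?C" for t using gU[of t] sub1 by blast
  qed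
  have "simply_connected (exp -` ?C :: complex set)"
    using slit closed_outside[OF V(1-3)] unbounded_connected_outside[OF V(1-3)] path_connected_imp_connected[OF pc]
    by (intro simply_connected_exp_vimage)
  with sub1 sub2 slit pc g gU show thesis by (intro that[of ?C g]) auto
qed

text \<open>C is a domain with its holes filled. A point with U \<ge> \<open>e\<^sub>2\<close> lies
  in an unbounded connected part of the complement of V, so the filling does not add it.\<close>

lemma disc_between:
  fixes U :: "complex \<Rightarrow> real"
  assumes U: "continuous_on UNIV U" and b: "bounded {z. U z < s}" and m: "U m < e\<^sub>1"
    and conn: "\<And>z z'. U z < e\<^sub>1 \<Longrightarrow> U z' < e\<^sub>1 \<Longrightarrow> connected_component {z. U z < s} z z'"
    and ub: "\<And>z. U z \<ge> e\<^sub>2 \<Longrightarrow> \<not> bounded (connected_component_set {z. U z \<ge> s} z)"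
  obtains C where "{z. U z < e\<^sub>1} \<subseteq> C" "C \<subseteq> {z. U z < e\<^sub>2}" "open C" "simply_connected C"
proof -
  obtain V where V: "open V" "connected V" "bounded V" "{z. U z < e\<^sub>1} \<subseteq> V" "V \<subseteq> {z. U z < s}"
    using level_domain[of U s m e\<^sub>1] U b m conn by blast
  have sV: "{z. U z \<ge> s} \<subseteq> - V" using V(5) by auto
  have "z \<in> outside V" if "U z \<ge> e\<^sub>2" for z
    using ub[OF that] bounded_subset[OF _ connected_component_mono[OF sV]] by (auto simp: outside)
  then have "- outside V \<subseteq> {z. U z < e\<^sub>2}" using not_less by blast
  moreover have "{z. U z < e\<^sub>1} \<subseteq> - outside V" using V(4) outside_no_overlap[of V] by blast
  ultimately show thesis
    using that simply_connected_filled[OF V(1-3)] closed_outside[OF V(1-3)] by blast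
qed

section \<open>Subsets of the sphere\<close>

text \<open>\<open>nsphere 2\<close> lives in an infinite product; the Euclidean model is the one
  from which \<open>punctured_sphere_homeomorphic_plane\<close> removes a point.\<close>

lemma nsphere_2_homeomorphic: "nsphere 2 homeomorphic_space top_of_set (sphere (0 :: complex \<times> real) 1)"
proof -
  define f where "f x = (Complex (x 0) (x 1), x 2)" for x :: "nat \<Rightarrow> real"
  define g where "g z i = (if i = 0 then Re (fst z) else if i = 1 then Im (fst z) else if i = 2 then snd z else 0)"
    for z :: "complex \<times> real" and i :: nat
  have *: "nsphere 2 = top_of_set {x. (x 0)\<^sup>2 + (x 1)\<^sup>2 + (x 2)\<^sup>2 = 1 \<and> (\<forall>i>2. x i = 0)}"
    unfolding nsphere euclidean_product_topology by (simp add: numeral_2_eq_2)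
  have "homeomorphism {x. (x 0)\<^sup>2 + (x 1)\<^sup>2 + (x 2)\<^sup>2 = 1 \<and> (\<forall>i>2. x i = 0)} (sphere 0 1) f g"
  proof (rule homeomorphismI)
    show "continuous_on {x. (x 0)\<^sup>2 + (x 1)\<^sup>2 + (x 2)\<^sup>2 = 1 \<and> (\<forall>i>2. x i = 0)} f"
      unfolding f_def by (intro continuous_intros continuous_on_subset[OF continuous_on_product_coordinates]) auto
    show "continuous_on (sphere 0 1) g"
    proof (rule continuous_on_coordinatewise_then_product)
      show "continuous_on (sphere 0 1) (\<lambda>z. g z i)" for i
        unfolding g_def by (cases "i = 0"; cases "i = 1"; cases "i = 2") (auto intro!: continuous_intros)
    qed
    show "f ` {x. (x 0)\<^sup>2 + (x 1)\<^sup>2 + (x 2)\<^sup>2 = 1 \<and> (\<forall>i>2. x i = 0)} \<subseteq> sphere 0 1"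
      by (auto simp: f_def norm_Pair cmod_def)
    show "g ` sphere 0 1 \<subseteq> {x. (x 0)\<^sup>2 + (x 1)\<^sup>2 + (x 2)\<^sup>2 = 1 \<and> (\<forall>i>2. x i = 0)}"
      by (auto simp: g_def norm_Pair cmod_power2)
    show "g (f x) = x" if "x \<in> {x. (x 0)\<^sup>2 + (x 1)\<^sup>2 + (x 2)\<^sup>2 = 1 \<and> (\<forall>i>2. x i = 0)}" for x
    proof
      fix i :: nat
      consider "i = 0" | "i = 1" | "i = 2" | "i > 2" by linarith
      then show "g (f x) i = x i" using that by cases (auto simp: f_def g_def)
    qed
    show "f (g z) = z" for z by (simp add: f_def g_def prod_eq_iff)
  qed
  then show ?thesis unfolding * by (auto simp: homeomorphic_def)
qed

lemma punctured_sphere_homeomorphic_plane: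
  assumes b: "b \<in> sphere (0 :: complex \<times> real) 1"
  shows "(sphere 0 1 - {b}) homeomorphic (UNIV :: complex set)"
proof -
  let ?H = "{x :: complex \<times> real. (0, 1) \<bullet> x = 0}"
  have "(sphere 0 1 - {b}) homeomorphic ?H"
    using b by (intro homeomorphic_punctured_sphere_hyperplane) (auto simp: zero_prod_def)
  also have "?H homeomorphic (UNIV :: complex set)"
    unfolding homeomorphic_def
    by (intro exI[of _ fst] exI[of _ "\<lambda>z. (z, 0)"] homeomorphismI)
       (auto intro!: continuous_intros)
  finally show ?thesis .
qed

lemma
  assumes X: "X homeomorphic_space nsphere 2"
  shows sphere_compact_space: "compact_space X" and sphere_Hausdorff_space: "Hausdorff_space X"
proof -
  have *: "X homeomorphic_space top_of_set (sphere (0 :: complex \<times> real) 1)"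
    using X nsphere_2_homeomorphic by (rule homeomorphic_space_trans)
  show "compact_space X"
    using homeomorphic_compact_space[OF *] by (simp add: compact_space_subtopology)
  show "Hausdorff_space X"
    unfolding homeomorphic_Hausdorff_space[OF *]
    by (intro Hausdorff_space_subtopology Hausdorff_space_euclidean)
qed

section \<open>The sphere minus a point as a planar chart\<close>

lemma pathin_topspace: "pathin X \<gamma> \<Longrightarrow> t \<in> {0..1} \<Longrightarrow> \<gamma> t \<in> topspace X"
  by (auto simp: pathin_def continuous_map_def)

text \<open>In the chart p is the point at infinity. The map j is total, but its value at p carries
  no information, so p is excluded throughout.\<close>

locale punctured_sphere_chart =
  fixes X :: "'a topology" and p :: 'a and j :: "'a \<Rightarrow> complex" and k :: "complex \<Rightarrow> 'a"
  assumes compact: "compact_space X" and Hausdorff: "Hausdorff_space X" and p_in: "p \<in> topspace X"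
    and chart: "homeomorphic_maps (subtopology X (topspace X - {p})) euclidean j k"
begin

lemma continuous_j: "continuous_map (subtopology X (topspace X - {p})) euclidean j"
  and continuous_k: "continuous_map euclidean X k"
  and kj: "\<And>x. x \<in> topspace X \<Longrightarrow> x \<noteq> p \<Longrightarrow> k (j x) = x"
  and jk: "\<And>z. j (k z) = z"
  and k_in: "\<And>z. k z \<in> topspace X" and k_neq: "\<And>z. k z \<noteq> p"
  using chart by (auto simp: homeomorphic_maps_def continuous_map_in_subtopology Pi_iff)

text \<open>A closed subset of X that avoids p is compact in the punctured space, hence stays away
  from infinity in the chart.\<close>

lemma bounded_image:
  assumes K: "closedin X K" "p \<notin> K"
  shows "bounded (j ` K)"
proof -
  have "compactin (subtopology X (topspace X - {p})) K"
    using closedin_compact_space[OF compact K(1)] closedin_subset[OF K(1)] K(2)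
    by (auto simp: compactin_subtopology)
  then have "compactin euclidean (j ` K)" using continuous_j by (rule image_compactin)
  then show ?thesis by (simp add: compact_imp_bounded)
qed

text \<open>The end time a is variable because \<open>unbounded_component_path\<close> applies this
  to initial pieces of a path that finally reaches p.\<close>

lemma connected_component_path:
  assumes \<gamma>: "pathin X \<gamma>" and a: "a \<in> {0..1}"
    and t: "\<And>t. t \<in> {0..a} \<Longrightarrow> \<gamma> t \<noteq> p" "\<And>t. t \<in> {0..a} \<Longrightarrow> P (\<gamma> t)"
  shows "connected_component {z. P (k z)} (j (\<gamma> 0)) (j (\<gamma> a))"
proof -
  have in_X: "\<gamma> t \<in> topspace X" if "t \<in> {0..1}" for t
    using \<gamma> that by (rule pathin_topspace)
  have "continuous_map (top_of_set {0..a}) X \<gamma>"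
    using \<gamma> a unfolding pathin_def by (auto elim: continuous_map_from_subtopology_mono)
  then have "continuous_map (top_of_set {0..a}) (subtopology X (topspace X - {p})) \<gamma>"
    using t(1) in_X a by (auto simp: continuous_map_in_subtopology)
  from continuous_map_compose[OF this continuous_j] have "continuous_on {0..a} (j \<circ> \<gamma>)" by simp
  then have "connected ((j \<circ> \<gamma>) ` {0..a})" by (intro connected_continuous_image) auto
  moreover have "(j \<circ> \<gamma>) ` {0..a} \<subseteq> {z. P (k z)}" using t in_X a kj by auto
  ultimately show ?thesis
    using a unfolding connected_component_def by (intro exI[of _ "(j \<circ> \<gamma>) ` {0..a}"]) auto
qed

text \<open>If the component were bounded, k would map its closure onto a compact, hence closed,
  subset of X that misses p. The path stays in this subset until it first reaches p, and closedness
  would put p in it too.\<close>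

lemma unbounded_component_path:
  assumes \<gamma>: "pathin X \<gamma>" "\<gamma> 0 \<noteq> p" "\<gamma> 1 = p" and t: "\<And>t. t \<in> {0..1} \<Longrightarrow> P (\<gamma> t)"
  shows "\<not> bounded (connected_component_set {z. P (k z)} (j (\<gamma> 0)))"
proof
  let ?Q = "connected_component_set {z. P (k z)} (j (\<gamma> 0))"
  assume "bounded ?Q"
  then have "compact (closure ?Q)" by (simp add: compact_closure)
  then have "compactin euclidean (closure ?Q)" by simp
  then have "closedin X (k ` closure ?Q)"
    by (intro compactin_imp_closedin[OF Hausdorff] image_compactin[OF _ continuous_k])
  then have "closedin (top_of_set {0..1}) {t \<in> topspace (top_of_set {0..1}). \<gamma> t \<in> k ` closure ?Q}"
    using \<gamma>(1) unfolding pathin_def by (rule closedin_continuous_map_preimage[rotated])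
  then have cl: "closed {t \<in> {0..1}. \<gamma> t \<in> k ` closure ?Q}"
    by (auto intro: closedin_closed_trans)
  have "closedin X {p}" using Hausdorff p_in by (simp add: closedin_Hausdorff_singleton)
  then have "closedin (top_of_set {0..1}) {t \<in> topspace (top_of_set {0..1}). \<gamma> t \<in> {p}}"
    using \<gamma>(1) unfolding pathin_def by (rule closedin_continuous_map_preimage[rotated])
  then have clp: "closed {t \<in> {0..1}. \<gamma> t = p}"
    by (auto intro: closedin_closed_trans)
  \<comment> \<open>The first time at which the path reaches p; before it the path can be followed
    in the chart.\<close>
  define a where "a = Inf {t \<in> {0..1}. \<gamma> t = p}"
  have bb: "bdd_below {t \<in> {0..1}. \<gamma> t = p}" by (intro bdd_belowI[of _ 0]) auto
  have ne: "{t \<in> {0..1}. \<gamma> t = p} \<noteq> {}" using \<gamma>(3) by (auto intro!: exI[of _ 1])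
  have a: "a \<in> {0..1}" "\<gamma> a = p" using closed_contains_Inf[OF ne bb clp] by (auto simp: a_def)
  have before: "\<gamma> t \<noteq> p" if "t \<in> {0..<a}" for t
  proof
    assume "\<gamma> t = p"
    then have "t \<in> {t \<in> {0..1}. \<gamma> t = p}" using that a(1) by auto
    from cInf_lower[OF this bb] show False using that by (simp add: a_def)
  qed
  have "a \<noteq> 0" using a(2) \<gamma>(2) by auto
  then have a0: "0 < a" using a(1) by auto
  have "{0..<a} \<subseteq> {t \<in> {0..1}. \<gamma> t \<in> k ` closure ?Q}"
  proof
    fix s assume s: "s \<in> {0..<a}"
    then have "connected_component {z. P (k z)} (j (\<gamma> 0)) (j (\<gamma> s))"
      using a(1) before t by (intro connected_component_path[OF \<gamma>(1)]) auto
    then have "j (\<gamma> s) \<in> closure ?Q" using closure_subset[of ?Q] by auto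
    moreover have "\<gamma> s = k (j (\<gamma> s))"
      using \<gamma>(1) before[OF s] a(1) s by (intro kj[symmetric]) (auto simp: pathin_def continuous_map_def Pi_iff)
    ultimately show "s \<in> {t \<in> {0..1}. \<gamma> t \<in> k ` closure ?Q}" using s a(1) by auto
  qed
  then have "closure {0..<a} \<subseteq> {t \<in> {0..1}. \<gamma> t \<in> k ` closure ?Q}"
    using cl by (rule closure_minimal)
  moreover have "a \<in> closure {0..<a}" using a0 by (simp add: closure_atLeastLessThan)
  ultimately have "\<gamma> a \<in> k ` closure ?Q" by blast
  then show False using a(2) k_neq by (metis imageE)
qed

lemma continuous_on_chart:
  assumes "continuous_map X euclideanreal u"
  shows "continuous_on UNIV (\<lambda>z. u (k z))"
  using continuous_map_compose[OF continuous_k assms] by (simp add: o_def)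

lemma bounded_chart:
  assumes "closedin X K" "p \<notin> K" "\<And>z. z \<in> A \<Longrightarrow> k z \<in> K"
  shows "bounded A"
proof (rule bounded_subset[OF bounded_image[OF assms(1,2)]])
  show "A \<subseteq> j ` K"
  proof
    fix z assume "z \<in> A"
    then show "z \<in> j ` K" using assms(3) jk[of z] by (metis image_eqI)
  qed
qed

lemma continuous_chart_subtopology:
  assumes "A \<subseteq> topspace X" "p \<notin> A" "j ` A \<subseteq> C"
  shows "continuous_map (subtopology X A) (top_of_set C) j"
proof -
  have "continuous_map (subtopology X A) euclidean j"
    using continuous_j by (rule continuous_map_from_subtopology_mono) (use assms in auto)
  then show ?thesis using assms(1,3) by (auto simp: continuous_map_in_subtopology)
qed

lemma continuous_chart_inverse_subtopology:
  assumes "\<And>z. z \<in> C \<Longrightarrow> k z \<in> A"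
  shows "continuous_map (top_of_set C) (subtopology X A) k"
  using assms continuous_k by (auto simp: continuous_map_in_subtopology continuous_map_from_subtopology)

end

lemma punctured_sphere_chart_exists:
  assumes X: "X homeomorphic_space nsphere 2" and p: "p \<in> topspace X"
  obtains j k where "punctured_sphere_chart X p j k" "j q = 0"
proof -
  let ?S = "sphere (0 :: complex \<times> real) 1"
  have "X homeomorphic_space top_of_set ?S"
    using X nsphere_2_homeomorphic by (rule homeomorphic_space_trans)
  then obtain f g where fg: "homeomorphic_maps X (top_of_set ?S) f g"
    unfolding homeomorphic_space_def by blast
  then have f: "f x \<in> ?S" "g (f x) = x" if "x \<in> topspace X" for x
    using that by (auto simp: homeomorphic_maps_def continuous_map_def)
  have g: "g y \<in> topspace X" "f (g y) = y" if "y \<in> ?S" for y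
    using that fg by (auto simp: homeomorphic_maps_def continuous_map_def)
  have "homeomorphic_maps (subtopology X (topspace X - {p})) (subtopology (top_of_set ?S) (?S - {f p})) f g"
  proof (rule homeomorphic_maps_subtopologies_alt[OF fg])
    show "f ` (topspace X \<inter> (topspace X - {p})) \<subseteq> ?S - {f p}" using f p by (auto simp del: mem_sphere_0) (metis f(2))
    show "g ` (topspace (top_of_set ?S) \<inter> (?S - {f p})) \<subseteq> topspace X - {p}"
      using g by (auto simp del: mem_sphere_0)
  qed
  then have "subtopology X (topspace X - {p}) homeomorphic_space top_of_set (?S - {f p})"
    by (auto simp: homeomorphic_space_def subtopology_subtopology Int_absorb1)
  also have "\<dots> homeomorphic_space top_of_set (UNIV :: complex set)"
    using punctured_sphere_homeomorphic_plane[OF f(1)[OF p]]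
    by (simp only: homeomorphic_space_iff_homeomorphic)
  finally obtain j k where jk: "homeomorphic_maps (subtopology X (topspace X - {p})) (euclidean :: complex topology) j k"
    by (auto simp: homeomorphic_space_def)
  \<comment> \<open>Recentring puts q at the origin, the value omitted by
    \<open>exp\<close>.\<close>
  have "homeomorphic_maps euclidean (euclidean :: complex topology) (\<lambda>z. z - j q) (\<lambda>z. z + j q)"
    by (auto simp: homeomorphic_maps_def intro!: continuous_intros)
  from homeomorphic_maps_compose[OF conjI[OF jk this]]
  have "homeomorphic_maps (subtopology X (topspace X - {p})) euclidean ((\<lambda>z. z - j q) \<circ> j) (k \<circ> (\<lambda>z. z + j q))" .
  then have "punctured_sphere_chart X p ((\<lambda>z. z - j q) \<circ> j) (k \<circ> (\<lambda>z. z + j q))"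
    using sphere_compact_space[OF X] sphere_Hausdorff_space[OF X] p by unfold_locales
  then show thesis by (rule that) simp
qed

text \<open>The point p on the side w > 0 is sent to infinity and q on the side w < 0 to 0. Paths
  supplied by \<open>far\<close> then show that far points of the first side lie in unbounded
  components and that those of the second side are joined to 0, as \<open>annulus_between\<close>
  demands. Degree 0 needs only \<open>near\<close>.\<close>

lemma sphere_cohomology_image_annulus:
  fixes X :: "'a topology" and u w :: "'a \<Rightarrow> real"
  assumes X: "X homeomorphic_space nsphere 2"
    and u: "continuous_map X euclideanreal u" and w: "continuous_map X euclideanreal w"
    and \<eta>: "0 < \<eta>" "e\<^sub>1 + 2 * \<eta> \<le> e\<^sub>2"
    and p: "p \<in> topspace X" "u p \<ge> e\<^sub>2" "w p > 0" and q: "q \<in> topspace X" "u q \<ge> e\<^sub>2" "w q < 0"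
    and m: "m \<in> topspace X" "u m < e\<^sub>1 - 2 * \<eta>"
    and near: "\<And>s y y'. y \<in> topspace X \<Longrightarrow> y' \<in> topspace X \<Longrightarrow> u y < s - \<eta> \<Longrightarrow> u y' < s - \<eta> \<Longrightarrow>
      \<exists>\<gamma>. pathin X \<gamma> \<and> \<gamma> 0 = y \<and> \<gamma> 1 = y' \<and> (\<forall>t\<in>{0..1}. u (\<gamma> t) < s)"
    and far: "\<And>s y y'. e\<^sub>1 - \<eta> \<le> s \<Longrightarrow> y \<in> topspace X \<Longrightarrow> y' \<in> topspace X \<Longrightarrow>
      s + \<eta> \<le> u y \<Longrightarrow> s + \<eta> \<le> u y' \<Longrightarrow> 0 < w y * w y' \<Longrightarrow>
      \<exists>\<gamma>. pathin X \<gamma> \<and> \<gamma> 0 = y \<and> \<gamma> 1 = y' \<and> (\<forall>t\<in>{0..1}. s \<le> u (\<gamma> t) \<and> 0 < w (\<gamma> t) * w y)"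
    and w0: "\<And>y. y \<in> topspace X \<Longrightarrow> e\<^sub>1 - 2 * \<eta> \<le> u y \<Longrightarrow> w y \<noteq> 0"
  shows "has_dim class_ring
    (cohomology_image a (subtopology X {y \<in> topspace X. u y < e\<^sub>1}) (subtopology X {y \<in> topspace X. u y < e\<^sub>2}) id
       :: ('k::field, ('a, 'k) cochain set) module)
    (if a = 0 \<or> a = 1 then 1 else 0)"
proof -
  let ?A = "{y \<in> topspace X. u y < e\<^sub>1}" and ?B = "{y \<in> topspace X. u y < e\<^sub>2}"
  have id: "continuous_map (subtopology X ?A) (subtopology X ?B) id"
    using \<eta> by (auto simp: continuous_map_in_subtopology intro: continuous_map_from_subtopology)
  show ?thesis
  proof (cases a)
    case 0
    have "has_dim class_ring (cohomology_image 0 (subtopology X ?A) (subtopology X ?B) id :: ('k, ('a, 'k) cochain set) module) 1"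
    proof (rule has_dim_cohomology_image_path_connected[OF id])
      show "topspace (subtopology X ?A) \<noteq> {}" using m \<eta> by force
      fix y y' assume "y \<in> topspace (subtopology X ?A)" "y' \<in> topspace (subtopology X ?A)"
      then obtain \<gamma> where \<gamma>: "pathin X \<gamma>" "\<gamma> 0 = y" "\<gamma> 1 = y'" "\<forall>t\<in>{0..1}. u (\<gamma> t) < e\<^sub>1 + \<eta>"
        using near[of y y' "e\<^sub>1 + \<eta>"] by auto
      have "\<gamma> t \<in> ?B" if "t \<in> {0..1}" for t
        using \<gamma>(4) pathin_topspace[OF \<gamma>(1) that] that \<eta> by fastforce
      then show "\<exists>g. pathin (subtopology X ?B) g \<and> g 0 = id y \<and> g 1 = id y'"
        using \<gamma> by (intro exI[of _ \<gamma>]) (simp add: pathin_subtopology)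
    qed
    then show ?thesis by (simp add: 0)
  next
    case (Suc b)
    obtain j k where jk0: "punctured_sphere_chart X p j k" "j q = 0"
      using punctured_sphere_chart_exists[OF X p(1)] by blast
    interpret punctured_sphere_chart X p j k by (rule jk0(1))
    have qp: "q \<noteq> p" using p(3) q(3) by (metis less_asym)
    have k0: "k 0 = q" using kj[OF q(1) qp] jk0(2) by simp
    have "u m < u p" using m(2) p(2) \<eta> by linarith
    then have mp: "m \<noteq> p" by blast
    let ?U = "\<lambda>z. u (k z)" and ?W = "\<lambda>z. w (k z)"
    have near': "connected_component {z. ?U z < s} z z'"
      if s: "s = e\<^sub>1 - \<eta> \<or> s = e\<^sub>1 + \<eta>" and z: "?U z < s - \<eta>" "?U z' < s - \<eta>" for s z z'
    proof -
      obtain \<gamma> where \<gamma>: "pathin X \<gamma>" "\<gamma> 0 = k z" "\<gamma> 1 = k z'" "\<forall>t\<in>{0..1}. u (\<gamma> t) < s"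
        using near[OF k_in k_in z] by blast
      have "\<gamma> t \<noteq> p" if "t \<in> {0..1}" for t using \<gamma>(4) that p(2) s \<eta> by force
      then show ?thesis
        using connected_component_path[OF \<gamma>(1), of 1 "\<lambda>y. u y < s"] \<gamma> by (simp add: jk)
    qed
    have left: "connected_component {z. ?U z \<ge> s} 0 z"
      if s: "s = e\<^sub>1 - \<eta> \<or> s = e\<^sub>1 + \<eta>" and z: "?U z \<ge> s + \<eta>" "?W z < 0" for s z
    proof -
      have "e\<^sub>1 - \<eta> \<le> s" "s + \<eta> \<le> u q" using s \<eta> q(2) by auto
      moreover have "0 < w q * w (k z)" using z(2) q(3) by (simp add: mult_neg_neg)
      ultimately obtain \<gamma> where \<gamma>: "pathin X \<gamma>" "\<gamma> 0 = q" "\<gamma> 1 = k z" "\<forall>t\<in>{0..1}. s \<le> u (\<gamma> t) \<and> 0 < w (\<gamma> t) * w q"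
        using far[OF _ q(1) k_in, of s z] z(1) by blast
      have "\<gamma> t \<noteq> p" if t: "t \<in> {0..1}" for t
      proof
        assume "\<gamma> t = p"
        then have "0 < w p * w q" using \<gamma>(4) t by blast
        then show False using mult_pos_neg[OF p(3) q(3)] by linarith
      qed
      then show ?thesis
        using connected_component_path[OF \<gamma>(1), of 1 "\<lambda>y. s \<le> u y"] \<gamma> by (simp add: jk jk0(2))
    qed
    have right: "\<not> bounded (connected_component_set {z. ?U z \<ge> s} z)"
      if s: "s = e\<^sub>1 - \<eta> \<or> s = e\<^sub>1 + \<eta>" and z: "?U z \<ge> s + \<eta>" "?W z > 0" for s z
    proof -
      have "e\<^sub>1 - \<eta> \<le> s" "s + \<eta> \<le> u p" using s \<eta> p(2) by auto
      moreover have "0 < w (k z) * w p" using z(2) p(3) by simp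
      ultimately obtain \<gamma> where \<gamma>: "pathin X \<gamma>" "\<gamma> 0 = k z" "\<gamma> 1 = p" "\<forall>t\<in>{0..1}. s \<le> u (\<gamma> t) \<and> 0 < w (\<gamma> t) * w (k z)"
        using far[OF _ k_in p(1), of s z] z(1) by blast
      then show ?thesis
        using unbounded_component_path[OF \<gamma>(1), of "\<lambda>y. s \<le> u y"] k_neq by (simp add: jk)
    qed
    have bU: "bounded {z. ?U z < e\<^sub>1 + \<eta>}"
    proof (rule bounded_chart)
      show "closedin X {y \<in> topspace X. u y \<in> {..e\<^sub>1 + \<eta>}}"
        by (rule closedin_continuous_map_preimage[OF u]) simp
    qed (use p \<eta> k_in in auto)
    have bW: "bounded {z. ?U z \<ge> e\<^sub>1 - 2 * \<eta> \<and> ?W z \<le> 0}"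
    proof (rule bounded_chart)
      show "closedin X {y \<in> topspace X. w y \<in> {..0}}"
        by (rule closedin_continuous_map_preimage[OF w]) simp
    qed (use p k_in in auto)
    obtain C g where C: "{z. ?U z < e\<^sub>1} \<subseteq> C" "C \<subseteq> {z. ?U z < e\<^sub>2}" "open C" "0 \<notin> C"
      "path_connected (exp -` C :: complex set)" "simply_connected (exp -` C :: complex set)"
      and g: "path g" "g 1 = deck 1 (g 0)" "\<And>t. ?U (exp (g t)) < e\<^sub>1"
      by (rule annulus_between[of ?U ?W \<eta> e\<^sub>1 e\<^sub>2 "j m"])
         (use continuous_on_chart[OF u] continuous_on_chart[OF w] \<eta> kj[OF m(1) mp] m k0 q near' left right
           w0[OF k_in] bW bU in auto)
    have "has_dim class_ring (cohomology_image (Suc b) (subtopology X ?A) (subtopology X ?B) id :: ('k, ('a, 'k) cochain set) module)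
      (if b = 0 then 1 else 0)"
    proof (rule has_dim_cohomology_image_annulus[OF id _ _ _ C(4,3,5,6) _ _ g(1,2), where j = j and i = j and k = k and l = k and W = "{z. ?U z < e\<^sub>1}"])
      have jC: "j ` ?A \<subseteq> C"
      proof (rule image_subsetI)
        fix y assume y: "y \<in> ?A"
        then have "y \<noteq> p" using p \<eta> by auto
        then have "k (j y) = y" using kj y by blast
        then show "j y \<in> C" using C(1) y by auto
      qed
      have pA: "p \<notin> ?A" "p \<notin> ?B" using p \<eta> by auto
      have jA: "?U (j y) = u y" if "y \<in> topspace X" "y \<noteq> p" for y using kj[OF that] by simp
      show "continuous_map (subtopology X ?A) (top_of_set C) j"
        using jC pA(1) by (intro continuous_chart_subtopology) auto
      show "continuous_map (top_of_set C) (subtopology X ?B) k"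
        using C(2) k_in by (intro continuous_chart_inverse_subtopology) auto
      show "k (j x) = id x" if "x \<in> topspace (subtopology X ?A)" for x
        using that kj[of x] pA(1) by auto
      show "continuous_map (subtopology X ?B) (top_of_set (- {0})) j"
      proof (intro continuous_chart_subtopology)
        show "j ` ?B \<subseteq> - {0}"
        proof
          fix z assume "z \<in> j ` ?B"
          then obtain y where y: "y \<in> topspace X" "u y < e\<^sub>2" "z = j y" by auto
          have "y \<noteq> p" using y(1,2) pA(2) by blast
          then have "?U z < e\<^sub>2" using jA[of y] y by simp
          then show "z \<in> - {0}" using k0 q(2) by auto
        qed
      qed (use pA in auto)
      show "j (id x) = j x" for x by simp
      show "exp (g t) \<in> {z. ?U z < e\<^sub>1}" for t using g(3) by simp
      show "continuous_map (top_of_set {z. ?U z < e\<^sub>1}) (subtopology X ?A) k"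
        using k_in by (intro continuous_chart_inverse_subtopology) auto
      show "j (k z) = z" for z by (rule jk)
    qed
    then show ?thesis by (simp add: Suc)
  qed
qed

text \<open>With a single far side every far point is joined to p, that is, to infinity in the
  chart, so filling all holes stays inside the larger ball.\<close>

lemma sphere_cohomology_image_disc:
  fixes X :: "'a topology" and u :: "'a \<Rightarrow> real"
  assumes X: "X homeomorphic_space nsphere 2"
    and u: "continuous_map X euclideanreal u"
    and \<eta>: "0 < \<eta>" "e\<^sub>1 + 2 * \<eta> \<le> e\<^sub>2"
    and p: "p \<in> topspace X" "u p \<ge> e\<^sub>2" and m: "m \<in> topspace X" "u m < e\<^sub>1"
    and near: "\<And>s y y'. y \<in> topspace X \<Longrightarrow> y' \<in> topspace X \<Longrightarrow> u y < s - \<eta> \<Longrightarrow> u y' < s - \<eta> \<Longrightarrow>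
      \<exists>\<gamma>. pathin X \<gamma> \<and> \<gamma> 0 = y \<and> \<gamma> 1 = y' \<and> (\<forall>t\<in>{0..1}. u (\<gamma> t) < s)"
    and far: "\<And>s y y'. e\<^sub>1 - \<eta> \<le> s \<Longrightarrow> y \<in> topspace X \<Longrightarrow> y' \<in> topspace X \<Longrightarrow>
      s + \<eta> \<le> u y \<Longrightarrow> s + \<eta> \<le> u y' \<Longrightarrow>
      \<exists>\<gamma>. pathin X \<gamma> \<and> \<gamma> 0 = y \<and> \<gamma> 1 = y' \<and> (\<forall>t\<in>{0..1}. s \<le> u (\<gamma> t))"
  shows "has_dim class_ring
    (cohomology_image a (subtopology X {y \<in> topspace X. u y < e\<^sub>1}) (subtopology X {y \<in> topspace X. u y < e\<^sub>2}) id
       :: ('k::field, ('a, 'k) cochain set) module)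
    (if a = 0 then 1 else 0)"
proof -
  let ?A = "{y \<in> topspace X. u y < e\<^sub>1}" and ?B = "{y \<in> topspace X. u y < e\<^sub>2}"
  have id: "continuous_map (subtopology X ?A) (subtopology X ?B) id"
    using \<eta> by (auto simp: continuous_map_in_subtopology intro: continuous_map_from_subtopology)
  show ?thesis
  proof (cases a)
    case 0
    have "has_dim class_ring (cohomology_image 0 (subtopology X ?A) (subtopology X ?B) id :: ('k, ('a, 'k) cochain set) module) 1"
    proof (rule has_dim_cohomology_image_path_connected[OF id])
      show "topspace (subtopology X ?A) \<noteq> {}" using m by force
      fix y y' assume "y \<in> topspace (subtopology X ?A)" "y' \<in> topspace (subtopology X ?A)"
      then obtain \<gamma> where \<gamma>: "pathin X \<gamma>" "\<gamma> 0 = y" "\<gamma> 1 = y'" "\<forall>t\<in>{0..1}. u (\<gamma> t) < e\<^sub>1 + \<eta>"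
        using near[of y y' "e\<^sub>1 + \<eta>"] by auto
      have "\<gamma> t \<in> ?B" if "t \<in> {0..1}" for t
        using \<gamma>(4) pathin_topspace[OF \<gamma>(1) that] that \<eta> by fastforce
      then show "\<exists>g. pathin (subtopology X ?B) g \<and> g 0 = id y \<and> g 1 = id y'"
        using \<gamma> by (intro exI[of _ \<gamma>]) (simp add: pathin_subtopology)
    qed
    then show ?thesis by (simp add: 0)
  next
    case (Suc b)
    obtain j k where jk0: "punctured_sphere_chart X p j k" "j p = 0"
      using punctured_sphere_chart_exists[OF X p(1)] by blast
    interpret punctured_sphere_chart X p j k by (rule jk0(1))
    have "u m < u p" using m(2) p(2) \<eta> by linarith
    then have mp: "m \<noteq> p" by blast
    let ?U = "\<lambda>z. u (k z)"
    have near': "connected_component {z. ?U z < e\<^sub>1 + \<eta>} z z'"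
      if z: "?U z < e\<^sub>1" "?U z' < e\<^sub>1" for z z'
    proof -
      obtain \<gamma> where \<gamma>: "pathin X \<gamma>" "\<gamma> 0 = k z" "\<gamma> 1 = k z'" "\<forall>t\<in>{0..1}. u (\<gamma> t) < e\<^sub>1 + \<eta>"
        using near[OF k_in k_in, of z "e\<^sub>1 + \<eta>" z'] z by auto
      have "\<gamma> t \<noteq> p" if "t \<in> {0..1}" for t using \<gamma>(4) that p(2) \<eta> by force
      then show ?thesis
        using connected_component_path[OF \<gamma>(1), of 1 "\<lambda>y. u y < e\<^sub>1 + \<eta>"] \<gamma> by (simp add: jk)
    qed
    have ub: "\<not> bounded (connected_component_set {z. ?U z \<ge> e\<^sub>1 + \<eta>} z)" if z: "?U z \<ge> e\<^sub>2" for z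
    proof -
      obtain \<gamma> where \<gamma>: "pathin X \<gamma>" "\<gamma> 0 = k z" "\<gamma> 1 = p" "\<forall>t\<in>{0..1}. e\<^sub>1 + \<eta> \<le> u (\<gamma> t)"
        using far[OF _ k_in p(1), of "e\<^sub>1 + \<eta>" z] z p(2) \<eta> by auto
      then show ?thesis
        using unbounded_component_path[OF \<gamma>(1), of "\<lambda>y. e\<^sub>1 + \<eta> \<le> u y"] k_neq by (simp add: jk)
    qed
    have b: "bounded {z. ?U z < e\<^sub>1 + \<eta>}"
    proof (rule bounded_chart)
      show "closedin X {y \<in> topspace X. u y \<in> {..e\<^sub>1 + \<eta>}}"
        by (rule closedin_continuous_map_preimage[OF u]) simp
    qed (use p \<eta> k_in in auto)
    obtain C where C: "{z. ?U z < e\<^sub>1} \<subseteq> C" "C \<subseteq> {z. ?U z < e\<^sub>2}" "open C" "simply_connected C"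
      by (rule disc_between[of ?U "e\<^sub>1 + \<eta>" "j m" e\<^sub>1 e\<^sub>2])
         (use continuous_on_chart[OF u] kj[OF m(1) mp] m near' ub b in auto)
    have "has_dim class_ring (cohomology_image (Suc b) (subtopology X ?A) (subtopology X ?B) id :: ('k, ('a, 'k) cochain set) module) 0"
    proof (rule has_dim_cohomology_image_disc[OF id _ _ _ C(3,4), where j = j and k = k])
      have jC: "j ` ?A \<subseteq> C"
      proof (rule image_subsetI)
        fix y assume y: "y \<in> ?A"
        then have "y \<noteq> p" using p \<eta> by auto
        then have "k (j y) = y" using kj y by blast
        then show "j y \<in> C" using C(1) y by auto
      qed
      have pA: "p \<notin> ?A" using p \<eta> by auto
      show "continuous_map (subtopology X ?A) (top_of_set C) j"
        using jC pA by (intro continuous_chart_subtopology) auto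
      show "continuous_map (top_of_set C) (subtopology X ?B) k"
        using C(2) k_in by (intro continuous_chart_inverse_subtopology) auto
      show "k (j x) = id x" if "x \<in> topspace (subtopology X ?A)" for x
        using that kj[of x] pA by auto
    qed
    then show ?thesis by (simp add: Suc)
  qed
qed

section \<open>Collapse of a length space to a segment\<close>

text \<open>A curve of nearly minimal length serves: its length is at least the sum over the
  partition 0, t, 1, encoded by \<open>T\<close>.\<close>

lemma intrinsic_metric_path:
  assumes m: "intrinsic_metric m" and y: "y \<in> mspace m" and y': "y' \<in> mspace m" and \<eta>: "\<eta> > 0"
  obtains \<gamma> where "pathin (mtopology_of m) \<gamma>" "\<gamma> 0 = y" "\<gamma> 1 = y'"
    "\<And>t. t \<in> {0..1} \<Longrightarrow> mdist m y (\<gamma> t) + mdist m (\<gamma> t) y' < mdist m y y' + \<eta>"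
proof -
  have "(INF \<gamma> \<in> {\<gamma>. pathin (mtopology_of m) \<gamma> \<and> \<gamma> 0 = y \<and> \<gamma> 1 = y'}. curve_length m \<gamma>) = ennreal (mdist m y y')"
    using m y y' by (simp add: intrinsic_metric_def)
  also have "\<dots> < ennreal (mdist m y y' + \<eta>)" using \<eta> by (simp add: ennreal_lessI)
  finally obtain \<gamma> where \<gamma>: "pathin (mtopology_of m) \<gamma>" "\<gamma> 0 = y" "\<gamma> 1 = y'"
      "curve_length m \<gamma> < ennreal (mdist m y y' + \<eta>)"
    unfolding INF_less_iff by auto
  show thesis
  proof (rule that[OF \<gamma>(1-3)])
    fix t :: real assume t: "t \<in> {0..1}"
    define T where "T i = (if i = 0 then 0 else if i = 1 then t else 1)" for i :: nat
    have "mono T" using t by (auto simp: mono_def T_def)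
    moreover have "range T \<subseteq> {0..1}" using t by (auto simp: T_def)
    ultimately have "(\<Sum>i<2. ennreal (mdist m (\<gamma> (T i)) (\<gamma> (T (Suc i))))) \<le> curve_length m \<gamma>"
      unfolding curve_length_def by (intro SUP_upper2[of "(2, T)"]) auto
    then have "ennreal (mdist m y (\<gamma> t) + mdist m (\<gamma> t) y') < ennreal (mdist m y y' + \<eta>)"
      using \<gamma>(2-4) by (simp add: T_def numeral_2_eq_2 ennreal_plus)
    then show "mdist m y (\<gamma> t) + mdist m (\<gamma> t) y' < mdist m y y' + \<eta>"
      by (simp add: ennreal_less_iff del: ennreal_plus)
  qed
qed

lemma hausdorff_dist_lessD:
  assumes "hausdorff_dist m S T < ennreal \<delta>"
  shows "\<And>x. x \<in> S \<Longrightarrow> \<exists>y\<in>T. mdist m x y < \<delta>" and "\<And>y. y \<in> T \<Longrightarrow> \<exists>x\<in>S. mdist m x y < \<delta>"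
proof -
  obtain \<rho> where \<rho>: "ennreal \<rho> < ennreal \<delta>" "\<rho> > 0" "\<forall>x\<in>S. \<exists>y\<in>T. mdist m x y < \<rho>" "\<forall>y\<in>T. \<exists>x\<in>S. mdist m x y < \<rho>"
    using assms unfolding hausdorff_dist_def Inf_less_iff by auto
  have "\<rho> < \<delta>" using \<rho>(1,2) by (simp add: ennreal_less_iff)
  then show "\<And>x. x \<in> S \<Longrightarrow> \<exists>y\<in>T. mdist m x y < \<delta>" "\<And>y. y \<in> T \<Longrightarrow> \<exists>x\<in>S. mdist m x y < \<delta>"
    using \<rho>(3,4) by (meson less_trans)+
qed

lemma continuous_map_cross_dist:
  assumes D: "extends_to_disjoint_union A X D" and x: "x \<in> mspace A"
  shows "continuous_map (mtopology_of X) euclideanreal (\<lambda>y. mdist D (Inl x) (Inr y))"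
proof -
  have "Lipschitz_continuous_map X euclidean_metric (\<lambda>y. mdist D (Inl x) (Inr y))"
    unfolding Lipschitz_continuous_map_def
  proof (intro conjI exI[of _ 1] ballI)
    fix y y' assume y: "y \<in> mspace X" "y' \<in> mspace X"
    have i: "Inl x \<in> mspace D" "Inr y \<in> mspace D" "Inr y' \<in> mspace D"
      and d: "mdist D (Inr y) (Inr y') = mdist X y y'"
      using D x y by (auto simp: extends_to_disjoint_union_def)
    show "mdist euclidean_metric (mdist D (Inl x) (Inr y)) (mdist D (Inl x) (Inr y')) \<le> 1 * mdist X y y'"
      using mdist_triangle[OF i(1,2,3)] mdist_triangle[OF i(1,3,2)] d mdist_commute[of D "Inr y" "Inr y'"]
      by (simp add: dist_real_def)
  qed auto
  from Lipschitz_continuous_imp_continuous_map[OF this] show ?thesis by simp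
qed

text \<open>The map f picks a partner in the segment for each point of X and need not be continuous.
  It enters only through estimates; the continuous functions handed to the topological part are
  distances to points of the segment.\<close>

locale segment_approximation =
  fixes l r \<delta> :: real and X :: "'a metric" and D :: "(real + 'a) metric" and f :: "'a \<Rightarrow> real"
  assumes intrinsic: "intrinsic_metric X"
    and ext: "extends_to_disjoint_union (segment l r) X D"
    and f_in: "y \<in> mspace X \<Longrightarrow> f y \<in> {l..r}"
    and f_close: "y \<in> mspace X \<Longrightarrow> mdist D (Inl (f y)) (Inr y) < \<delta>"
    and dense: "x \<in> {l..r} \<Longrightarrow> \<exists>y\<in>mspace X. mdist D (Inl x) (Inr y) < \<delta>"
begin

lemma in_mspace: "x \<in> {l..r} \<Longrightarrow> Inl x \<in> mspace D" "y \<in> mspace X \<Longrightarrow> Inr y \<in> mspace D"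
  and mdist_Inl: "x \<in> {l..r} \<Longrightarrow> x' \<in> {l..r} \<Longrightarrow> mdist D (Inl x) (Inl x') = \<bar>x - x'\<bar>"
  and mdist_Inr: "y \<in> mspace X \<Longrightarrow> y' \<in> mspace X \<Longrightarrow> mdist D (Inr y) (Inr y') = mdist X y y'"
  using ext by (auto simp: extends_to_disjoint_union_def segment_def dist_real_def)

lemma cross_dist_close:
  assumes x: "x \<in> {l..r}" and y: "y \<in> mspace X"
  shows "\<bar>mdist D (Inl x) (Inr y) - \<bar>x - f y\<bar>\<bar> < \<delta>"
  using mdist_triangle[of "Inl x" D "Inl (f y)" "Inr y"] mdist_triangle[of "Inl x" D "Inr y" "Inl (f y)"]
    in_mspace x y f_in[OF y] f_close[OF y] mdist_Inl[OF x f_in[OF y]] mdist_commute[of D "Inr y" "Inl (f y)"]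
  by auto

text \<open>Each of the two points is exchanged for its partner in the segment at a cost of
  \<delta>.\<close>

lemma mdist_close:
  assumes y: "y \<in> mspace X" "y' \<in> mspace X"
  shows "\<bar>mdist X y y' - \<bar>f y - f y'\<bar>\<bar> < 2 * \<delta>"
proof -
  have "\<bar>mdist X y y' - mdist D (Inl (f y)) (Inr y')\<bar> < \<delta>"
    using mdist_triangle[of "Inr y" D "Inl (f y)" "Inr y'"] mdist_triangle[of "Inl (f y)" D "Inr y" "Inr y'"]
      in_mspace y f_in[OF y(1)] f_close[OF y(1)] mdist_Inr[OF y] mdist_commute[of D "Inr y" "Inl (f y)"]
    by auto
  then show ?thesis using cross_dist_close[OF f_in[OF y(1)] y(2)] by linarith
qed

text \<open>A path with excess \<delta> is taken. Comparing three distances in X with f-values costs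
  2 \<delta> each, so in the segment the detour stays below 8 \<delta>. Overshooting an end of the
  interval by h costs 2 h, whence h < 4 \<delta>.\<close>

lemma path_between:
  assumes y: "y \<in> mspace X" "y' \<in> mspace X"
  obtains \<gamma> where "pathin (mtopology_of X) \<gamma>" "\<gamma> 0 = y" "\<gamma> 1 = y'" "\<And>t. t \<in> {0..1} \<Longrightarrow> \<gamma> t \<in> mspace X"
    "\<And>t. t \<in> {0..1} \<Longrightarrow> min (f y) (f y') - 4 * \<delta> < f (\<gamma> t)"
    "\<And>t. t \<in> {0..1} \<Longrightarrow> f (\<gamma> t) < max (f y) (f y') + 4 * \<delta>"
proof -
  have \<delta>: "\<delta> > 0" using f_close[OF y(1)] mdist_nonneg[of D] by (rule le_less_trans[rotated])
  obtain \<gamma> where \<gamma>: "pathin (mtopology_of X) \<gamma>" "\<gamma> 0 = y" "\<gamma> 1 = y'"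
    "\<And>t. t \<in> {0..1} \<Longrightarrow> mdist X y (\<gamma> t) + mdist X (\<gamma> t) y' < mdist X y y' + \<delta>"
    using intrinsic_metric_path[OF intrinsic y \<delta>] by blast
  have \<gamma>X: "\<gamma> t \<in> mspace X" if "t \<in> {0..1}" for t using pathin_topspace[OF \<gamma>(1) that] by simp
  have *: "\<bar>f y - f (\<gamma> t)\<bar> + \<bar>f (\<gamma> t) - f y'\<bar> < \<bar>f y - f y'\<bar> + 8 * \<delta>" if t: "t \<in> {0..1}" for t
    using \<gamma>(4)[OF t] mdist_close[OF y] mdist_close[OF y(1) \<gamma>X[OF t]] mdist_close[OF \<gamma>X[OF t] y(2)] \<delta>
    by linarith
  show thesis
  proof (rule that[OF \<gamma>(1-3) \<gamma>X])
    fix t :: real assume "t \<in> {0..1}"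
    from *[OF this] show "min (f y) (f y') - 4 * \<delta> < f (\<gamma> t)" "f (\<gamma> t) < max (f y) (f y') + 4 * \<delta>"
      by (auto simp: min_def max_def abs_if split: if_splits)
  qed
qed

text \<open>The loss 10 \<delta> covers \<delta> for passing to f-values, 4 \<delta> for the
  overshoot and \<delta> for passing back.\<close>

lemma path_near:
  assumes x: "x \<in> {l..r}" and y: "y \<in> mspace X" "y' \<in> mspace X"
    and s: "mdist D (Inl x) (Inr y) < s - 10 * \<delta>" "mdist D (Inl x) (Inr y') < s - 10 * \<delta>"
  shows "\<exists>\<gamma>. pathin (mtopology_of X) \<gamma> \<and> \<gamma> 0 = y \<and> \<gamma> 1 = y' \<and> (\<forall>t\<in>{0..1}. mdist D (Inl x) (Inr (\<gamma> t)) < s)"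
proof -
  obtain \<gamma> where \<gamma>: "pathin (mtopology_of X) \<gamma>" "\<gamma> 0 = y" "\<gamma> 1 = y'" "\<And>t. t \<in> {0..1} \<Longrightarrow> \<gamma> t \<in> mspace X"
    "\<And>t. t \<in> {0..1} \<Longrightarrow> min (f y) (f y') - 4 * \<delta> < f (\<gamma> t)"
    "\<And>t. t \<in> {0..1} \<Longrightarrow> f (\<gamma> t) < max (f y) (f y') + 4 * \<delta>"
    using path_between[OF y] by blast
  have "mdist D (Inl x) (Inr (\<gamma> t)) < s" if t: "t \<in> {0..1}" for t
    using \<gamma>(5,6)[OF t] cross_dist_close[OF x \<gamma>(4)[OF t]] cross_dist_close[OF x y(1)] cross_dist_close[OF x y(2)] s
    by (simp add: min_def max_def split: if_splits)
  then show ?thesis using \<gamma> by blast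
qed

text \<open>Both f-values lie on the same side of x at distance more than s + 9 \<delta>; an
  overshoot below 4 \<delta> can neither cross x nor come within s + 5 \<delta> of it.\<close>

lemma path_far:
  assumes x: "x \<in> {l..r}" and y: "y \<in> mspace X" "y' \<in> mspace X" and s: "0 < s"
    and far: "s + 10 * \<delta> \<le> mdist D (Inl x) (Inr y)" "s + 10 * \<delta> \<le> mdist D (Inl x) (Inr y')"
    and side: "f y < x \<longleftrightarrow> f y' < x"
  shows "\<exists>\<gamma>. pathin (mtopology_of X) \<gamma> \<and> \<gamma> 0 = y \<and> \<gamma> 1 = y' \<and>
    (\<forall>t\<in>{0..1}. \<gamma> t \<in> mspace X \<and> s \<le> mdist D (Inl x) (Inr (\<gamma> t)) \<and> (f (\<gamma> t) < x \<longleftrightarrow> f y < x))"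
proof -
  have \<delta>: "\<delta> > 0" using f_close[OF y(1)] mdist_nonneg[of D] by (rule le_less_trans[rotated])
  obtain \<gamma> where \<gamma>: "pathin (mtopology_of X) \<gamma>" "\<gamma> 0 = y" "\<gamma> 1 = y'" "\<And>t. t \<in> {0..1} \<Longrightarrow> \<gamma> t \<in> mspace X"
    "\<And>t. t \<in> {0..1} \<Longrightarrow> min (f y) (f y') - 4 * \<delta> < f (\<gamma> t)"
    "\<And>t. t \<in> {0..1} \<Longrightarrow> f (\<gamma> t) < max (f y) (f y') + 4 * \<delta>"
    using path_between[OF y] by blast
  have "s \<le> mdist D (Inl x) (Inr (\<gamma> t)) \<and> (f (\<gamma> t) < x \<longleftrightarrow> f y < x)" if t: "t \<in> {0..1}" for t
  proof -
    note close = cross_dist_close[OF x \<gamma>(4)[OF t]]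
      and close_y = cross_dist_close[OF x y(1)] cross_dist_close[OF x y(2)]
    show ?thesis
    proof (cases "f y < x")
      case True
      have "f y < x - s - 9 * \<delta>" using True close_y(1) far(1) by linarith
      moreover have "f y' < x - s - 9 * \<delta>" using True side close_y(2) far(2) by linarith
      ultimately have "f (\<gamma> t) < x - s - 5 * \<delta>" using \<gamma>(6)[OF t] by linarith
      then have "s \<le> mdist D (Inl x) (Inr (\<gamma> t))" "f (\<gamma> t) < x" using close s \<delta> by linarith+
      then show ?thesis using True by blast
    next
      case False
      have "f y > x + s + 9 * \<delta>" using False close_y(1) far(1) by linarith
      moreover have "f y' > x + s + 9 * \<delta>" using False side close_y(2) far(2) by linarith
      ultimately have "f (\<gamma> t) > x + s + 5 * \<delta>" using \<gamma>(5)[OF t] by linarith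
      then have "s \<le> mdist D (Inl x) (Inr (\<gamma> t))" "\<not> f (\<gamma> t) < x" using close s \<delta> by linarith+
      then show ?thesis using False by blast
    qed
  qed
  then show ?thesis using \<gamma> by blast
qed

lemma point_near:
  assumes x: "x \<in> {l..r}"
  obtains y where "y \<in> mspace X" "mdist D (Inl x) (Inr y) < \<delta>" "\<bar>x - f y\<bar> < 2 * \<delta>"
proof -
  obtain y where "y \<in> mspace X" "mdist D (Inl x) (Inr y) < \<delta>" using dense[OF x] by blast
  then show thesis using that cross_dist_close[OF x, of y] by fastforce
qed

text \<open>The sign of f y - x tells the two sides apart, but f may be discontinuous. The distance
  to the left endpoint l, shifted by x - l, is a continuous replacement \<open>?w\<close> with error
  below \<delta>. The bound 30 \<delta> \<le> \<open>e\<^sub>1\<close> leaves |f y - x| > 9 \<delta>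
  at the lowest level \<open>e\<^sub>1 - 20 * \<delta>\<close>, so the two signs agree there. The
  points p and q lie near r and l.\<close>

lemma interior_ball_image:
  assumes X: "mtopology_of X homeomorphic_space nsphere 2"
    and x: "x \<in> {l..r}" and e: "e\<^sub>2 + 10 * \<delta> \<le> x - l" "e\<^sub>2 + 10 * \<delta> \<le> r - x"
    and \<delta>: "30 * \<delta> \<le> e\<^sub>1" "e\<^sub>1 + 20 * \<delta> \<le> e\<^sub>2"
  shows "has_dim (class_ring :: 'k::field ring) (ball_restriction_image a X D x e\<^sub>1 e\<^sub>2) (if a = 0 \<or> a = 1 then 1 else 0)"
proof -
  let ?u = "\<lambda>y. mdist D (Inl x) (Inr y)" and ?w = "\<lambda>y. mdist D (Inl l) (Inr y) - (x - l)"
  have lr: "l \<in> {l..r}" "r \<in> {l..r}" using x by auto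
  have seg: "x \<in> mspace (segment l r)" "l \<in> mspace (segment l r)" using x lr by (auto simp: segment_def)
  obtain p where p: "p \<in> mspace X" "\<bar>r - f p\<bar> < 2 * \<delta>" using point_near[OF lr(2)] by metis
  obtain q where q: "q \<in> mspace X" "\<bar>l - f q\<bar> < 2 * \<delta>" using point_near[OF lr(1)] by metis
  obtain m where m: "m \<in> mspace X" "?u m < \<delta>" using point_near[OF x] by metis
  have \<delta>0: "\<delta> > 0" using m(2) mdist_nonneg[of D "Inl x" "Inr m"] by linarith
  have w: "\<bar>?w y - (f y - x)\<bar> < \<delta>" if "y \<in> mspace X" for y
    using cross_dist_close[OF lr(1) that] f_in[OF that] by simp
  have side: "(0 < ?w y \<longleftrightarrow> \<not> f y < x) \<and> ?w y \<noteq> 0"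
    if "y \<in> mspace X" "e\<^sub>1 - 20 * \<delta> \<le> ?u y" for y
    using w[OF that(1)] cross_dist_close[OF x that(1)] that(2) \<delta> \<delta>0 by (smt (verit))
  show ?thesis
    unfolding ball_restriction_image_def cross_ball_def topspace_mtopology_of[symmetric]
  proof (rule sphere_cohomology_image_annulus[OF X, where u = ?u and w = ?w and \<eta> = "10 * \<delta>" and p = p and q = q and m = m])
    show "continuous_map (mtopology_of X) euclideanreal ?u"
      by (rule continuous_map_cross_dist[OF ext seg(1)])
    show "continuous_map (mtopology_of X) euclideanreal ?w"
      by (rule continuous_map_diff[OF continuous_map_cross_dist[OF ext seg(2)]]) simp
    show "0 < 10 * \<delta>" "e\<^sub>1 + 2 * (10 * \<delta>) \<le> e\<^sub>2" using \<delta>0 \<delta> by auto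
    show "p \<in> topspace (mtopology_of X)" "q \<in> topspace (mtopology_of X)" "m \<in> topspace (mtopology_of X)"
      using p q m by auto
    show "e\<^sub>2 \<le> ?u p" using cross_dist_close[OF x p(1)] p(2) e \<delta>0 by linarith
    show "0 < ?w p" using w[OF p(1)] p(2) e \<delta>0 \<delta> by linarith
    show "e\<^sub>2 \<le> ?u q" using cross_dist_close[OF x q(1)] q(2) e \<delta>0 by linarith
    show "?w q < 0" using w[OF q(1)] q(2) e \<delta>0 \<delta> by linarith
    show "?u m < e\<^sub>1 - 2 * (10 * \<delta>)" using m(2) \<delta> \<delta>0 by linarith
    show "\<exists>\<gamma>. pathin (mtopology_of X) \<gamma> \<and> \<gamma> 0 = y \<and> \<gamma> 1 = y' \<and> (\<forall>t\<in>{0..1}. ?u (\<gamma> t) < s)"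
      if "y \<in> topspace (mtopology_of X)" "y' \<in> topspace (mtopology_of X)" "?u y < s - 10 * \<delta>" "?u y' < s - 10 * \<delta>" for s y y'
      using that by (intro path_near[OF x]) auto
    show "?w y \<noteq> 0" if "y \<in> topspace (mtopology_of X)" "e\<^sub>1 - 2 * (10 * \<delta>) \<le> ?u y" for y
      using side[of y] that by simp
    fix s y y'
    assume s: "e\<^sub>1 - 10 * \<delta> \<le> s" and "y \<in> topspace (mtopology_of X)" "y' \<in> topspace (mtopology_of X)"
      and u: "s + 10 * \<delta> \<le> ?u y" "s + 10 * \<delta> \<le> ?u y'" and w: "0 < ?w y * ?w y'"
    then have y: "y \<in> mspace X" "y' \<in> mspace X" by auto
    have s0: "0 < s" using s \<delta> \<delta>0 by linarith
    have u': "e\<^sub>1 - 20 * \<delta> \<le> ?u y" "e\<^sub>1 - 20 * \<delta> \<le> ?u y'" using s u \<delta>0 by linarith+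
    have "f y < x \<longleftrightarrow> f y' < x"
      using side[OF y(1) u'(1)] side[OF y(2) u'(2)] w by (auto simp: zero_less_mult_iff)
    from path_far[OF x y s0 u this] obtain \<gamma> where \<gamma>: "pathin (mtopology_of X) \<gamma>" "\<gamma> 0 = y" "\<gamma> 1 = y'"
      "\<And>t. t \<in> {0..1} \<Longrightarrow> \<gamma> t \<in> mspace X \<and> s \<le> ?u (\<gamma> t) \<and> (f (\<gamma> t) < x \<longleftrightarrow> f y < x)" by blast
    have "0 < ?w (\<gamma> t) * ?w y" if "t \<in> {0..1}" for t
    proof -
      have "e\<^sub>1 - 20 * \<delta> \<le> ?u (\<gamma> t)" using \<gamma>(4)[OF that] s \<delta>0 by linarith
      then show ?thesis
        using side[of "\<gamma> t"] side[OF y(1) u'(1)] \<gamma>(4)[OF that] by (auto simp: zero_less_mult_iff)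
    qed
    then show "\<exists>\<gamma>. pathin (mtopology_of X) \<gamma> \<and> \<gamma> 0 = y \<and> \<gamma> 1 = y' \<and> (\<forall>t\<in>{0..1}. s \<le> ?u (\<gamma> t) \<and> 0 < ?w (\<gamma> t) * ?w y)"
      using \<gamma> by blast
  qed
qed

lemma endpoint_ball_image:
  assumes X: "mtopology_of X homeomorphic_space nsphere 2"
    and x: "x \<in> {l, r}" "l \<le> r" and e: "e\<^sub>2 + 10 * \<delta> \<le> r - l"
    and \<delta>: "30 * \<delta> \<le> e\<^sub>1" "e\<^sub>1 + 20 * \<delta> \<le> e\<^sub>2"
  shows "has_dim (class_ring :: 'k::field ring) (ball_restriction_image a X D x e\<^sub>1 e\<^sub>2) (if a = 0 then 1 else 0)"
proof -
  let ?u = "\<lambda>y. mdist D (Inl x) (Inr y)"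
  \<comment> \<open>The point l + r - x is the other endpoint; p is taken near it.\<close>
  have x': "x \<in> {l..r}" "l + r - x \<in> {l..r}" using x by auto
  obtain p where p: "p \<in> mspace X" "\<bar>l + r - x - f p\<bar> < 2 * \<delta>" using point_near[OF x'(2)] by metis
  obtain m where m: "m \<in> mspace X" "?u m < \<delta>" using point_near[OF x'(1)] by metis
  have \<delta>0: "\<delta> > 0" using m(2) mdist_nonneg[of D "Inl x" "Inr m"] by linarith
  show ?thesis
    unfolding ball_restriction_image_def cross_ball_def topspace_mtopology_of[symmetric]
  proof (rule sphere_cohomology_image_disc[OF X, where u = ?u and \<eta> = "10 * \<delta>" and p = p and m = m])
    show "continuous_map (mtopology_of X) euclideanreal ?u"
      by (rule continuous_map_cross_dist[OF ext]) (use x' in \<open>auto simp: segment_def\<close>)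
    show "0 < 10 * \<delta>" "e\<^sub>1 + 2 * (10 * \<delta>) \<le> e\<^sub>2" using \<delta>0 \<delta> by auto
    show "p \<in> topspace (mtopology_of X)" "m \<in> topspace (mtopology_of X)" using p m by auto
    show "e\<^sub>2 \<le> ?u p" using cross_dist_close[OF x'(1) p(1)] p(2) e \<delta>0 x by auto
    show "?u m < e\<^sub>1" using m(2) \<delta> \<delta>0 by linarith
    show "\<exists>\<gamma>. pathin (mtopology_of X) \<gamma> \<and> \<gamma> 0 = y \<and> \<gamma> 1 = y' \<and> (\<forall>t\<in>{0..1}. ?u (\<gamma> t) < s)"
      if "y \<in> topspace (mtopology_of X)" "y' \<in> topspace (mtopology_of X)" "?u y < s - 10 * \<delta>" "?u y' < s - 10 * \<delta>" for s y y'
      using that by (intro path_near[OF x'(1)]) auto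
    fix s y y'
    assume s: "e\<^sub>1 - 10 * \<delta> \<le> s" and "y \<in> topspace (mtopology_of X)" "y' \<in> topspace (mtopology_of X)"
      and u: "s + 10 * \<delta> \<le> ?u y" "s + 10 * \<delta> \<le> ?u y'"
    then have y: "y \<in> mspace X" "y' \<in> mspace X" by auto
    have s0: "0 < s" using s \<delta> \<delta>0 by linarith
    \<comment> \<open>There is only one side: if x = l no value of f is below x, and if x = r all
      far points have f-values below x.\<close>
    have "f y < x \<longleftrightarrow> f y' < x"
      using x f_in[OF y(1)] f_in[OF y(2)] cross_dist_close[OF x'(1) y(1)] cross_dist_close[OF x'(1) y(2)] u s0 \<delta>0
      by auto
    from path_far[OF x'(1) y s0 u this]
    show "\<exists>\<gamma>. pathin (mtopology_of X) \<gamma> \<and> \<gamma> 0 = y \<and> \<gamma> 1 = y' \<and> (\<forall>t\<in>{0..1}. s \<le> ?u (\<gamma> t))" by blast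
  qed
qed

end

section \<open>From Hausdorff convergence to the dimension formulas\<close>

lemma segment_approximation_exists:
  assumes "intrinsic_metric X" and D: "extends_to_disjoint_union (segment l r) X D"
    and H: "hausdorff_dist D (Inl ` mspace (segment l r)) (Inr ` mspace X) < ennreal \<delta>"
  obtains f where "segment_approximation l r \<delta> X D f"
proof -
  have seg: "mspace (segment l r) = {l..r}" by (simp add: segment_def)
  have "\<forall>y\<in>mspace X. \<exists>x. x \<in> {l..r} \<and> mdist D (Inl x) (Inr y) < \<delta>"
    using hausdorff_dist_lessD(2)[OF H] unfolding seg by blast
  then obtain f where f: "\<And>y. y \<in> mspace X \<Longrightarrow> f y \<in> {l..r}" "\<And>y. y \<in> mspace X \<Longrightarrow> mdist D (Inl (f y)) (Inr y) < \<delta>"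
    by metis
  show thesis
    using hausdorff_dist_lessD(1)[OF H] f assms(1) D unfolding seg by (intro that[of f]) (unfold_locales, auto)
qed

theorem theorem6p5:
  fixes X :: "nat \<Rightarrow> 'a metric" and S :: "nat \<Rightarrow> 'a topology"
    and D :: "nat \<Rightarrow> (real + 'a) metric" and l r :: real
  assumes sphere: "\<And>i. S i homeomorphic_space nsphere 2"
    and cbb: "\<And>i. cbb_metric_on (S i) (X i)"
    and nondegenerate: "l < r"
    and converges: "gromov_hausdorff_converges X (segment l r)"
    and extends: "\<And>i. extends_to_disjoint_union (segment l r) (X i) (D i)"
    and hausdorff:
      "(\<lambda>i. hausdorff_dist (D i) (Inl ` mspace (segment l r)) (Inr ` mspace (X i))) \<longlonglongrightarrow> 0"
  shows "(\<forall>\<kappa> \<epsilon>\<^sub>1 \<epsilon>\<^sub>2. 0 < \<kappa> \<and> 0 < \<epsilon>\<^sub>1 \<and> \<epsilon>\<^sub>1 < \<epsilon>\<^sub>2 \<and> \<epsilon>\<^sub>2 < \<kappa> / 100 \<longrightarrow>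
      (\<exists>i\<^sub>0. \<forall>i>i\<^sub>0. \<forall>x\<in>mspace (segment l r). infdist x {l, r} > \<kappa> \<longrightarrow>
        (\<forall>a. has_dim (class_ring :: 'k::field ring)
               (ball_restriction_image a (X i) (D i) x \<epsilon>\<^sub>1 \<epsilon>\<^sub>2)
               (if a = 0 \<or> a = 1 then 1 else 0))))
    \<and> (\<forall>x\<in>{l, r}. \<forall>\<epsilon>\<^sub>1 \<epsilon>\<^sub>2. 0 < \<epsilon>\<^sub>1 \<and> \<epsilon>\<^sub>1 < \<epsilon>\<^sub>2 \<and> \<epsilon>\<^sub>2 < (r - l) / 100 \<longrightarrow>
      (\<forall>\<^sub>F i in sequentially.
        \<forall>a. has_dim (class_ring :: 'k::field ring)
              (ball_restriction_image a (X i) (D i) x \<epsilon>\<^sub>1 \<epsilon>\<^sub>2)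
              (if a = 0 then 1 else 0)))"
proof -
  have X: "mtopology_of (X i) homeomorphic_space nsphere 2" "intrinsic_metric (X i)" for i
    using sphere[of i] cbb[of i] by (auto simp: cbb_metric_on_def)
  have approx: "\<forall>\<^sub>F i in sequentially. \<exists>f. segment_approximation l r \<delta> (X i) (D i) f" if "\<delta> > 0" for \<delta>
  proof -
    have "\<forall>\<^sub>F i in sequentially. hausdorff_dist (D i) (Inl ` mspace (segment l r)) (Inr ` mspace (X i)) < ennreal \<delta>"
      using order_tendstoD(2)[OF hausdorff, of "ennreal \<delta>"] that by simp
    then show ?thesis
      by eventually_elim (use segment_approximation_exists[OF X(2) extends] in blast)
  qed
  show ?thesis
  proof (intro conjI allI impI ballI)
    fix \<kappa> \<epsilon>\<^sub>1 \<epsilon>\<^sub>2 :: real assume *: "0 < \<kappa> \<and> 0 < \<epsilon>\<^sub>1 \<and> \<epsilon>\<^sub>1 < \<epsilon>\<^sub>2 \<and> \<epsilon>\<^sub>2 < \<kappa> / 100"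
    \<comment> \<open>The choice depends on the two radii only, so the index from which the
      approximations exist is uniform in x.\<close>
    define \<delta> where "\<delta> = min \<epsilon>\<^sub>1 (\<epsilon>\<^sub>2 - \<epsilon>\<^sub>1) / 30"
    have "\<delta> > 0" "\<delta> \<le> \<epsilon>\<^sub>1 / 30" "\<delta> \<le> (\<epsilon>\<^sub>2 - \<epsilon>\<^sub>1) / 30" using * by (auto simp: \<delta>_def)
    then have \<delta>: "\<delta> > 0" "30 * \<delta> \<le> \<epsilon>\<^sub>1" "\<epsilon>\<^sub>1 + 20 * \<delta> \<le> \<epsilon>\<^sub>2" by argo+
    obtain i\<^sub>0 where i0: "\<And>i. i \<ge> i\<^sub>0 \<Longrightarrow> \<exists>f. segment_approximation l r \<delta> (X i) (D i) f"
      using approx[OF \<delta>(1)] unfolding eventually_sequentially by blast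
    show "\<exists>i\<^sub>0. \<forall>i>i\<^sub>0. \<forall>x\<in>mspace (segment l r). infdist x {l, r} > \<kappa> \<longrightarrow>
        (\<forall>a. has_dim (class_ring :: 'k ring) (ball_restriction_image a (X i) (D i) x \<epsilon>\<^sub>1 \<epsilon>\<^sub>2)
               (if a = 0 \<or> a = 1 then 1 else 0))"
    proof (intro exI[of _ i\<^sub>0] allI impI ballI)
      fix i x a assume i: "i > i\<^sub>0" and x: "x \<in> mspace (segment l r)" "infdist x {l, r} > \<kappa>"
      obtain f where "segment_approximation l r \<delta> (X i) (D i) f" using i0[of i] i by auto
      then interpret segment_approximation l r \<delta> "X i" "D i" f .
      have x': "x \<in> {l..r}" using x(1) by (simp add: segment_def)
      have "\<kappa> < x - l" "\<kappa> < r - x"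
        using infdist_le[of l "{l, r}" x] infdist_le[of r "{l, r}" x] x(2) x' by (auto simp: dist_real_def)
      then show "has_dim (class_ring :: 'k ring) (ball_restriction_image a (X i) (D i) x \<epsilon>\<^sub>1 \<epsilon>\<^sub>2)
               (if a = 0 \<or> a = 1 then 1 else 0)"
        \<comment> \<open>The distance to the endpoints suffices because 10 \<delta> \<le>
          \<open>\<epsilon>\<^sub>1 / 3\<close>, so
          \<open>\<epsilon>\<^sub>2 + 10 * \<delta>\<close> is below
          \<open>2 * \<epsilon>\<^sub>2\<close> and hence below \<kappa>.\<close>
        using * \<delta> by (intro interior_ball_image[OF X(1) x']) auto
    qed
  next
    fix x \<epsilon>\<^sub>1 \<epsilon>\<^sub>2 :: real assume x: "x \<in> {l, r}" and *: "0 < \<epsilon>\<^sub>1 \<and> \<epsilon>\<^sub>1 < \<epsilon>\<^sub>2 \<and> \<epsilon>\<^sub>2 < (r - l) / 100"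
    define \<delta> where "\<delta> = min \<epsilon>\<^sub>1 (\<epsilon>\<^sub>2 - \<epsilon>\<^sub>1) / 30"
    have "\<delta> > 0" "\<delta> \<le> \<epsilon>\<^sub>1 / 30" "\<delta> \<le> (\<epsilon>\<^sub>2 - \<epsilon>\<^sub>1) / 30" using * by (auto simp: \<delta>_def)
    then have \<delta>: "\<delta> > 0" "30 * \<delta> \<le> \<epsilon>\<^sub>1" "\<epsilon>\<^sub>1 + 20 * \<delta> \<le> \<epsilon>\<^sub>2" by argo+
    show "\<forall>\<^sub>F i in sequentially. \<forall>a. has_dim (class_ring :: 'k ring)
        (ball_restriction_image a (X i) (D i) x \<epsilon>\<^sub>1 \<epsilon>\<^sub>2) (if a = 0 then 1 else 0)"
      using approx[OF \<delta>(1)]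
    proof eventually_elim
      fix i assume "\<exists>f. segment_approximation l r \<delta> (X i) (D i) f"
      then obtain f where "segment_approximation l r \<delta> (X i) (D i) f" ..
      then interpret segment_approximation l r \<delta> "X i" "D i" f .
      show "\<forall>a. has_dim (class_ring :: 'k ring)
          (ball_restriction_image a (X i) (D i) x \<epsilon>\<^sub>1 \<epsilon>\<^sub>2) (if a = 0 then 1 else 0)"
        using * \<delta> nondegenerate by (intro allI endpoint_ball_image[OF X(1) x]) auto
    qed
  qed
qed

end
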